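(* For every $g\ge1$, $$\varrho_g>\frac{\sqrt3\,\pi^3}{2}\,\Gamma\!\left(2+\tfrac g2\right)^{-\frac4g}.$$
   Context: For $t\in\mathrm{Sym}_g(\mathbb{Q})$ and $m\in\mathbb{Q}$, $t$ represents $m$ if there is $0\ne v\in\mathbb{Z}^g$ with ${}^tv\,t\,v=m$. For a nonzero Siegel modular form $f(\tau)=\sum_{t\ge0}c(f;t)e(t\tau)$ ($e(x)=\exp(2\pi i\,\mathrm{tr}\,x)$) of genus $g$ and weight $k$ for $\mathrm{Sp}_{2g}(\mathbb{Z})$, its vanishing order is $\mathrm{ord}\,f=\inf\{m\in\mathbb{Q}:\exists t$ with $c(f;t)\ne0$ and $t$ represents $m\}$, and its slope is $\varrho(f)=k/\mathrm{ord}\,f$. $\varrho_g$ is the infimum of $\varrho(f)$ over all nonzero scalar-valued Siegel modular forms $f$ of genus $g$ (of any weight) for $\mathrm{Sp}_{2g}(\mathbb{Z})$. $\Gamma$ is the Gamma function. *)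

theory Defs
  imports "HOL-Analysis.Analysis"
begin

text \<open>
  The genus is \<open>CARD('n)\<close> throughout, for an arbitrary finite index type \<open>'n\<close>;
  $2g \times 2g$ matrices are indexed by \<open>'n + 'n\<close>, so that the constructors \<open>Inl\<close> and
  \<open>Inr\<close> select the $g \times g$ blocks.
\<close>

definition siegel_space :: "(complex^('n::finite)^'n) set" where
  "siegel_space = {\<tau>. transpose \<tau> = \<tau> \<and>
     (\<forall>x::real^'n. x \<noteq> 0 \<longrightarrow> 0 < x \<bullet> (map_matrix Im \<tau> *v x))}"

definition symplectic_form :: "int^('n::finite + 'n)^('n + 'n)" where
  "symplectic_form = (\<chi> i j. case (i, j) of
       (Inl a, Inr b) \<Rightarrow> if a = b then 1 else 0
     | (Inr a, Inl b) \<Rightarrow> if a = b then -1 else 0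
     | _ \<Rightarrow> 0)"

definition Sp_int :: "(int^('n::finite + 'n)^('n + 'n)) set" where
  "Sp_int = {M. transpose M ** symplectic_form ** M = symplectic_form}"

definition block_A :: "int^('n::finite + 'n)^('n + 'n) \<Rightarrow> complex^'n^'n" where
  "block_A M = (\<chi> i j. of_int (M $ Inl i $ Inl j))"

definition block_B :: "int^('n::finite + 'n)^('n + 'n) \<Rightarrow> complex^'n^'n" where
  "block_B M = (\<chi> i j. of_int (M $ Inl i $ Inr j))"

definition block_C :: "int^('n::finite + 'n)^('n + 'n) \<Rightarrow> complex^'n^'n" where
  "block_C M = (\<chi> i j. of_int (M $ Inr i $ Inl j))"

definition block_D :: "int^('n::finite + 'n)^('n + 'n) \<Rightarrow> complex^'n^'n" where
  "block_D M = (\<chi> i j. of_int (M $ Inr i $ Inr j))"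

definition siegel_factor :: "int^('n::finite + 'n)^('n + 'n) \<Rightarrow> complex^'n^'n \<Rightarrow> complex^'n^'n" where
  "siegel_factor M \<tau> = block_C M ** \<tau> + block_D M"

definition siegel_action :: "int^('n::finite + 'n)^('n + 'n) \<Rightarrow> complex^'n^'n \<Rightarrow> complex^'n^'n" where
  "siegel_action M \<tau> = (block_A M ** \<tau> + block_B M) ** matrix_inv (siegel_factor M \<tau>)"

text \<open>
  The Siegel space is open in the symmetric matrices, not in all matrices, so the derivative is
  taken within it; holomorphy means that the real derivative can be chosen complex linear.
\<close>

definition siegel_holomorphic :: "(complex^('n::finite)^'n \<Rightarrow> complex) \<Rightarrow> bool" where
  "siegel_holomorphic f \<longleftrightarrow> (\<forall>\<tau>\<in>siegel_space. \<exists>L.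
     (f has_derivative L) (at \<tau> within siegel_space) \<and>
     (\<forall>c X. L (map_matrix ((*) c) X) = c * L X))"

definition exp_tr :: "complex^('n::finite)^'n \<Rightarrow> complex" where
  "exp_tr X = exp (2 * of_real pi * \<i> * trace X)"

definition psd_rat :: "(rat^('n::finite)^'n) set" where
  "psd_rat = {t. transpose t = t \<and>
     (\<forall>x::real^'n. 0 \<le> x \<bullet> (map_matrix of_rat t *v x))}"

definition has_fourier_expansion ::
    "(complex^('n::finite)^'n \<Rightarrow> complex) \<Rightarrow> (rat^'n^'n \<Rightarrow> complex) \<Rightarrow> bool" where
  "has_fourier_expansion f c \<longleftrightarrow>
     (\<forall>t. t \<notin> psd_rat \<longrightarrow> c t = 0) \<and>
     (\<forall>\<tau>\<in>siegel_space.
        ((\<lambda>t. c t * exp_tr (map_matrix of_rat t ** \<tau>)) has_sum f \<tau>) psd_rat)"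

text \<open>
  The existence of an expansion over positive semidefinite \<open>t\<close> is the condition of
  holomorphy at the cusp if the genus is 1; in higher genus it is automatic (Koecher principle).
  Values of \<open>f\<close> outside the Siegel space are irrelevant.
\<close>

definition siegel_modular_form :: "int \<Rightarrow> (complex^('n::finite)^'n \<Rightarrow> complex) \<Rightarrow> bool" where
  "siegel_modular_form k f \<longleftrightarrow>
     siegel_holomorphic f \<and>
     (\<forall>M\<in>Sp_int. \<forall>\<tau>\<in>siegel_space.
        f (siegel_action M \<tau>) = det (siegel_factor M \<tau>) powi k * f \<tau>) \<and>
     (\<exists>c. has_fourier_expansion f c)"

text \<open>The coefficients are uniquely determined by the values of \<open>f\<close> on the Siegel space.\<close>

definition fourier_coeff :: "(complex^('n::finite)^'n \<Rightarrow> complex) \<Rightarrow> rat^'n^'n \<Rightarrow> complex" where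
  "fourier_coeff f = (SOME c. has_fourier_expansion f c)"

definition represents :: "rat^('n::finite)^'n \<Rightarrow> rat \<Rightarrow> bool" where
  "represents t m \<longleftrightarrow> (\<exists>v::int^'n. v \<noteq> 0 \<and>
     (\<Sum>i\<in>UNIV. \<Sum>j\<in>UNIV. of_int (v $ i) * t $ i $ j * of_int (v $ j)) = m)"

text \<open>
  For a nonzero form the set below is nonempty and bounded below by 0, so that the infimum
  of reals is the intended one.
\<close>

definition vanishing_order :: "(complex^('n::finite)^'n \<Rightarrow> complex) \<Rightarrow> real" where
  "vanishing_order f =
     Inf {of_rat m | m. \<exists>t. fourier_coeff f t \<noteq> 0 \<and> represents t m}"

text \<open>
  A form of vanishing order 0 has slope $\infty$. This includes the nonzero constants, for which
  $k / \mathrm{ord} f$ reads $0 / 0$; counting them with slope 0 would make every minimal slope 0.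
\<close>

definition slope :: "int \<Rightarrow> (complex^('n::finite)^'n \<Rightarrow> complex) \<Rightarrow> ereal" where
  "slope k f = (if vanishing_order f = 0 then \<infinity> else ereal (of_int k / vanishing_order f))"

definition minimal_slope :: "'n::finite itself \<Rightarrow> ereal" where
  "minimal_slope _ = Inf {slope k f | k (f :: complex^'n^'n \<Rightarrow> complex).
     siegel_modular_form k f \<and> (\<exists>\<tau>\<in>siegel_space. f \<tau> \<noteq> 0)}"

end

theory Submission
  imports Defs "HOL-Complex_Analysis.Conformal_Mappings"
begin

text \<open>
  Let \<open>y\<close> be the imaginary part of \<open>\<tau>\<close>. The function $\varphi = (\det y)^{k/2} |f|$ is invariant under the
  symplectic group, and it is bounded if $m = \mathrm{ord} f > 0$. Replacing \<open>\<tau>\<close> by an equivalent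
  point we may assume that \<open>y\<close> has minimum at least \<open>r\<close> on nonzero integral vectors, for any
  $r < \sqrt 3/2$. By Hermite's inequality, applied to \<open>y\<close> and to its inverse, some integral
  \<open>v \<noteq> 0\<close> satisfies $y^{-1}[v] \le \gamma^2 / r$, where $\gamma$ is close to Hermite's constant.
  The function $f(\tau + s v\,{}^tv)$ of one variable \<open>s\<close> decays like $e^{- 2\pi m\,\mathrm{Im}\,s}$, so by the
  maximum principle it grows by the factor $e^{2\pi m\beta a}$ at some point with
  $\mathrm{Im}\,s = - \beta a$, where $a = 1 / y^{-1}[v]$, while the determinant is multiplied by
  $1 - \beta$. Comparing with the supremum of $\varphi$ and letting $\beta \to 0$ gives
  $k \ge 4\pi m a$, hence $k/m \ge 4\pi r/\gamma^2$. Blichfeldt's bound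
  $\gamma < \frac{2}{\pi} \Gamma(2 + g/2)^{2/g}$ completes the proof.
\<close>

section \<open>Positive definite forms\<close>

text \<open>The inequality is strict although the slope is an infimum over all forms, so the
  strictness must be uniform in \<open>f\<close>. It comes from a constant strictly below
  Blichfeldt's bound; this margin also pays for taking \<open>r\<close> below sqrt 3 / 2. The value
  sqrt 3 / 2 is the lowest height in the classical fundamental domain of SL_2(Z); it enters because
  translations and an inversion in a single coordinate already suffice to raise a low point. For
  this to stop, det y must be bounded on each orbit. That is the main obstacle, and it is met by an
  invariant of the orbit: the lattice \<tau> Z^g + Z^g with the Hermitian form y^{-1}, whose minimum
  bounds det y through Hermite's inequality. No extremum is claimed to be attained: shortest
  vectors, points of maximal determinant and the supremum of the invariant function are replaced by
  nearly extremal choices, and one fixed \<beta> with a gain above 1 stands in for the limit.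
  Boundedness takes more than a lower bound for the minimum of y: a reduced basis makes y comparable
  to its diagonal, and then exponential decay in the trace of y outweighs powers of det y.\<close>

definition qf :: "real^'n^'n \<Rightarrow> real^'n \<Rightarrow> real"
  where "qf y x = x \<bullet> (y *v x)"

definition posdef :: "real^'n^'n \<Rightarrow> bool"
  where "posdef y \<longleftrightarrow> transpose y = y \<and> (\<forall>x. x \<noteq> 0 \<longrightarrow> 0 < qf y x)"

definition outer :: "'a::semiring_1^'n \<Rightarrow> 'a^'n^'n"
  where "outer v = (\<chi> i j. v $ i * v $ j)"

definition rvec :: "int^'n \<Rightarrow> real^'n"
  where "rvec v = (\<chi> i. of_int (v $ i))"

lemma inner_matrix_vector:
  fixes A :: "real^'n^'m"
  shows "x \<bullet> (A *v z) = (transpose A *v x) \<bullet> z"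
  by (simp add: dot_lmul_matrix)

lemma qf_transform: "qf y (B *v z) = qf (transpose B ** y ** B) z"
  using inner_matrix_vector[of z "transpose B" "y *v (B *v z)"]
  by (simp add: qf_def matrix_vector_mul_assoc matrix_mul_assoc)

lemma qf_mat_1: "qf (mat 1) z = (norm z)\<^sup>2"
  by (simp add: qf_def power2_norm_eq_inner)

lemma qf_zero [simp]: "qf y 0 = 0"
  by (simp add: qf_def)

lemma qf_scaleR_left: "qf (c *\<^sub>R y) x = c * qf y x"
  by (simp add: qf_def flip: scaleR_matrix_vector_assoc)

lemma qf_diff_left: "qf (y - z) x = qf y x - qf z x"
  by (simp add: qf_def matrix_vector_mult_diff_rdistrib inner_diff_right)

lemma matrix_add_rdistrib: "(B + C) ** A = B ** A + (C :: 'a::semiring_1^'n^'m) ** A"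
  by (simp add: vec_eq_iff matrix_matrix_mult_def distrib_right sum.distrib)

lemma matrix_diff_ldistrib: "A ** (B - C) = A ** B - A ** (C :: 'a::ring_1^'n^'m)"
  by (simp add: vec_eq_iff matrix_matrix_mult_def right_diff_distrib sum_subtractf)

lemma matrix_diff_rdistrib: "(B - C) ** A = B ** A - (C :: 'a::ring_1^'n^'m) ** A"
  by (simp add: vec_eq_iff matrix_matrix_mult_def left_diff_distrib sum_subtractf)

lemma matrix_scaleR_left: "(c *\<^sub>R A) ** B = c *\<^sub>R (A ** (B :: real^'n^'m))"
  by (simp add: vec_eq_iff matrix_matrix_mult_def sum_distrib_left mult_ac)

lemma matrix_scaleR_right: "A ** (c *\<^sub>R B) = c *\<^sub>R (A ** (B :: real^'n^'m))"
  by (simp add: vec_eq_iff matrix_matrix_mult_def sum_distrib_left mult_ac)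

lemma outer_mult_vector: "outer v *v (x::real^'n) = (v \<bullet> x) *\<^sub>R v"
  by (simp add: vec_eq_iff outer_def matrix_vector_mult_def inner_vec_def sum_distrib_left
      sum_distrib_right mult_ac)

lemma qf_outer: "qf (outer v) x = (v \<bullet> x)\<^sup>2"
  by (simp add: qf_def outer_mult_vector inner_commute power2_eq_square)

lemma qf_nonneg: "posdef y \<Longrightarrow> 0 \<le> qf y x"
  by (cases "x = 0") (auto simp: posdef_def less_imp_le)

lemma transpose_outer [simp]: "transpose (outer v) = outer (v :: 'a::comm_semiring_1^'n)"
  by (simp add: outer_def transpose_def vec_eq_iff mult.commute)

text \<open>Gram-Schmidt by counting dimensions: while fewer than n vectors are chosen, their images
  under \<open>y\<close> span a proper subspace, and a vector Euclidean-orthogonal to it is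
  orthogonal for the form \<open>y\<close>.\<close>

lemma posdef_imp_orthonormal_family:
  fixes y :: "real^'n^'n"
  assumes "posdef y"
  shows "\<exists>b::'n \<Rightarrow> real^'n. \<forall>i\<in>S. \<forall>j\<in>S. b i \<bullet> (y *v b j) = (if i = j then 1 else 0)"
  using finite[of S]
proof induction
  case empty
  show ?case by simp
next
  case (insert k S)
  then obtain b :: "'n \<Rightarrow> real^'n"
    where b: "\<And>i j. i \<in> S \<Longrightarrow> j \<in> S \<Longrightarrow> b i \<bullet> (y *v b j) = (if i = j then 1 else 0)"
    by blast
  have "dim ((\<lambda>j. y *v b j) ` S) \<le> card ((\<lambda>j. y *v b j) ` S)"
    by (simp add: dim_le_card')
  also have "\<dots> \<le> card S"
    using insert by (simp add: card_image_le)
  also have "\<dots> < card (insert k S)"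
    using insert by simp
  also have "\<dots> \<le> CARD('n)"
    by (simp add: card_mono)
  finally have "dim ((\<lambda>j. y *v b j) ` S) < DIM(real^'n)"
    by simp
  then obtain x where x: "x \<noteq> 0" and "\<And>z. z \<in> span ((\<lambda>j. y *v b j) ` S) \<Longrightarrow> orthogonal x z"
    using orthogonal_to_subspace_exists by blast
  then have orth: "x \<bullet> (y *v b j) = 0" if "j \<in> S" for j
    using that by (auto simp: orthogonal_def span_base)
  have sym: "u \<bullet> (y *v w) = w \<bullet> (y *v u)" for u w
    using assms by (metis inner_commute inner_matrix_vector posdef_def)
  have orth': "b j \<bullet> (y *v x) = 0" if "j \<in> S" for j
    using orth[OF that] sym by metis
  have pos: "0 < x \<bullet> (y *v x)"
    using assms x by (auto simp: posdef_def qf_def)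
  define b' where "b' = b(k := (1 / sqrt (x \<bullet> (y *v x))) *\<^sub>R x)"
  have "b' i \<bullet> (y *v b' j) = (if i = j then 1 else 0)" if "i \<in> insert k S" "j \<in> insert k S" for i j
    using that insert.hyps(2) pos orth orth' b
    by (auto simp: b'_def matrix_vector_mult_scaleR)
  then show ?case by blast
qed

text \<open>\<open>B\<close> plays the part of y^{-1/2}. From here on the inverse of
  \<open>y\<close> appears as \<open>B ** transpose B\<close>, and its form at v as the squared norm
  of \<open>transpose B *v v\<close>.\<close>

lemma posdef_imp_congruent_mat_1:
  fixes y :: "real^'n^'n"
  assumes "posdef y"
  obtains B :: "real^'n^'n" where "transpose B ** y ** B = mat 1"
proof -
  obtain b :: "'n \<Rightarrow> real^'n"
    where b: "\<And>i j. b i \<bullet> (y *v b j) = (if i = j then 1 else 0)"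
    using posdef_imp_orthonormal_family[OF assms, of UNIV] by blast
  define B :: "real^'n^'n" where "B = (\<chi> i j. b j $ i)"
  have "(transpose B ** (y ** B)) $ i $ j = b i \<bullet> (y *v b j)" for i j
    by (simp add: B_def transpose_def matrix_matrix_mult_def matrix_vector_mult_def inner_vec_def)
  then have "transpose B ** y ** B = mat 1"
    by (simp add: vec_eq_iff b mat_def matrix_mul_assoc)
  then show ?thesis using that by blast
qed

lemma
  fixes y B :: "real^'n^'n"
  assumes B: "transpose B ** y ** B = mat 1"
  shows congruent_mat_1_inverse: "B ** (transpose B ** y) = mat 1" "y ** (B ** transpose B) = mat 1"
    and congruent_mat_1_det: "det y * (det B)\<^sup>2 = 1"
proof -
  show 1: "B ** (transpose B ** y) = mat 1"
    using B by (rule matrix_left_right_inverse[THEN iffD1])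
  then have "(B ** transpose B) ** y = mat 1"
    by (simp only: matrix_mul_assoc)
  then show "y ** (B ** transpose B) = mat 1"
    by (rule matrix_left_right_inverse[THEN iffD1])
  show "det y * (det B)\<^sup>2 = 1"
    using arg_cong[OF B, of det] by (simp add: det_mul power2_eq_square mult_ac)
qed

lemma qf_mult_transpose: "qf (B ** transpose B) v = (norm (transpose B *v v))\<^sup>2"
  using qf_transform[of "mat 1" "transpose B" v] by (simp add: qf_mat_1)

lemma congruent_mat_1_posdef_inverse:
  fixes y B :: "real^'n^'n"
  assumes B: "transpose B ** y ** B = mat 1"
  shows "posdef (B ** transpose B)"
  unfolding posdef_def
proof (intro conjI allI impI)
  show "transpose (B ** transpose B) = B ** transpose B"
    by (simp add: matrix_transpose_mul)
  fix v :: "real^'n" assume "v \<noteq> 0"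
  have "transpose B *v v \<noteq> 0"
  proof
    assume *: "transpose B *v v = 0"
    have "v = (y ** (B ** transpose B)) *v v"
      by (simp add: congruent_mat_1_inverse[OF B])
    also have "\<dots> = y *v (B *v (transpose B *v v))"
      by (simp only: matrix_vector_mul_assoc matrix_mul_assoc)
    finally show False using * \<open>v \<noteq> 0\<close> by simp
  qed
  then show "0 < qf (B ** transpose B) v" by (simp add: qf_mult_transpose)
qed

lemma posdef_det_pos:
  fixes y :: "real^'n^'n"
  assumes "posdef y"
  shows "0 < det y"
proof -
  obtain B :: "real^'n^'n" where "transpose B ** y ** B = mat 1"
    by (rule posdef_imp_congruent_mat_1[OF assms])
  then have "0 < det y * (det B)\<^sup>2" by (simp add: congruent_mat_1_det)
  then show ?thesis by (simp add: zero_less_mult_iff)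
qed

section \<open>Rank-one updates of a positive definite form\<close>

lemma norm_axis: "norm (axis k r :: real^'n) = \<bar>r\<bar>"
  by (simp add: norm_eq_sqrt_inner inner_axis_axis)

text \<open>A rotation carries \<open>w\<close> to a multiple of a coordinate vector; there the
  matrix is diagonal with at most one entry different from 1.\<close>

lemma det_mat_1_minus_outer:
  fixes w :: "real^'n"
  shows "det (mat 1 - c *\<^sub>R outer w) = 1 - c * (norm w)\<^sup>2"
proof -
  fix k :: 'n
  obtain f where f: "orthogonal_transformation f" "f (axis k (norm w)) = w"
    using orthogonal_transformation_exists[of "axis k (norm w)" w] norm_axis[of k "norm w"] by auto
  define Q where "Q = matrix f"
  have Q: "transpose Q ** Q = mat 1"
    using f by (simp add: Q_def orthogonal_transformation_matrix orthogonal_matrix)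
  then have Q': "Q ** transpose Q = mat 1"
    by (rule matrix_left_right_inverse[THEN iffD1])
  have lin: "linear f" using f by (simp add: orthogonal_transformation_linear)
  have w: "w = Q *v axis k (norm w)"
    using f lin by (simp add: Q_def matrix_works)
  have out: "outer (Q *v z) = Q ** outer z ** transpose Q" for z :: "real^'n"
    by (simp add: vec_eq_iff outer_def matrix_matrix_mult_def matrix_vector_mult_def transpose_def
        sum_distrib_left sum_distrib_right mult_ac)
  have "mat 1 - c *\<^sub>R outer w = Q ** (mat 1 - c *\<^sub>R outer (axis k (norm w))) ** transpose Q"
    by (subst w, simp add: out matrix_diff_ldistrib matrix_diff_rdistrib Q'
        matrix_scaleR_left matrix_scaleR_right)
  moreover have "det Q * det (transpose Q) = 1"
    using arg_cong[OF Q', of det] by (simp add: det_mul)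
  ultimately have "det (mat 1 - c *\<^sub>R outer w) = det (mat 1 - c *\<^sub>R outer (axis k (norm w)))"
    by (simp add: det_mul mult_ac)
  also have "\<dots> = (\<Prod>i\<in>UNIV. (mat 1 - c *\<^sub>R outer (axis k (norm w))) $ i $ i)"
    by (rule det_diagonal) (auto simp: mat_def outer_def axis_def)
  also have "\<dots> = (\<Prod>i\<in>UNIV. if i = k then 1 - c * (norm w)\<^sup>2 else 1)"
    by (rule prod.cong) (auto simp: mat_def outer_def axis_def power2_eq_square)
  finally show ?thesis by simp
qed

text \<open>Congruence by \<open>B\<close> reduces to the identity matrix minus a multiple of the
  rank-one matrix of w = \<open>transpose B *v v\<close>, and Cauchy-Schwarz does the rest. The
  condition reads c y^{-1}[v] < 1, so it measures how far a point can move down in direction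
  \<open>outer v\<close>; negative \<open>c\<close>, a move upwards, is covered too.\<close>

lemma posdef_rank_one_update:
  fixes y B :: "real^'n^'n"
  assumes y: "posdef y" and B: "transpose B ** y ** B = mat 1"
    and v: "c * (norm (transpose B *v v))\<^sup>2 < 1"
  shows "posdef (y - c *\<^sub>R outer v)"
    and "det (y - c *\<^sub>R outer v) = det y * (1 - c * (norm (transpose B *v v))\<^sup>2)"
proof -
  define w where "w = transpose B *v v"
  have out: "outer w = transpose B ** outer v ** B"
    by (simp add: w_def vec_eq_iff outer_def matrix_matrix_mult_def matrix_vector_mult_def transpose_def
        sum_distrib_left sum_distrib_right mult_ac)
  have eq: "transpose B ** (y - c *\<^sub>R outer v) ** B = mat 1 - c *\<^sub>R outer w"
    by (simp add: out matrix_diff_ldistrib matrix_diff_rdistrib B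
        matrix_scaleR_left matrix_scaleR_right)
  have "det (y - c *\<^sub>R outer v) * (det B)\<^sup>2 = 1 - c * (norm w)\<^sup>2"
    using arg_cong[OF eq, of det] by (simp add: det_mul det_mat_1_minus_outer power2_eq_square mult_ac)
  then show "det (y - c *\<^sub>R outer v) = det y * (1 - c * (norm (transpose B *v v))\<^sup>2)"
    using congruent_mat_1_det[OF B] unfolding w_def by algebra
  have inv: "B *v ((transpose B ** y) *v x) = x" for x
    by (simp add: matrix_vector_mul_assoc congruent_mat_1_inverse[OF B])
  have "0 < qf (y - c *\<^sub>R outer v) x" if "x \<noteq> 0" for x
  proof -
    define z where "z = (transpose B ** y) *v x"
    have xz: "x = B *v z" using inv z_def by simp
    have "z \<noteq> 0" using xz that by auto
    have "qf (y - c *\<^sub>R outer v) x = (norm z)\<^sup>2 - c * (w \<bullet> z)\<^sup>2"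
      unfolding xz qf_transform eq by (simp add: qf_diff_left qf_scaleR_left qf_mat_1 qf_outer)
    also have "\<dots> > 0"
    proof (cases "c \<le> 0")
      case True
      then show ?thesis using \<open>z \<noteq> 0\<close>
        by (simp add: add_pos_nonneg diff_conv_add_uminus mult_nonpos_nonneg del: add_uminus_conv_diff)
    next
      case False
      have "(w \<bullet> z)\<^sup>2 \<le> (norm w)\<^sup>2 * (norm z)\<^sup>2"
        using Cauchy_Schwarz_ineq2[of w z] by (metis abs_ge_zero power2_abs power_mono power_mult_distrib)
      then have "c * (w \<bullet> z)\<^sup>2 \<le> (c * (norm w)\<^sup>2) * (norm z)\<^sup>2"
        using False by (simp add: mult.assoc)
      also have "\<dots> < 1 * (norm z)\<^sup>2"
        using v \<open>z \<noteq> 0\<close> unfolding w_def by (intro mult_strict_right_mono) auto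
      finally show ?thesis by simp
    qed
    finally show ?thesis .
  qed
  moreover have "transpose (y - c *\<^sub>R outer v) = y - c *\<^sub>R outer v"
    using y by (simp add: posdef_def vec_eq_iff transpose_def outer_def mult.commute)
  ultimately show "posdef (y - c *\<^sub>R outer v)"
    by (simp add: posdef_def)
qed

section \<open>Blichfeldt's bound for Hermite's constant\<close>

text \<open>
  The library states the linear change of variables only for well-ordered index types.
\<close>
lemma measure_linear_image_finite_type:
  fixes f :: "real^'n \<Rightarrow> real^'n"
  assumes "linear f"
  shows "\<forall>S\<in>lmeasurable. f ` S \<in> lmeasurable
    \<and> measure lebesgue (f ` S) = \<bar>det (matrix f)\<bar> * measure lebesgue S"
    (is "\<forall>S\<in>_. ?P f S")
proof (rule induct_linear_elementary[OF \<open>linear f\<close>]; intro ballI)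
  fix f g :: "real^'n \<Rightarrow> real^'n" and S :: "(real^'n) set"
  assume f: "linear f" "\<forall>S\<in>lmeasurable. ?P f S" and g: "linear g" "\<forall>S\<in>lmeasurable. ?P g S"
    and "S \<in> lmeasurable"
  then show "?P (f \<circ> g) S"
    using matrix_compose[of g f]
    by (simp only: det_mul abs_mult flip: image_comp) simp
next
  fix f :: "real^'n \<Rightarrow> real^'n" and i and S :: "(real^'n) set"
  assume f: "linear f" "\<And>x. f x $ i = 0"
  then have "f x \<noteq> axis i 1" for x by (metis axis_nth zero_neq_one)
  then have "\<not> surj f" by (metis surjD)
  then have "\<not> inj f" using f linear_injective_imp_surjective by blast
  then have "negligible (f ` S)" "det (matrix f) = 0"
    using f negligible_linear_singular_image det_nz_iff_inj by blast+
  then show "?P f S"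
    using negligible_iff_measure by auto
next
  fix c :: "'n \<Rightarrow> real" and S :: "(real^'n) set"
  assume "S \<in> lmeasurable"
  then show "?P (\<lambda>x. \<chi> i. c i * x $ i) S"
    by (simp add: measurable_stretch measure_stretch matrix_def det_diagonal axis_def)
next
  fix m n :: 'n and S :: "(real^'n) set"
  assume S: "S \<in> lmeasurable" "m \<noteq> n"
  let ?p = "Transposition.transpose m n"
  let ?h = "\<lambda>x :: real^'n. \<chi> i. x $ ?p i"
  have p: "?p permutes UNIV" by (simp add: permutes_swap_id)
  have lin: "linear ?h" by (rule linearI) (simp_all add: vec_eq_iff)
  have img: "?h ` cbox a b = cbox (?h a) (?h b)" for a b
  proof (intro equalityI subsetI)
    fix x assume "x \<in> cbox (?h a) (?h b)"
    then have le: "a $ ?p i \<le> x $ i \<and> x $ i \<le> b $ ?p i" for i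
      by (simp add: mem_box_cart)
    have "a $ i \<le> ?h x $ i \<and> ?h x $ i \<le> b $ i" for i
      using le[of "?p i"] by simp
    then show "x \<in> ?h ` cbox a b"
      by (intro image_eqI[of _ _ "?h x"]) (simp_all add: mem_box_cart vec_eq_iff)
  qed (auto simp: mem_box_cart)
  have "measure lebesgue (?h ` cbox a b) = 1 * measure lebesgue (cbox a b)" for a b
  proof (cases "cbox a b = {}")
    case False
    moreover have "cbox (?h a) (?h b) \<noteq> {}" using False img by (metis image_is_empty)
    moreover have "(\<Prod>i\<in>UNIV. b $ ?p i - a $ ?p i) = (\<Prod>i\<in>UNIV. b $ i - a $ i)"
      using prod.permute[OF p, of "\<lambda>i. b $ i - a $ i"] by (simp add: o_def)
    ultimately show ?thesis unfolding img by (simp add: content_cbox_cart)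
  qed simp
  moreover have "matrix ?h = (\<chi> i j. mat 1 $ i $ ?p j)"
    by (auto simp: matrix_def axis_def mat_def vec_eq_iff)
  ultimately show "?P ?h S"
    using measure_linear_sufficient[OF lin S(1), of 1] S(2)
    by (simp add: det_permute_columns[OF p] sign_swap_id)
next
  fix m n :: 'n and S :: "(real^'n) set"
  assume mn: "m \<noteq> n" and S: "S \<in> lmeasurable"
  let ?h = "\<lambda>x :: real^'n. \<chi> i. if i = m then x $ m + x $ n else x $ i"
  have lin: "linear ?h" by (rule linearI) (simp_all add: vec_eq_iff algebra_simps)
  have "measure lebesgue (?h ` cbox a b) = 1 * measure lebesgue (cbox a b)" for a b
  proof (cases "cbox a b = {}")
    case False
    \<comment> \<open>The formula for sheared boxes wants a nonnegative coordinate \<open>n\<close>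
      at the lower corner. This translation makes it 0, and the shear turns translations into
      translations, which preserve the measure.\<close>
    define s where "s = axis n (- a $ n)"
    have st: "cbox (s + a) (s + b) = (+) s ` cbox a b"
      by (simp add: cbox_translation)
    then have hs: "?h ` cbox (s + a) (s + b) = (+) (?h s) ` ?h ` cbox a b"
      unfolding st image_image by (intro image_cong refl) (auto simp: vec_eq_iff)
    have "cbox (s + a) (s + b) \<noteq> {}" "0 \<le> (s + a) $ n"
      using False unfolding st by (auto simp: s_def)
    from measure_shear_interval[OF mn this]
    show ?thesis
      unfolding hs unfolding st measure_translation by simp
  qed simp
  moreover have "matrix ?h = (\<chi> k. if k = m then row m (mat 1) + 1 *s row n (mat 1) else row k (mat 1))"
    using mn by (auto simp: matrix_def axis_def mat_def vec_eq_iff row_def)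
  then have "det (matrix ?h) = 1"
    by (simp only: det_row_operation[OF mn] det_I)
  ultimately show "?P ?h S"
    using measure_linear_sufficient[OF lin S, of 1] by simp
qed

text \<open>
  Blichfeldt's density is $\max(0, 2 - t)$. Raising it to \<open>2\<close> near \<open>0\<close> does not destroy the estimate
  below, since a lattice point this close to the origin excludes all others from the support; the gain
  makes the resulting bound for Hermite's constant strict.
\<close>
definition blichfeldt_weight :: "real \<Rightarrow> real"
  where "blichfeldt_weight t = (if t < 1/4 then 2 else max 0 (2 - t))"

lemma blichfeldt_weight_nonneg: "0 \<le> blichfeldt_weight t"
  by (simp add: blichfeldt_weight_def)

lemma blichfeldt_weight_measurable [measurable]: "blichfeldt_weight \<in> borel_measurable borel"
  unfolding blichfeldt_weight_def by measurable

text \<open>Dropping the last square shows that points far from each other cannot all be close to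
  the origin; this is the geometric core of Blichfeldt's method.\<close>

lemma sum_sum_norm_diff_squared:
  fixes p :: "'i \<Rightarrow> 'a::real_inner"
  shows "(\<Sum>i\<in>G. \<Sum>j\<in>G. (norm (p i - p j))\<^sup>2)
    = 2 * card G * (\<Sum>i\<in>G. (norm (p i))\<^sup>2) - 2 * (norm (\<Sum>i\<in>G. p i))\<^sup>2"
proof -
  have "(\<Sum>i\<in>G. \<Sum>j\<in>G. (norm (p i - p j))\<^sup>2)
    = (\<Sum>i\<in>G. \<Sum>j\<in>G. (norm (p i))\<^sup>2 + (norm (p j))\<^sup>2 - 2 * (p i \<bullet> p j))"
    by (simp add: power2_norm_eq_inner inner_diff algebra_simps inner_commute)
  also have "\<dots> = 2 * card G * (\<Sum>i\<in>G. (norm (p i))\<^sup>2) - 2 * ((\<Sum>i\<in>G. p i) \<bullet> (\<Sum>j\<in>G. p j))"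
    by (simp add: sum_subtractf sum.distrib inner_sum_left inner_sum_right
        flip: sum_distrib_left) (rule sum.swap)
  finally show ?thesis by (simp add: power2_norm_eq_inner)
qed

text \<open>If k points of the support all have weight 2 - |p|^2, the k (k - 1) ordered pairs
  contribute at least 4 each, so the squared norms add up to at least 2 (k - 1) and the weights to
  at most 2. If some point has norm below 1/2, every other one has squared norm at least 9/4 > 2 and
  weight 0.\<close>

lemma sum_blichfeldt_weight_le:
  fixes p :: "'i \<Rightarrow> 'a::real_inner"
  assumes fin: "finite F"
    and sep: "\<And>i j. i \<in> F \<Longrightarrow> j \<in> F \<Longrightarrow> i \<noteq> j \<Longrightarrow> 2 \<le> norm (p i - p j)"
  shows "(\<Sum>i\<in>F. blichfeldt_weight ((norm (p i))\<^sup>2)) \<le> 2"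
proof -
  define G where "G = {i \<in> F. (norm (p i))\<^sup>2 < 2}"
  have GF: "G \<subseteq> F" and finG: "finite G" using fin by (auto simp: G_def)
  have sumG: "(\<Sum>i\<in>F. blichfeldt_weight ((norm (p i))\<^sup>2)) = (\<Sum>i\<in>G. blichfeldt_weight ((norm (p i))\<^sup>2))"
    by (rule sum.mono_neutral_right[OF fin GF]) (auto simp: G_def blichfeldt_weight_def)
  show ?thesis
  proof (cases "\<exists>i\<in>G. norm (p i) < 1/2")
    case True
    then obtain i where i: "i \<in> G" "norm (p i) < 1/2" by blast
    have "j = i" if "j \<in> G" for j
    proof (rule ccontr)
      assume "j \<noteq> i"
      then have "2 \<le> norm (p i - p j)" using sep i that GF by blast
      also have "\<dots> \<le> norm (p i) + norm (p j)" by (rule norm_triangle_ineq4)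
      finally have "3/2 \<le> norm (p j)" using i by simp
      then have "(3/2)\<^sup>2 \<le> (norm (p j))\<^sup>2" by (intro power_mono) auto
      then show False using that by (simp add: G_def power2_eq_square)
    qed
    then have "G = {i}" using i by blast
    then show ?thesis unfolding sumG by (simp add: blichfeldt_weight_def)
  next
    case False
    have far: "1/4 \<le> (norm (p i))\<^sup>2" if "i \<in> G" for i
    proof -
      have "(1/2)\<^sup>2 \<le> (norm (p i))\<^sup>2" using False that by (intro power_mono) auto
      then show ?thesis by (simp add: power2_eq_square)
    qed
    have w: "blichfeldt_weight ((norm (p i))\<^sup>2) = 2 - (norm (p i))\<^sup>2" if "i \<in> G" for i
      using far[OF that] that by (simp add: G_def blichfeldt_weight_def)
    show ?thesis
    proof (cases "card G = 0")
      case True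
      then show ?thesis unfolding sumG using finG by simp
    next
      case False
      define k where "k = real (card G)"
      have k: "0 < k" using False by (simp add: k_def)
      have "(\<Sum>i\<in>G. \<Sum>j\<in>G. if i = j then 0 else 4) \<le> (\<Sum>i\<in>G. \<Sum>j\<in>G. (norm (p i - p j))\<^sup>2)"
      proof (intro sum_mono)
        fix i j assume "i \<in> G" "j \<in> G"
        then show "(if i = j then 0 else 4) \<le> (norm (p i - p j))\<^sup>2"
          using power_mono[OF sep[of i j], of 2] GF by auto
      qed
      moreover have "(\<Sum>i\<in>G. \<Sum>j\<in>G. if i = j then 0 else 4) = (\<Sum>i\<in>G. \<Sum>j\<in>G. (4::real) - (if i = j then 4 else 0))"
        by (intro sum.cong) auto
      moreover have "\<dots> = 4 * k * (k - 1)"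
        using finG by (simp add: sum_subtractf k_def algebra_simps)
      moreover have "(\<Sum>i\<in>G. \<Sum>j\<in>G. (norm (p i - p j))\<^sup>2) \<le> 2 * k * (\<Sum>i\<in>G. (norm (p i))\<^sup>2)"
        by (simp add: sum_sum_norm_diff_squared k_def)
      ultimately have "4 * k * (k - 1) \<le> 2 * k * (\<Sum>i\<in>G. (norm (p i))\<^sup>2)"
        by linarith
      then have "2 * k * (2 * (k - 1)) \<le> 2 * k * (\<Sum>i\<in>G. (norm (p i))\<^sup>2)"
        by (simp add: algebra_simps)
      then have "2 * (k - 1) \<le> (\<Sum>i\<in>G. (norm (p i))\<^sup>2)"
        using k by (subst (asm) mult_le_cancel_left_pos) auto
      moreover have "(\<Sum>i\<in>G. blichfeldt_weight ((norm (p i))\<^sup>2)) = 2 * k - (\<Sum>i\<in>G. (norm (p i))\<^sup>2)"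
        using w by (simp add: sum_subtractf k_def)
      ultimately show ?thesis unfolding sumG by simp
    qed
  qed
qed

section \<open>Folding the weight onto the unit cube\<close>

lemma finite_int_box: "finite {l :: int^'n. \<forall>i. l $ i \<in> {- K..K}}"
proof -
  have "{l :: int^'n. \<forall>i. l $ i \<in> {- K..K}} = vec_lambda ` (\<Pi>\<^sub>E i\<in>UNIV. {- K..K})"
  proof (intro equalityI subsetI)
    fix l :: "int^'n" assume "l \<in> {l. \<forall>i. l $ i \<in> {- K..K}}"
    then show "l \<in> vec_lambda ` (\<Pi>\<^sub>E i\<in>UNIV. {- K..K})"
      by (intro image_eqI[of _ _ "vec_nth l"]) auto
  qed auto
  then show ?thesis by (simp add: finite_PiE)
qed

lemma rvec_diff: "rvec (u - v) = rvec u - rvec v"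
  by (simp add: rvec_def vec_eq_iff)

lemma rvec_eq_0_iff [simp]: "rvec v = 0 \<longleftrightarrow> v = 0"
  by (simp add: rvec_def vec_eq_iff)

lemma posdef_eq_norm:
  fixes y :: "real^'n^'n"
  fixes B :: "real^'n^'n"
  assumes "transpose B ** y ** B = mat 1"
  obtains A :: "real^'n^'n" where "\<And>x. qf y x = (norm (A *v x))\<^sup>2" "\<And>x. B *v (A *v x) = x"
proof -
  have 1: "B *v ((transpose B ** y) *v x) = x" for x
    by (simp add: matrix_vector_mul_assoc congruent_mat_1_inverse[OF assms])
  have "qf y x = (norm ((transpose B ** y) *v x))\<^sup>2" for x
    using qf_transform[of y B "(transpose B ** y) *v x"] by (simp add: 1 assms qf_mat_1)
  then show ?thesis using 1 that by blast
qed

lemma qf_measurable [measurable]: "(\<lambda>x. qf y x) \<in> borel_measurable borel"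
  unfolding qf_def by (intro borel_measurable_continuous_onI continuous_intros
    linear_continuous_on_compose[OF continuous_on_id] ) (simp add: matrix_vector_mul_linear)

text \<open>The integral over space is the integral over the unit cube of the sum of all integer
  translates. In the metric of \<open>y\<close> lattice points are at distance at least 2, so this
  sum is at most 2 at every point. The support is bounded, hence finitely many translates
  \<open>F\<close> suffice.\<close>

lemma nn_integral_blichfeldt_weight_le:
  fixes y :: "real^'n^'n"
  assumes pd: "posdef y" and min: "\<And>v. v \<noteq> 0 \<Longrightarrow> 4 \<le> qf y (rvec v)"
  shows "(\<integral>\<^sup>+x. ennreal (blichfeldt_weight (qf y x)) \<partial>lborel) \<le> 2"
proof -
  obtain B :: "real^'n^'n" where B: "transpose B ** y ** B = mat 1"
    by (rule posdef_imp_congruent_mat_1[OF pd])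
  obtain A :: "real^'n^'n" where A: "\<And>x. qf y x = (norm (A *v x))\<^sup>2" "\<And>x. B *v (A *v x) = x"
    using posdef_eq_norm[OF B] by blast
  define W where "W x = ennreal (blichfeldt_weight (qf y x))" for x
  have [measurable]: "W \<in> borel_measurable borel" unfolding W_def by measurable
  \<comment> \<open>Half open, so that every \<open>x\<close> lies in exactly one integer
    translate.\<close>
  define C where "C = {x :: real^'n. \<forall>i. 0 \<le> x $ i \<and> x $ i < 1}"
  have [measurable]: "C \<in> sets borel" unfolding C_def by measurable
  have C1: "emeasure lborel C \<le> 1"
  proof -
    have "C \<subseteq> cbox (0 :: real^'n) (\<chi> i. 1)"
      by (auto simp: C_def mem_box_cart less_imp_le)
    then have "emeasure lborel C \<le> emeasure lborel (cbox (0 :: real^'n) (\<chi> i. 1))"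
      by (intro emeasure_mono) auto
    also have "\<dots> = ennreal (measure lborel (cbox (0 :: real^'n) (\<chi> i. 1)))"
      using emeasure_lborel_cbox_finite[of 0 "(\<chi> i. 1) :: real^'n"]
      by (intro emeasure_eq_ennreal_measure) (auto simp: top.not_eq_extremum)
    also have "measure lborel (cbox (0 :: real^'n) (\<chi> i. 1)) = 1"
      by (subst content_cbox_cart) (auto simp: interval_ne_empty_cart)
    also have "ennreal 1 = 1" by simp
    finally show ?thesis .
  qed
  obtain c where c: "\<And>z. norm (B *v z) \<le> norm z * c" "c > 0"
    using bounded_linear.pos_bounded[OF matrix_vector_mul_bounded_linear[of B]] by metis
  define K where "K = \<lceil>2 * c\<rceil> + 1"
  define F where "F = {l :: int^'n. \<forall>i. l $ i \<in> {- K..K}}"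
  have finF: "finite F" unfolding F_def by (rule finite_int_box)
  have split: "W x = (\<Sum>l\<in>F. W x * indicator C (x - rvec l))" for x
  proof (cases "W x = 0")
    case False
    then have "blichfeldt_weight (qf y x) > 0" by (simp add: W_def ennreal_eq_0_iff)
    then have "qf y x < 2" by (auto simp: blichfeldt_weight_def split: if_splits)
    then have "(norm (A *v x))\<^sup>2 < 2\<^sup>2" using A by simp
    then have "norm (A *v x) < 2" by (rule power_less_imp_less_base) simp
    then have "norm (A *v x) * c \<le> 2 * c" using c by simp
    then have "norm x \<le> 2 * c" using c(1)[of "A *v x"] A(2)[of x] by simp
    then have comp: "\<bar>x $ i\<bar> \<le> 2 * c" for i
      using component_le_norm_cart order_trans by blast
    define l :: "int^'n" where "l = (\<chi> i. \<lfloor>x $ i\<rfloor>)"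
    have "\<lfloor>x $ i\<rfloor> \<in> {- K..K}" for i
      using comp[of i] unfolding K_def by (simp add: le_floor_iff floor_le_iff) linarith
    then have lF: "l \<in> F" by (simp add: F_def l_def)
    have lC: "x - rvec l' \<in> C \<longleftrightarrow> l' = l" for l'
    proof -
      have "x - rvec l' \<in> C \<longleftrightarrow> (\<forall>i. \<lfloor>x $ i\<rfloor> = l' $ i)"
        unfolding C_def by (simp add: rvec_def floor_eq_iff algebra_simps)
      then show ?thesis by (auto simp: l_def vec_eq_iff)
    qed
    have "(\<Sum>l'\<in>F. W x * indicator C (x - rvec l')) = (\<Sum>l'\<in>F. if l' = l then W x else 0)"
      by (intro sum.cong) (auto simp: lC indicator_def)
    also have "\<dots> = W x" using finF lF by simp
    finally show ?thesis by simp
  qed simp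
  have shift: "(\<integral>\<^sup>+x. W x * indicator C (x - rvec l) \<partial>lborel) = (\<integral>\<^sup>+x. W (rvec l + x) * indicator C x \<partial>lborel)"
    for l :: "int^'n"
    by (subst lborel_distr_plus[symmetric, of "rvec l"], subst nn_integral_distr) auto
  have "(\<integral>\<^sup>+x. W x \<partial>lborel) = (\<integral>\<^sup>+x. (\<Sum>l\<in>F. W x * indicator C (x - rvec l)) \<partial>lborel)"
    by (subst split) simp
  also have "\<dots> = (\<Sum>l\<in>F. \<integral>\<^sup>+x. W x * indicator C (x - rvec l) \<partial>lborel)"
    by (rule nn_integral_sum) auto
  also have "\<dots> = (\<Sum>l\<in>F. \<integral>\<^sup>+x. W (rvec l + x) * indicator C x \<partial>lborel)"
    by (simp add: shift)
  also have "\<dots> = (\<integral>\<^sup>+x. (\<Sum>l\<in>F. W (rvec l + x) * indicator C x) \<partial>lborel)"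
    by (rule nn_integral_sum[symmetric]) auto
  also have "\<dots> \<le> (\<integral>\<^sup>+x. 2 * indicator C x \<partial>lborel)"
  proof (rule nn_integral_mono)
    fix x :: "real^'n"
    have "(\<Sum>l\<in>F. blichfeldt_weight ((norm (A *v (rvec l + x)))\<^sup>2)) \<le> 2"
    proof (rule sum_blichfeldt_weight_le[OF finF])
      fix i j :: "int^'n" assume "i \<noteq> j"
      then have "4 \<le> qf y (rvec (i - j))" by (intro min) simp
      also have "\<dots> = (norm (A *v (rvec i + x) - A *v (rvec j + x)))\<^sup>2"
        by (simp add: A rvec_diff flip: matrix_vector_mult_diff_distrib)
      finally have "2\<^sup>2 \<le> (norm (A *v (rvec i + x) - A *v (rvec j + x)))\<^sup>2" by simp
      then show "2 \<le> norm (A *v (rvec i + x) - A *v (rvec j + x))"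
        by (rule power2_le_imp_le) simp
    qed
    then have "ennreal (\<Sum>l\<in>F. blichfeldt_weight (qf y (rvec l + x))) \<le> ennreal 2"
      by (intro ennreal_leI) (simp add: A)
    then have "(\<Sum>l\<in>F. W (rvec l + x)) \<le> 2"
      by (simp add: W_def sum_ennreal blichfeldt_weight_nonneg)
    then show "(\<Sum>l\<in>F. W (rvec l + x) * indicator C x) \<le> 2 * indicator C x"
      by (simp add: indicator_def)
  qed
  also have "\<dots> = 2 * emeasure lborel C" by (simp add: nn_integral_cmult)
  also have "\<dots> \<le> 2 * 1" using C1 by (intro mult_left_mono) auto
  finally show ?thesis by (simp add: W_def)
qed

text \<open>The ellipsoid is the image under \<open>B\<close> of the ball of radius sqrt t, and |det
  B| is (det y)^{-1/2}.\<close>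

lemma emeasure_ellipsoid:
  fixes y B :: "real^'n^'n"
  assumes B: "transpose B ** y ** B = mat 1" and t: "0 < t"
  shows "emeasure lborel {x. qf y x < t}
    = ennreal (\<bar>det B\<bar> * unit_ball_vol (real CARD('n)) * t powr (real CARD('n) / 2))"
proof -
  obtain A :: "real^'n^'n" where A: "\<And>x. qf y x = (norm (A *v x))\<^sup>2" "\<And>x. B *v (A *v x) = x"
    using posdef_eq_norm[OF B] by blast
  have qB: "qf y (B *v z) = (norm z)\<^sup>2" for z
    by (simp add: qf_transform B qf_mat_1)
  have "{x. qf y x < t} = (*v) B ` ball 0 (sqrt t)"
  proof (intro equalityI subsetI)
    fix x assume "x \<in> {x. qf y x < t}"
    then have "norm (A *v x) < sqrt t" using A(1) by (simp add: real_less_rsqrt)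
    then show "x \<in> (*v) B ` ball 0 (sqrt t)"
      by (intro image_eqI[of _ _ "A *v x"]) (simp_all add: A(2))
  next
    fix x assume "x \<in> (*v) B ` ball 0 (sqrt t)"
    then show "x \<in> {x. qf y x < t}"
      using t by (auto simp: qB) (metis norm_ge_zero real_sqrt_less_iff real_sqrt_pow2 real_sqrt_unique power_strict_mono less_imp_le zero_less_numeral)
  qed
  moreover have "(*v) B ` ball 0 (sqrt t) \<in> lmeasurable"
    "measure lebesgue ((*v) B ` ball 0 (sqrt t)) = \<bar>det B\<bar> * measure lebesgue (ball 0 (sqrt t) :: (real^'n) set)"
    using measure_linear_image_finite_type[OF matrix_vector_mul_linear, of B] by (auto simp: matrix_of_matrix_vector_mul)
  ultimately have "emeasure lebesgue {x. qf y x < t} = ennreal (\<bar>det B\<bar> * measure lebesgue (ball 0 (sqrt t) :: (real^'n) set))"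
    by (simp add: emeasure_eq_measure2)
  moreover have "measure lebesgue (ball 0 (sqrt t) :: (real^'n) set) = unit_ball_vol (real CARD('n)) * t powr (real CARD('n) / 2)"
    using t by (simp add: measure_completion content_ball powr_half_sqrt[symmetric] powr_powr flip: powr_realpow)
  moreover have "{x. qf y x < t} \<in> sets lborel"
    by measurable
  then have "emeasure lebesgue {x. qf y x < t} = emeasure lborel {x. qf y x < t}"
    by (simp add: main_part_sets)
  ultimately show ?thesis by (simp add: mult.assoc)
qed

lemma nn_integral_layers:
  fixes g :: "real^'n \<Rightarrow> real"
  assumes [measurable]: "g \<in> borel_measurable borel"
  shows "(\<integral>\<^sup>+x. ennreal (g x) \<partial>lborel)
    = (\<integral>\<^sup>+s. emeasure lborel {x. s < g x} * indicator {0..} s \<partial>lborel)"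
proof -
  have "(\<integral>\<^sup>+x. ennreal (g x) \<partial>lborel) = (\<integral>\<^sup>+x. \<integral>\<^sup>+s. indicator {0..<g x} s \<partial>lborel \<partial>lborel)"
  proof (intro nn_integral_cong)
    fix x show "ennreal (g x) = (\<integral>\<^sup>+s. indicator {0..<g x} s \<partial>lborel)"
      by (cases "0 \<le> g x") (auto simp: ennreal_neg)
  qed
  also have "\<dots> = (\<integral>\<^sup>+x. \<integral>\<^sup>+s. indicator {(x, s). 0 \<le> s \<and> s < g x} (x, s) \<partial>lborel \<partial>lborel)"
    by (intro nn_integral_cong) (auto simp: indicator_def)
  also have "\<dots> = (\<integral>\<^sup>+s. \<integral>\<^sup>+x. indicator {(x, s). 0 \<le> s \<and> s < g x} (x, s) \<partial>lborel \<partial>lborel)"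
    by (rule lborel_pair.Fubini'[symmetric]) measurable
  also have "\<dots> = (\<integral>\<^sup>+s. emeasure lborel {x. s < g x} * indicator {0..} s \<partial>lborel)"
  proof (intro nn_integral_cong)
    fix s :: real
    have "(\<integral>\<^sup>+x. indicator {(x, s). 0 \<le> s \<and> s < g x} (x, s) \<partial>lborel)
      = (\<integral>\<^sup>+x. indicator {0..} s * indicator {x. s < g x} x \<partial>lborel)"
      by (intro nn_integral_cong) (auto simp: indicator_def)
    also have "\<dots> = indicator {0..} s * emeasure lborel {x. s < g x}"
      by (simp add: nn_integral_cmult)
    finally show "(\<integral>\<^sup>+x. indicator {(x, s). 0 \<le> s \<and> s < g x} (x, s) \<partial>lborel)
      = emeasure lborel {x. s < g x} * indicator {0..} s"
      by (simp add: mult.commute)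
  qed
  finally show ?thesis .
qed

lemma nn_integral_powr_Icc:
  fixes h :: real
  assumes "0 < h"
  shows "(\<integral>\<^sup>+s. ennreal ((2 - s) powr h) * indicator {0..7/4} s \<partial>lborel)
    = ennreal ((2 powr (h + 1) - (1/4) powr (h + 1)) / (h + 1))"
proof -
  have "(\<integral>\<^sup>+s. ennreal ((2 - s) powr h) * indicator {0..7/4} s \<partial>lborel)
    = ennreal (- ((2 - 7/4) powr (h + 1) / (h + 1)) - - ((2 - 0) powr (h + 1) / (h + 1)))"
  proof (rule nn_integral_FTC_Icc[where F = "\<lambda>s. - ((2 - s) powr (h + 1) / (h + 1))"])
    fix s :: real assume "s \<in> {0..7/4}"
    then show "((\<lambda>s. - ((2 - s) powr (h + 1) / (h + 1))) has_real_derivative (2 - s) powr h) (at s)"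
      using assms by (auto intro!: derivative_eq_intros)
  qed auto
  then show ?thesis by (simp add: diff_divide_distrib)
qed

text \<open>Layer by layer: for levels up to 7/4 = 2 - 1/4 the superlevel set is the ellipsoid y[x]
  < 2 - s, and for the remaining levels below 2 it stays y[x] < 1/4 because of the raised centre.
  The second range has length 1/4 and yields the summand \<open>(1/4) powr (h + 1)\<close>.\<close>

lemma nn_integral_blichfeldt_weight:
  fixes y B :: "real^'n^'n"
  assumes B: "transpose B ** y ** B = mat 1"
  defines "h \<equiv> real CARD('n) / 2"
  shows "ennreal (\<bar>det B\<bar> * unit_ball_vol (real CARD('n))
      * ((2 powr (h + 1) - (1/4) powr (h + 1)) / (h + 1) + (1/4) powr (h + 1)))
    \<le> (\<integral>\<^sup>+x. ennreal (blichfeldt_weight (qf y x)) \<partial>lborel)"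
proof -
  have h: "0 < h" by (simp add: h_def)
  define c where "c = \<bar>det B\<bar> * unit_ball_vol (real CARD('n))"
  have c: "0 \<le> c" by (simp add: c_def)
  have layer: "emeasure lborel {x. s < blichfeldt_weight (qf y x)} = ennreal (c * (max (2 - s) (1/4)) powr h)"
    if "0 \<le> s" "s < 2" for s
  proof -
    have "{x. s < blichfeldt_weight (qf y x)} = {x. qf y x < max (2 - s) (1/4)}"
      using that by (auto simp: blichfeldt_weight_def)
    then show ?thesis using emeasure_ellipsoid[OF B, of "max (2 - s) (1/4)"] that
      by (simp add: c_def h_def)
  qed
  have "(1/4) powr (h + 1) \<le> (2::real) powr (h + 1)"
    using h by (intro powr_mono2) auto
  then have "0 \<le> (2 powr (h + 1) - (1/4) powr (h + 1)) / (h + 1)"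
    using h by simp
  then have "ennreal (c * ((2 powr (h + 1) - (1/4) powr (h + 1)) / (h + 1) + (1/4) powr (h + 1)))
    = ennreal c * (ennreal ((2 powr (h + 1) - (1/4) powr (h + 1)) / (h + 1)) + ennreal ((1/4) powr h * (1/4) powr 1))"
    using c unfolding powr_add[symmetric]
    by (simp only: ennreal_mult' ennreal_plus powr_ge_zero)
  also have "ennreal ((1/4) powr h * (1/4) powr 1) = (\<integral>\<^sup>+s. ennreal ((1/4) powr h) * indicator {7/4<..<2::real} s \<partial>lborel)"
    by (simp add: nn_integral_cmult flip: ennreal_mult'')
  also have "ennreal c * (ennreal ((2 powr (h + 1) - (1/4) powr (h + 1)) / (h + 1)) + \<dots>)
    = (\<integral>\<^sup>+s. ennreal c * (ennreal ((2 - s) powr h) * indicator {0..7/4} s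
        + ennreal ((1/4) powr h) * indicator {7/4<..<2::real} s) \<partial>lborel)"
    by (simp add: nn_integral_cmult nn_integral_add nn_integral_powr_Icc[OF h])
  also have "\<dots> \<le> (\<integral>\<^sup>+s. emeasure lborel {x. s < blichfeldt_weight (qf y x)} * indicator {0..} s \<partial>lborel)"
  proof (rule nn_integral_mono)
    fix s :: real
    consider "s \<in> {0..7/4}" | "s \<in> {7/4<..<2}" | "s \<notin> {0..7/4} \<union> {7/4<..<2}" by blast
    then show "ennreal c * (ennreal ((2 - s) powr h) * indicator {0..7/4} s
        + ennreal ((1/4) powr h) * indicator {7/4<..<2::real} s)
      \<le> emeasure lborel {x. s < blichfeldt_weight (qf y x)} * indicator {0..} s"
    proof cases
      case 1
      then have "max (2 - s) (1/4) = 2 - s" by simp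
      with 1 c show ?thesis by (simp add: layer ennreal_mult)
    qed (use c in \<open>auto simp: layer ennreal_mult max_def\<close>)
  qed
  also have "\<dots> = (\<integral>\<^sup>+x. ennreal (blichfeldt_weight (qf y x)) \<partial>lborel)"
    by (rule nn_integral_layers[symmetric]) measurable
  finally show ?thesis by (simp add: c_def)
qed

text \<open>\<open>K\<close> is an upper bound for Hermite's constant. Speaking of lower bounds
  \<open>m\<close> instead of the minimum avoids showing that a shortest vector exists.\<close>

definition hermite_bound :: "'n::finite itself \<Rightarrow> real \<Rightarrow> bool"
  where "hermite_bound _ K \<longleftrightarrow> (\<forall>(y :: real^'n^'n) m. posdef y \<longrightarrow> 0 < m \<longrightarrow>
    (\<forall>v. v \<noteq> 0 \<longrightarrow> m \<le> qf y (rvec v)) \<longrightarrow> m \<le> K * det y powr (1 / real CARD('n)))"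

lemma hermite_boundD:
  fixes y :: "real^'n^'n"
  assumes "hermite_bound TYPE('n) K" "posdef y" "0 < m" "\<And>v. v \<noteq> 0 \<Longrightarrow> m \<le> qf y (rvec v)"
  shows "m \<le> K * det y powr (1 / real CARD('n))"
  using assms unfolding hermite_bound_def by simp

lemma det_scaleR: "det (c *\<^sub>R (A :: real^'n^'n)) = c ^ CARD('n) * det A"
  using det_rows_mul[of "\<lambda>_. c" "\<lambda>i. A $ i"]
  by (simp add: vec_lambda_eta scaleR_vec_def vector_scalar_mult_def)

text \<open>The two estimates for the integral of the weight give |det B| V J <= 2 once the form is
  scaled to minimum 4; undoing the scaling turns this into Hermite's inequality. With 2^{h+1} / (h +
  1) in place of J the constant would be exactly Blichfeldt's.\<close>

theorem blichfeldt:
  obtains K where "0 < K" "K < 2 / pi * Gamma (2 + real CARD('n) / 2) powr (2 / real CARD('n))"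
    "hermite_bound TYPE('n::finite) K"
proof -
  define h where "h = real CARD('n) / 2"
  have h: "0 < h" by (simp add: h_def)
  define V where "V = unit_ball_vol (real CARD('n))"
  have V: "0 < V" by (simp add: V_def)
  define J where "J = (2 powr (h + 1) - (1/4) powr (h + 1)) / (h + 1) + (1/4::real) powr (h + 1)"
  \<comment> \<open>The left side is the integral belonging to the unmodified density max (0, 2 -
    t). The raised centre replaces (1/4)^{h+1} / (h + 1) by (1/4)^{h+1}, and this is the origin of
    the strict inequality.\<close>
  have J: "2 powr (h + 1) / (h + 1) < J"
  proof -
    have "(1/4) powr (h + 1) / (h + 1) < (1/4::real) powr (h + 1)"
      using h by (simp add: divide_less_eq)
    then show ?thesis by (simp add: J_def diff_divide_distrib)
  qed
  then have J0: "0 < J" using h by (smt (verit) divide_pos_pos powr_gt_zero)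
  define K where "K = 4 * (2 / (V * J)) powr (1 / h)"
  have "0 < K" using V J0 by (simp add: K_def)
  have "2 / (V * J) < 2 / (V * (2 powr (h + 1) / (h + 1)))"
    using V J J0 h by (intro divide_strict_left_mono mult_strict_left_mono mult_pos_pos) auto
  also have "\<dots> = Gamma (h + 2) / (2 * pi) powr h"
  proof -
    have V': "V = pi powr h / Gamma (h + 1)" by (simp add: V_def unit_ball_vol_def h_def)
    have "Gamma (h + 2) = (h + 1) * Gamma (h + 1)"
      using Gamma_plus1[of "h + 1"] h by (force simp: algebra_simps elim!: nonpos_Ints_cases)
    moreover have "Gamma (h + 1) > 0" using h by (intro Gamma_real_pos) auto
    ultimately show ?thesis using h by (simp add: V' powr_add powr_mult field_simps)
  qed
  finally have "(2 / (V * J)) powr (1 / h) < (Gamma (h + 2) / (2 * pi) powr h) powr (1 / h)"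
    using V J0 h by (intro powr_less_mono2) auto
  also have "\<dots> = Gamma (h + 2) powr (1 / h) / (2 * pi)"
    using h by (simp add: powr_divide powr_powr)
  finally have K2: "K < 2 / pi * Gamma (2 + real CARD('n) / 2) powr (2 / real CARD('n))"
    by (simp add: K_def h_def add.commute field_simps)
  have "hermite_bound TYPE('n) K"
    unfolding hermite_bound_def
  proof (intro allI impI)
    fix y :: "real^'n^'n" and m :: real
    assume y: "posdef y" and m: "0 < m" and min: "\<forall>v. v \<noteq> 0 \<longrightarrow> m \<le> qf y (rvec v)"
    \<comment> \<open>Minimum 4 means distance 2 between lattice points, as required by the
      weight.\<close>
    define z where "z = (4 / m) *\<^sub>R y"
    have z: "posdef z" using y m
      by (simp add: posdef_def z_def qf_scaleR_left transpose_def vec_eq_iff)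
    obtain B :: "real^'n^'n" where B: "transpose B ** z ** B = mat 1"
      by (rule posdef_imp_congruent_mat_1[OF z])
    note det = congruent_mat_1_det[OF B]
    have "4 \<le> qf z (rvec v)" if "v \<noteq> 0" for v
      using min that m by (simp add: z_def qf_scaleR_left field_simps)
    from order_trans[OF nn_integral_blichfeldt_weight[OF B] nn_integral_blichfeldt_weight_le[OF z this]]
    have "ennreal (\<bar>det B\<bar> * V * J) \<le> ennreal 2"
      by (simp add: V_def J_def h_def)
    then have le: "\<bar>det B\<bar> * (V * J) \<le> 2"
      using ennreal_le_iff[of 2 "\<bar>det B\<bar> * V * J"] by (simp add: mult.assoc)
    have dz: "det z = (4 / m) powr (2 * h) * det y"
      using m by (simp add: z_def h_def det_scaleR powr_realpow)
    have dy: "0 < det y" by (rule posdef_det_pos[OF y])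
    have dB: "0 < \<bar>det B\<bar>" using det by auto
    have "(det B)\<^sup>2 * ((4 / m) powr h * det y powr (1/2))\<^sup>2 = 1"
      using det dy m unfolding dz
      by (simp add: power_mult_distrib powr_half_sqrt powr_power mult_ac)
    then have "(\<bar>det B\<bar> * ((4 / m) powr h * det y powr (1/2)))\<^sup>2 = 1\<^sup>2"
      by (simp add: power_mult_distrib)
    then have "\<bar>det B\<bar> * ((4 / m) powr h * det y powr (1/2)) = 1"
      by (subst (asm) power2_eq_iff_nonneg) auto
    then have "\<bar>det B\<bar> * (V * J) \<le> \<bar>det B\<bar> * (2 * ((4 / m) powr h * det y powr (1/2)))"
      using le by simp
    then have "V * J \<le> 2 * ((4 / m) powr h * det y powr (1/2))"
      by (rule mult_left_le_imp_le[OF _ dB])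
    then have "V * J * m powr h \<le> 2 * 4 powr h * det y powr (1/2)"
      using m by (simp add: powr_divide field_simps)
    then have "m powr h \<le> 2 / (V * J) * 4 powr h * det y powr (1/2)"
      using V J0 by (simp add: field_simps)
    moreover have mh: "(m powr h) powr (1 / h) = m"
      using h m by (simp add: powr_powr)
    ultimately have "(m powr h) powr (1 / h) \<le> (2 / (V * J) * 4 powr h * det y powr (1/2)) powr (1 / h)"
      using h by (intro powr_mono2) auto
    also have "\<dots> = K * det y powr (1 / real CARD('n))"
    proof -
      have "(2 / (V * J) * 4 powr h * det y powr (1/2)) powr (1 / h)
        = (2 / (V * J)) powr (1 / h) * (4 powr h) powr (1 / h) * (det y powr (1/2)) powr (1 / h)"
        by (simp only: powr_mult)
      also have "(4 powr h) powr (1 / h) = (4 :: real)" using h by (simp add: powr_powr)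
      also have "(det y powr (1/2)) powr (1 / h) = det y powr (1 / real CARD('n))"
        by (simp add: powr_powr h_def)
      finally show ?thesis by (simp add: K_def)
    qed
    finally show "m \<le> K * det y powr (1 / real CARD('n))"
      unfolding mh .
  qed
  then show ?thesis by (rule that[OF \<open>0 < K\<close> K2])
qed

section \<open>Reduction of lattice bases\<close>

text \<open>Elementary integral changes of a lattice basis. The index set is recorded so that an
  induction can work on part of a basis and leave the rest fixed; a single move is easily realised
  by a unimodular matrix acting on the Siegel space.\<close>

inductive transvections :: "'i set \<Rightarrow> ('i \<Rightarrow> 'v::real_vector) \<Rightarrow> ('i \<Rightarrow> 'v) \<Rightarrow> bool"
  for I b where
  idle: "transvections I b b"
| shear: "transvections I b c \<Longrightarrow> j \<in> I \<Longrightarrow> k \<in> I \<Longrightarrow> j \<noteq> k \<Longrightarrow>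
    transvections I b (c(k := c k + of_int a *\<^sub>R c j))"

lemma transvections_trans:
  "transvections I c d \<Longrightarrow> transvections I b c \<Longrightarrow> transvections I b d"
  by (induction rule: transvections.induct) (auto intro: transvections.shear)

lemma transvections_mono: "transvections I b c \<Longrightarrow> I \<subseteq> J \<Longrightarrow> transvections J b c"
  by (induction rule: transvections.induct) (auto intro: transvections.intros)

lemma transvections_outside: "transvections I b c \<Longrightarrow> i \<notin> I \<Longrightarrow> c i = b i"
  by (induction rule: transvections.induct) auto

lemma transvections_one:
  "j \<in> I \<Longrightarrow> k \<in> I \<Longrightarrow> j \<noteq> k \<Longrightarrow> transvections I b (b(k := b k + of_int a *\<^sub>R b j))"
  by (intro transvections.intros)

text \<open>The moves are formal, so those that reduce a projected basis can be repeated on the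
  original one.\<close>

lemma transvections_linear_lift:
  assumes "transvections I d' c'" "d' = P \<circ> b" "linear P"
  shows "\<exists>c. transvections I b c \<and> c' = P \<circ> c"
  using assms
proof induction
  case idle
  then show ?case by (auto intro: transvections.idle)
next
  case (shear c' j k a)
  then obtain c where c: "transvections I b c" "c' = P \<circ> c" by blast
  have "c'(k := c' k + of_int a *\<^sub>R c' j) = P \<circ> c(k := c k + of_int a *\<^sub>R c j)"
    using c \<open>linear P\<close> by (auto simp: fun_eq_iff linear_add linear_scale)
  then show ?case using transvections.shear[OF c(1) shear.hyps(2-4)] by metis
qed

text \<open>A move of the basis is the transposed move of the coefficients: adding a times c_j to
  c_k amounts to adding a n_k to n_j, which is invertible over the integers.\<close>

lemma transvections_lattice:
  assumes "transvections I b c" "finite I" "\<exists>i\<in>I. n i \<noteq> (0::int)"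
  shows "\<exists>n'. (\<exists>i\<in>I. n' i \<noteq> (0::int)) \<and> (\<Sum>i\<in>I. of_int (n i) *\<^sub>R c i) = (\<Sum>i\<in>I. of_int (n' i) *\<^sub>R b i)"
  using assms
proof (induction arbitrary: n)
  case idle
  then show ?case by blast
next
  case (shear c j k a)
  define n' where "n' = n(j := n j + a * n k)"
  have "\<exists>i\<in>I. n' i \<noteq> 0"
  proof (rule ccontr)
    assume "\<not> ?thesis"
    then have z: "\<And>i. i \<in> I \<Longrightarrow> n' i = 0" by blast
    then have "n k = 0" using shear.hyps by (metis fun_upd_apply n'_def)
    then have "n i = 0" if "i \<in> I" for i using z[OF that] by (auto simp: n'_def split: if_splits)
    then show False using shear.prems by blast
  qed
  moreover have "(\<Sum>i\<in>I. of_int (n i) *\<^sub>R (c(k := c k + of_int a *\<^sub>R c j)) i) = (\<Sum>i\<in>I. of_int (n' i) *\<^sub>R c i)"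
  proof -
    have "(\<Sum>i\<in>I. of_int (n i) *\<^sub>R (c(k := c k + of_int a *\<^sub>R c j)) i)
      = (\<Sum>i\<in>I. of_int (n i) *\<^sub>R c i + (if i = k then of_int (n k * a) *\<^sub>R c j else 0))"
      by (intro sum.cong) (auto simp: algebra_simps)
    also have "\<dots> = (\<Sum>i\<in>I. of_int (n i) *\<^sub>R c i) + of_int (n k * a) *\<^sub>R c j"
      using shear.hyps \<open>finite I\<close> by (simp add: sum.distrib)
    also have "\<dots> = (\<Sum>i\<in>I. of_int (n i) *\<^sub>R c i + (if i = j then of_int (n k * a) *\<^sub>R c j else 0))"
      using shear.hyps \<open>finite I\<close> by (simp add: sum.distrib)
    also have "\<dots> = (\<Sum>i\<in>I. of_int (n' i) *\<^sub>R c i)"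
      by (intro sum.cong) (auto simp: n'_def algebra_simps)
    finally show ?thesis .
  qed
  moreover obtain n'' where "\<exists>i\<in>I. n'' i \<noteq> (0::int)"
    "(\<Sum>i\<in>I. of_int (n' i) *\<^sub>R c i) = (\<Sum>i\<in>I. of_int (n'' i) *\<^sub>R b i)"
    using shear.IH[OF \<open>finite I\<close> \<open>\<exists>i\<in>I. n' i \<noteq> 0\<close>] by blast
  ultimately show ?case by (intro exI[of _ n'']) simp
qed

text \<open>Three shears turn the pair (b_i, b_j) into (b_j, - b_i). The sign is forced by
  determinant 1 and is harmless here.\<close>

lemma transvections_move:
  assumes "i \<in> I" "j \<in> I"
  shows "\<exists>c. transvections I b c \<and> c i = b j"
proof (cases "i = j")
  case True
  then show ?thesis using transvections.idle by blast
next
  case False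
  define b1 where "b1 = b(i := b i + of_int 1 *\<^sub>R b j)"
  define b2 where "b2 = b1(j := b1 j + of_int (-1) *\<^sub>R b1 i)"
  define b3 where "b3 = b2(i := b2 i + of_int 1 *\<^sub>R b2 j)"
  have "transvections I b b3"
    unfolding b3_def b2_def b1_def using assms False
    by (intro transvections.shear transvections.idle) auto
  moreover have "b3 i = b j" using False by (simp add: b3_def b2_def b1_def)
  ultimately show ?thesis by blast
qed

text \<open>The Euclidean algorithm on the coefficients of a lattice vector.\<close>
lemma lattice_vector_multiple_of_basis_vector:
  fixes n :: "'i \<Rightarrow> int"
  assumes "finite I" "i \<in> I"
  shows "\<exists>c d. transvections I b c \<and> (\<Sum>j\<in>I. of_int (n j) *\<^sub>R b j) = of_int d *\<^sub>R c i"
proof (induction "\<Sum>j\<in>I. nat \<bar>n j\<bar>" arbitrary: n b rule: less_induct)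
  case less
  show ?case
  proof (cases "\<exists>j\<in>I. \<exists>k\<in>I. j \<noteq> k \<and> n j \<noteq> 0 \<and> n k \<noteq> 0")
    case True
    then obtain j k where jk: "j \<in> I" "k \<in> I" "j \<noteq> k" "n j \<noteq> 0" "n k \<noteq> 0" "\<bar>n k\<bar> \<le> \<bar>n j\<bar>"
      by (metis linorder_le_cases)
    \<comment> \<open>The sign for which subtracting \<open>s * n k\<close> shrinks the larger
      coefficient \<open>n j\<close>. Adding \<open>s\<close> times b_j to b_k compensates, so the
      lattice vector stays the same while the sum of the absolute values drops.\<close>
    define s where "s = sgn (n j) * sgn (n k)"
    define n' where "n' = n(j := n j - s * n k)"
    define b' where "b' = b(k := b k + of_int s *\<^sub>R b j)"
    have "\<bar>n j - s * n k\<bar> < \<bar>n j\<bar>"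
      using jk(4-6) by (auto simp: s_def sgn_if)
    then have "(\<Sum>j\<in>I. nat \<bar>n' j\<bar>) < (\<Sum>j\<in>I. nat \<bar>n j\<bar>)"
      using assms jk by (intro sum_strict_mono_ex1) (auto simp: n'_def intro!: bexI[of _ j])
    from less[OF this] obtain c d where
      c: "transvections I b' c" "(\<Sum>j\<in>I. of_int (n' j) *\<^sub>R b' j) = of_int d *\<^sub>R c i" by blast
    have "(\<Sum>i\<in>I. of_int (n' i) *\<^sub>R b' i)
      = (\<Sum>i\<in>I. of_int (n i) *\<^sub>R b i + (if i = k then of_int (n k * s) *\<^sub>R b j else 0)
          - (if i = j then of_int (n k * s) *\<^sub>R b j else 0))"
      using jk by (intro sum.cong) (auto simp: n'_def b'_def algebra_simps)
    also have "\<dots> = (\<Sum>i\<in>I. of_int (n i) *\<^sub>R b i)"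
      using jk assms by (simp add: sum.distrib sum_subtractf)
    finally have "(\<Sum>j\<in>I. of_int (n j) *\<^sub>R b j) = of_int d *\<^sub>R c i" using c by simp
    moreover have "transvections I b c"
      using c(1) transvections_one[OF jk(1-3)] transvections_trans unfolding b'_def by blast
    ultimately show ?thesis by blast
  next
    case False
    show ?thesis
    proof (cases "\<exists>j\<in>I. n j \<noteq> 0")
      case True
      then obtain j where j: "j \<in> I" "n j \<noteq> 0" by blast
      have "(\<Sum>j\<in>I. of_int (n j) *\<^sub>R b j) = (\<Sum>k\<in>I. if k = j then of_int (n j) *\<^sub>R b j else 0)"
        using False j by (intro sum.cong) auto
      also have "\<dots> = of_int (n j) *\<^sub>R b j" using j assms by simp
      finally show ?thesis using transvections_move[OF \<open>i \<in> I\<close> j(1), of b] by metis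
    next
      case False
      then have "(\<Sum>j\<in>I. of_int (n j) *\<^sub>R b j) = of_int 0 *\<^sub>R b i" by simp
      then show ?thesis using transvections.idle by blast
    qed
  qed
qed

text \<open>For positive \<open>r\<close> and finite \<open>I\<close> this carries both facts needed
  about the family: independence over the integers and discreteness of the lattice. It depends on
  the lattice only, hence survives transvections.\<close>

definition lattice_min :: "'i set \<Rightarrow> ('i \<Rightarrow> 'v::real_inner) \<Rightarrow> real \<Rightarrow> bool"
  where "lattice_min I b r \<longleftrightarrow>
    (\<forall>n. (\<exists>i\<in>I. n i \<noteq> (0::int)) \<longrightarrow> r \<le> (norm (\<Sum>i\<in>I. of_int (n i) *\<^sub>R b i))\<^sup>2)"

lemma lattice_min_transvections:
  assumes "transvections I b c" "finite I" "lattice_min I b r"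
  shows "lattice_min I c r"
  unfolding lattice_min_def
proof (intro allI impI)
  fix n :: "'a \<Rightarrow> int" assume "\<exists>i\<in>I. n i \<noteq> 0"
  from transvections_lattice[OF assms(1,2) this] obtain n' where
    "\<exists>i\<in>I. n' i \<noteq> (0::int)" "(\<Sum>i\<in>I. of_int (n i) *\<^sub>R c i) = (\<Sum>i\<in>I. of_int (n' i) *\<^sub>R b i)"
    by blast
  then show "r \<le> (norm (\<Sum>i\<in>I. of_int (n i) *\<^sub>R c i))\<^sup>2"
    using assms(3) unfolding lattice_min_def by simp
qed

lemma lattice_minD1:
  assumes "lattice_min I b r" "finite I" "i \<in> I"
  shows "r \<le> (norm (b i))\<^sup>2"
proof -
  have "(\<Sum>j\<in>I. of_int (if j = i then 1 else 0) *\<^sub>R b j) = (\<Sum>j\<in>I. if j = i then b i else 0)"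
    by (intro sum.cong) auto
  also have "\<dots> = b i" using assms by simp
  finally show ?thesis using assms(1,3) unfolding lattice_min_def
    by (elim allE[of _ "\<lambda>j. if j = i then 1 else 0"]) auto
qed

text \<open>A lattice vector of less than twice the minimal square length is primitive, hence can be made
  a member of the basis.\<close>
lemma short_basis_vector:
  fixes b :: "'i \<Rightarrow> 'v::real_inner"
  assumes fin: "finite I" "i \<in> I" and r: "0 < r" "lattice_min I b r"
  shows "\<exists>c. transvections I b c \<and> lattice_min I c ((norm (c i))\<^sup>2 / 2) \<and> r \<le> (norm (c i))\<^sup>2"
proof -
  define S where "S = {(norm (\<Sum>i\<in>I. of_int (n i) *\<^sub>R b i))\<^sup>2 | n. \<exists>i\<in>I. n i \<noteq> (0::int)}"
  have S0: "S \<noteq> {}" using fin(2) unfolding S_def by (auto intro!: exI[of _ "\<lambda>_. 1"])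
  have Sr: "r \<le> s" if "s \<in> S" for s using that r unfolding S_def lattice_min_def by blast
  have bdd: "bdd_below S" using Sr by (auto simp: bdd_below_def)
  have "r \<le> Inf S" using S0 Sr by (intro cInf_greatest) auto
  \<comment> \<open>The factor 2 makes room for a lattice vector near the infimum, and is small
    enough to force d^2 = 1 below.\<close>
  then have "Inf S < 2 * Inf S" using r by simp
  then obtain s where s: "s \<in> S" "s < 2 * Inf S" using cInf_lessD[OF S0] by blast
  then obtain n where n: "\<exists>i\<in>I. n i \<noteq> (0::int)" "s = (norm (\<Sum>i\<in>I. of_int (n i) *\<^sub>R b i))\<^sup>2"
    unfolding S_def by blast
  obtain c d where c: "transvections I b c" "(\<Sum>j\<in>I. of_int (n j) *\<^sub>R b j) = of_int d *\<^sub>R c i"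
    using lattice_vector_multiple_of_basis_vector[OF fin] by blast
  have Smin: "lattice_min I b (Inf S)"
    unfolding lattice_min_def using bdd by (intro allI impI cInf_lower) (auto simp: S_def)
  then have cmin: "lattice_min I c (Inf S)" using lattice_min_transvections c fin by blast
  have ci: "Inf S \<le> (norm (c i))\<^sup>2" using lattice_minD1[OF cmin fin] .
  have sd: "s = (of_int d)\<^sup>2 * (norm (c i))\<^sup>2"
    using n c by (simp add: power_mult_distrib)
  have "(of_int d)\<^sup>2 * Inf S \<le> s"
    unfolding sd using ci by (intro mult_left_mono) auto
  also note s(2)
  finally have "(of_int d :: real)\<^sup>2 < 2" using \<open>r \<le> Inf S\<close> r by simp
  moreover have "d \<noteq> 0" using sd Sr[OF s(1)] r by auto
  moreover have "d\<^sup>2 < 2 \<longleftrightarrow> (of_int d :: real)\<^sup>2 < 2"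
    by (metis of_int_less_iff of_int_numeral of_int_power)
  ultimately have "d\<^sup>2 = 1"
    using zero_less_power2[of d] by linarith
  then have "(of_int d :: real)\<^sup>2 = 1"
    by (metis of_int_1 of_int_power)
  then have "(norm (c i))\<^sup>2 = s" using sd by simp
  then have "lattice_min I c ((norm (c i))\<^sup>2 / 2)"
    using cmin s(2) unfolding lattice_min_def by (smt (verit) field_sum_of_halves)
  moreover have "r \<le> (norm (c i))\<^sup>2" using ci \<open>r \<le> Inf S\<close> by simp
  ultimately show ?thesis using c by blast
qed

lemma transvections_add_multiples:
  assumes "finite J" "J \<subseteq> I" "i \<in> I" "i \<notin> J"
  shows "transvections I b (\<lambda>j. if j \<in> J then b j + of_int (m j) *\<^sub>R b i else b j)"
  using assms
proof induction
  case empty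
  then show ?case by (simp add: transvections.idle)
next
  case (insert k J)
  define c where "c = (\<lambda>j. if j \<in> J then b j + of_int (m j) *\<^sub>R b i else b j)"
  have "transvections I b (c(k := c k + of_int (m k) *\<^sub>R c i))"
    using insert unfolding c_def by (intro transvections.shear) auto
  also have "c(k := c k + of_int (m k) *\<^sub>R c i) = (\<lambda>j. if j \<in> insert k J then b j + of_int (m j) *\<^sub>R b i else b j)"
    using insert by (auto simp: c_def fun_eq_iff)
  finally show ?case .
qed

text \<open>
  Reduction in the style of Hermite, Korkine and Zolotarev: a nearly shortest vector comes first, the
  others are reduced modulo it.
\<close>
theorem exists_reduced_basis:
  assumes "finite I"
  shows "\<exists>K\<ge>1. \<forall>(b :: 'i \<Rightarrow> 'v::real_inner) r. 0 < r \<longrightarrow> lattice_min I b r \<longrightarrow>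
    (\<exists>c. transvections I b c \<and>
      (\<forall>x. (\<Sum>i\<in>I. (norm (c i))\<^sup>2 * (x i)\<^sup>2) \<le> K * (norm (\<Sum>i\<in>I. x i *\<^sub>R c i))\<^sup>2))"
  using assms
proof induction
  case empty
  show ?case by (intro exI[of _ 1]) (auto intro: transvections.idle)
next
  case (insert i J)
  define I where "I = insert i J"
  have finI: "finite I" "i \<in> I" "J \<subseteq> I" using insert by (auto simp: I_def)
  obtain K where K: "1 \<le> K" and KJ: "\<And>(b :: 'i \<Rightarrow> 'v) r. 0 < r \<Longrightarrow> lattice_min J b r \<Longrightarrow>
    \<exists>c. transvections J b c \<and>
      (\<forall>x. (\<Sum>i\<in>J. (norm (c i))\<^sup>2 * (x i)\<^sup>2) \<le> K * (norm (\<Sum>i\<in>J. x i *\<^sub>R c i))\<^sup>2)"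
    using insert.IH by blast
  \<comment> \<open>\<open>K\<close> controls the projected lattice. In the bracket,
    \<open>2 * card J\<close> pays for the cross terms with the first vector, and 2 for lifting,
    which at most doubles the square lengths of the other vectors.\<close>
  define L where "L = (2 * real (card J) + 2) * K"
  have "2 * 1 \<le> L" unfolding L_def using K by (intro mult_mono) auto
  then have L: "2 \<le> L" by simp
  have "\<exists>c. transvections I b c \<and>
      (\<forall>x. (\<Sum>i\<in>I. (norm (c i))\<^sup>2 * (x i)\<^sup>2) \<le> L * (norm (\<Sum>i\<in>I. x i *\<^sub>R c i))\<^sup>2)"
    if r: "0 < r" "lattice_min I b r" for b :: "'i \<Rightarrow> 'v" and r
  proof -
    obtain c where c: "transvections I b c" "lattice_min I c ((norm (c i))\<^sup>2 / 2)" "r \<le> (norm (c i))\<^sup>2"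
      using short_basis_vector[OF finI(1,2) r] by blast
    define u where "u = c i"
    define A where "A = (norm u)\<^sup>2"
    have A: "0 < A" using c(3) r(1) unfolding A_def u_def by linarith
    define t where "t v = (v \<bullet> u) / A" for v
    \<comment> \<open>Orthogonal projection along \<open>u\<close>; \<open>t\<close> is the
      coefficient of \<open>u\<close>.\<close>
    define P where "P v = v - t v *\<^sub>R u" for v
    have linP: "linear P"
      by (rule linearI) (simp_all add: P_def t_def inner_add_left add_divide_distrib algebra_simps)
    have Pu: "P v \<bullet> u = 0" for v
      using A by (simp add: P_def t_def inner_diff_left A_def power2_norm_eq_inner)
    have pyth: "(norm (P v + s *\<^sub>R u))\<^sup>2 = (norm (P v))\<^sup>2 + s\<^sup>2 * A" for v s
      using Pu[of v] unfolding A_def power2_norm_eq_inner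
      by (simp add: inner_add inner_commute power2_eq_square)
    have P0: "P u = 0" using A by (simp add: P_def t_def A_def power2_norm_eq_inner)
    have Padd: "P (v + s *\<^sub>R u) = P v" for v s
      using linP P0 by (simp add: linear_add linear_scale)
    have norm_decomp: "(norm v)\<^sup>2 = (norm (P v))\<^sup>2 + (t v)\<^sup>2 * A" for v
      using pyth[of v "t v"] by (simp add: P_def)
    have t_round: "t (v - of_int (round (t v)) *\<^sub>R u) = t v - round (t v)" for v
      using A by (simp add: t_def inner_diff_left diff_divide_distrib A_def power2_norm_eq_inner)
    have round: "(t v - of_int (round (t v)))\<^sup>2 \<le> 1/4" for v
    proof -
      have "\<bar>t v - of_int (round (t v))\<bar> \<le> 1/2"
        using of_int_round_abs_le[of "t v"] by (simp add: abs_minus_commute)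
      then have "\<bar>t v - of_int (round (t v))\<bar>\<^sup>2 \<le> (1/2)\<^sup>2" by (intro power_mono) auto
      then show ?thesis by (simp add: power_divide)
    qed
    \<comment> \<open>Among the lifts of a projected vector one has coefficient of \<open>u\<close>
      at most 1/2 in absolute value. Its square length is at least A/2, since \<open>u\<close> is
      nearly shortest, and the component along \<open>u\<close> accounts for at most A/4 of
      it.\<close>
    have far: "A / 4 \<le> (norm (P (\<Sum>j\<in>J. of_int (n j) *\<^sub>R c j)))\<^sup>2" if n: "\<exists>j\<in>J. n j \<noteq> 0" for n :: "'i \<Rightarrow> int"
    proof -
      define v where "v = (\<Sum>j\<in>J. of_int (n j) *\<^sub>R c j)"
      define w where "w = v - of_int (round (t v)) *\<^sub>R u"
      have "w = (\<Sum>j\<in>I. of_int ((n(i := - round (t v))) j) *\<^sub>R c j)"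
      proof -
        have "(\<Sum>j\<in>J. of_int ((n(i := - round (t v))) j) *\<^sub>R c j) = v"
          unfolding v_def using insert.hyps by (intro sum.cong) auto
        then show ?thesis using insert.hyps by (simp add: I_def w_def u_def)
      qed
      moreover have "\<exists>j\<in>I. (n(i := - round (t v))) j \<noteq> 0"
        using n insert.hyps by (auto simp: I_def)
      ultimately have "A / 2 \<le> (norm w)\<^sup>2"
        using c(2) unfolding lattice_min_def A_def u_def by (elim allE[of _ "n(i := - round (t v))"]) simp
      also have "\<dots> = (norm (P v))\<^sup>2 + (t v - of_int (round (t v)))\<^sup>2 * A"
        using norm_decomp[of w] t_round[of v] Padd[of v "- of_int (round (t v))"] by (simp add: w_def)
      also have "\<dots> \<le> (norm (P v))\<^sup>2 + 1/4 * A"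
        using round A by (intro add_left_mono mult_right_mono) auto
      finally show ?thesis by (simp add: v_def)
    qed
    have "lattice_min J (P \<circ> c) (A / 4)"
      unfolding lattice_min_def using far by (simp add: linear_sum[OF linP] linear_scale[OF linP])
    then obtain d' where d': "transvections J (P \<circ> c) d'"
      "\<And>x. (\<Sum>j\<in>J. (norm (d' j))\<^sup>2 * (x j)\<^sup>2) \<le> K * (norm (\<Sum>j\<in>J. x j *\<^sub>R d' j))\<^sup>2"
      using KJ[of "A / 4"] A by auto
    obtain d where d: "transvections J c d" "d' = P \<circ> d"
      using transvections_linear_lift[OF d'(1) refl linP] by blast
    have di: "d i = u" using transvections_outside[OF d(1)] insert.hyps by (simp add: u_def)
    \<comment> \<open>Size reduction: multiples of \<open>u\<close> are subtracted so that all
      coefficients of \<open>u\<close> are at most 1/2 in absolute value. The projections do not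
      change.\<close>
    define e where "e = (\<lambda>j. if j \<in> J then d j + of_int (- round (t (d j))) *\<^sub>R d i else d j)"
    have "transvections I d e"
      unfolding e_def using insert.hyps finI by (intro transvections_add_multiples) auto
    then have be: "transvections I b e"
      using c(1) transvections_mono[OF d(1) finI(3)] transvections_trans by blast
    have ei: "e i = u" using di insert.hyps by (simp add: e_def)
    have Pe: "P (e j) = d' j" if "j \<in> J" for j
      using that Padd[of "d j" "- of_int (round (t (d j)))"] by (simp add: e_def di d)
    have te: "(t (e j))\<^sup>2 \<le> 1/4" if "j \<in> J" for j
    proof -
      have "e j = d j - of_int (round (t (d j))) *\<^sub>R u"
        using that by (simp add: e_def di)
      then show ?thesis using t_round[of "d j"] round[of "d j"] by metis
    qed
    have A4: "A / 4 \<le> (norm (d' j))\<^sup>2" if "j \<in> J" for j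
    proof -
      have "lattice_min J d' (A / 4)"
        using lattice_min_transvections[OF d'(1) insert.hyps(1) \<open>lattice_min J (P \<circ> c) (A / 4)\<close>] .
      then show ?thesis by (rule lattice_minD1[OF _ insert.hyps(1) that])
    qed
    have "(\<Sum>j\<in>I. (norm (e j))\<^sup>2 * (x j)\<^sup>2) \<le> L * (norm (\<Sum>j\<in>I. x j *\<^sub>R e j))\<^sup>2" for x
    proof -
      define Q where "Q = (norm (\<Sum>j\<in>J. x j *\<^sub>R d' j))\<^sup>2"
      define R where "R = (\<Sum>j\<in>J. (norm (d' j))\<^sup>2 * (x j)\<^sup>2)"
      define T where "T = (\<Sum>j\<in>J. x j * t (e j))"
      have RQ: "R \<le> K * Q" using d'(2) by (simp add: R_def Q_def)
      have R0: "0 \<le> R" by (simp add: R_def sum_nonneg)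
      define v where "v = (\<Sum>j\<in>I. x j *\<^sub>R e j)"
      have v: "v = x i *\<^sub>R u + (\<Sum>j\<in>J. x j *\<^sub>R e j)"
        using insert.hyps by (simp add: v_def I_def ei)
      have Pv: "P v = (\<Sum>j\<in>J. x j *\<^sub>R d' j)"
        unfolding v using P0 by (simp add: linear_add[OF linP] linear_sum[OF linP] linear_scale[OF linP] Pe cong: sum.cong)
      have tv: "t v = x i + T"
        unfolding v T_def using A
        by (simp add: t_def inner_add_left inner_sum_left add_divide_distrib sum_divide_distrib A_def power2_norm_eq_inner)
      have vQ: "(norm v)\<^sup>2 = Q + (x i + T)\<^sup>2 * A"
        using norm_decomp[of v] by (simp add: Pv tv Q_def)
      have "T\<^sup>2 \<le> (\<Sum>j\<in>J. (x j)\<^sup>2) * (\<Sum>j\<in>J. (t (e j))\<^sup>2)"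
        unfolding T_def by (rule Cauchy_Schwarz_ineq_sum)
      also have "\<dots> \<le> (\<Sum>j\<in>J. (x j)\<^sup>2) * (\<Sum>j\<in>J. 1/4)"
        using te by (intro mult_left_mono sum_mono sum_nonneg) auto
      finally have T2: "T\<^sup>2 \<le> (\<Sum>j\<in>J. (x j)\<^sup>2) * card J / 4" by simp
      have AR: "A / 4 * (\<Sum>j\<in>J. (x j)\<^sup>2) \<le> R"
        unfolding R_def sum_distrib_left using A4 by (intro sum_mono mult_right_mono) auto
      have TA: "T\<^sup>2 * A \<le> card J * R"
      proof -
        have "T\<^sup>2 * A \<le> ((\<Sum>j\<in>J. (x j)\<^sup>2) * card J / 4) * A" using T2 A by (intro mult_right_mono) auto
        also have "\<dots> = card J * (A / 4 * (\<Sum>j\<in>J. (x j)\<^sup>2))" by simp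
        also have "\<dots> \<le> card J * R" using AR by (intro mult_left_mono) auto
        finally show ?thesis .
      qed
      have "(norm (e j))\<^sup>2 \<le> 2 * (norm (d' j))\<^sup>2" if "j \<in> J" for j
      proof -
        have "(t (e j))\<^sup>2 * A \<le> 1/4 * A" using te[OF that] A by (intro mult_right_mono) auto
        then show ?thesis using norm_decomp[of "e j"] A4[OF that] Pe[OF that] by simp
      qed
      then have "(\<Sum>j\<in>J. (norm (e j))\<^sup>2 * (x j)\<^sup>2) \<le> (\<Sum>j\<in>J. 2 * ((norm (d' j))\<^sup>2 * (x j)\<^sup>2))"
        by (intro sum_mono) (simp add: mult_right_mono flip: mult.assoc)
      then have J2: "(\<Sum>j\<in>J. (norm (e j))\<^sup>2 * (x j)\<^sup>2) \<le> 2 * R"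
        by (simp add: R_def sum_distrib_left)
      have "(x i)\<^sup>2 \<le> 2 * (x i + T)\<^sup>2 + 2 * T\<^sup>2"
        using zero_le_power2[of "x i + 2 * T"] by (simp add: power2_eq_square algebra_simps)
      then have "A * (x i)\<^sup>2 \<le> A * (2 * (x i + T)\<^sup>2 + 2 * T\<^sup>2)"
        using A by (intro mult_left_mono) auto
      then have i2: "A * (x i)\<^sup>2 \<le> 2 * ((x i + T)\<^sup>2 * A) + 2 * card J * R"
        using TA by (simp add: algebra_simps)
      have "(\<Sum>j\<in>I. (norm (e j))\<^sup>2 * (x j)\<^sup>2) = A * (x i)\<^sup>2 + (\<Sum>j\<in>J. (norm (e j))\<^sup>2 * (x j)\<^sup>2)"
        using insert.hyps by (simp add: I_def ei A_def)
      also have "\<dots> \<le> 2 * ((x i + T)\<^sup>2 * A) + (2 * card J + 2) * R"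
        using i2 J2 by (simp add: algebra_simps)
      also have "\<dots> \<le> L * ((x i + T)\<^sup>2 * A) + (2 * card J + 2) * (K * Q)"
        using RQ R0 L A by (intro add_mono mult_mono) auto
      also have "\<dots> = L * (norm v)\<^sup>2"
        by (simp add: vQ L_def algebra_simps)
      finally show ?thesis by (simp add: v_def)
    qed
    then show ?thesis using be by blast
  qed
  moreover have "1 \<le> L" using L by simp
  ultimately show ?case unfolding I_def by blast
qed

section \<open>The symplectic action\<close>

abbreviation cmat :: "int^'n^'m \<Rightarrow> complex^'n^'m"
  where "cmat \<equiv> map_matrix of_int"

abbreviation cvec :: "int^'n \<Rightarrow> complex^'n"
  where "cvec v \<equiv> (\<chi> i. of_int (v $ i))"

abbreviation cnj_mat :: "complex^'n^'m \<Rightarrow> complex^'n^'m"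
  where "cnj_mat \<equiv> map_matrix cnj"

abbreviation imag :: "complex^'n^'n \<Rightarrow> real^'n^'n"
  where "imag \<equiv> map_matrix Im"

definition bil :: "complex^'n \<Rightarrow> complex^'n \<Rightarrow> complex"
  where "bil u v = (\<Sum>i\<in>UNIV. u $ i * v $ i)"

definition herm :: "real^'n^'n \<Rightarrow> complex^'n \<Rightarrow> real"
  where "herm y z = qf y (\<chi> i. Re (z $ i)) + qf y (\<chi> i. Im (z $ i))"

lemma cmat_mult: "cmat (A ** B) = cmat A ** cmat B"
  by (simp add: vec_eq_iff matrix_matrix_mult_def)

lemma cmat_add: "cmat (A + B) = cmat A + cmat B"
  by (simp add: vec_eq_iff)

lemma cmat_transpose: "cmat (transpose A) = transpose (cmat A)"
  by (simp add: vec_eq_iff transpose_def)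

lemma cmat_1 [simp]: "cmat (mat 1) = mat 1"
  by (simp add: vec_eq_iff mat_def)

lemma cnj_mat_mult: "cnj_mat (A ** B) = cnj_mat A ** cnj_mat B"
  by (simp add: vec_eq_iff matrix_matrix_mult_def)

lemma cnj_mat_add: "cnj_mat (A + B) = cnj_mat A + cnj_mat B"
  by (simp add: vec_eq_iff)

lemma cnj_mat_transpose: "cnj_mat (transpose A) = transpose (cnj_mat A)"
  by (simp add: vec_eq_iff transpose_def)

lemma cnj_mat_cmat [simp]: "cnj_mat (cmat A) = cmat A"
  by (simp add: vec_eq_iff)

lemma cnj_mat_1 [simp]: "cnj_mat (mat 1) = mat 1"
  by (simp add: vec_eq_iff mat_def)

lemma transpose_add: "transpose (A + B) = transpose A + transpose (B :: 'a::plus^'n^'m)"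
  by (simp add: vec_eq_iff transpose_def)

lemma bil_mult_vector: "bil u (X *v v) = bil (transpose X *v u) v"
proof -
  have "bil u (X *v v) = (\<Sum>i\<in>UNIV. \<Sum>j\<in>UNIV. u $ i * X $ i $ j * v $ j)"
    by (simp add: bil_def matrix_vector_mult_def sum_distrib_left mult_ac)
  also have "\<dots> = (\<Sum>j\<in>UNIV. \<Sum>i\<in>UNIV. u $ i * X $ i $ j * v $ j)"
    by (rule sum.swap)
  also have "\<dots> = bil (transpose X *v u) v"
    by (simp add: bil_def matrix_vector_mult_def transpose_def sum_distrib_left mult_ac)
  finally show ?thesis .
qed

lemma bil_diff: "bil u (v - w) = bil u v - bil u w"
  by (simp add: bil_def right_diff_distrib sum_subtractf)

lemma cnj_mult_vector: "(\<chi> i. cnj ((X *v v) $ i)) = cnj_mat X *v (\<chi> i. cnj (v $ i))"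
  by (simp add: vec_eq_iff matrix_vector_mult_def)

lemma bil_herm:
  assumes "transpose y = y"
  shows "bil (\<chi> i. cnj (z $ i)) (map_matrix of_real y *v z) = of_real (herm y z)"
proof -
  define a b :: "real^'a" where "a = (\<chi> i. Re (z $ i))" and "b = (\<chi> i. Im (z $ i))"
  have z: "z $ i = complex_of_real (a $ i) + \<i> * complex_of_real (b $ i)" for i
    by (simp add: a_def b_def complex_eq)
  have "map_matrix of_real y *v z
    = (\<chi> i. complex_of_real ((y *v a) $ i) + \<i> * complex_of_real ((y *v b) $ i))"
    by (simp add: vec_eq_iff matrix_vector_mult_def z distrib_left sum.distrib sum_distrib_left mult_ac)
  then have "bil (\<chi> i. cnj (z $ i)) (map_matrix of_real y *v z)
    = of_real (a \<bullet> (y *v a) + b \<bullet> (y *v b)) + \<i> * of_real (a \<bullet> (y *v b) - b \<bullet> (y *v a))"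
    by (simp add: bil_def inner_vec_def z algebra_simps sum.distrib sum_subtractf sum_distrib_left sum_negf)
  moreover have "a \<bullet> (y *v b) = b \<bullet> (y *v a)"
    using assms by (metis inner_commute inner_matrix_vector)
  ultimately show ?thesis by (simp add: herm_def qf_def a_def b_def)
qed

lemma herm_pos:
  assumes "posdef y" "z \<noteq> 0"
  shows "0 < herm y z"
proof -
  have "(\<chi> i. Re (z $ i)) \<noteq> 0 \<or> (\<chi> i. Im (z $ i)) \<noteq> 0"
    using assms(2) by (auto simp: vec_eq_iff complex_eq_iff)
  then show ?thesis
    using assms(1) qf_nonneg[OF assms(1)] unfolding herm_def posdef_def
    by (meson add_nonneg_pos add_pos_nonneg)
qed

lemma siegel_space_iff: "\<tau> \<in> siegel_space \<longleftrightarrow> transpose \<tau> = \<tau> \<and> posdef (imag \<tau>)"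
proof -
  have "transpose (imag \<tau>) = imag \<tau>" if "transpose \<tau> = \<tau>"
    using that by (simp add: vec_eq_iff transpose_def)
  then show ?thesis by (auto simp: siegel_space_def posdef_def qf_def)
qed

section \<open>Integral symplectic matrices in block form\<close>

definition block_matrix :: "int^'n^'n \<Rightarrow> int^'n^'n \<Rightarrow> int^'n^'n \<Rightarrow> int^'n^'n \<Rightarrow> int^('n::finite + 'n)^('n + 'n)"
  where "block_matrix A B C D = (\<chi> i j. case (i, j) of
      (Inl a, Inl b) \<Rightarrow> A $ a $ b | (Inl a, Inr b) \<Rightarrow> B $ a $ b
    | (Inr a, Inl b) \<Rightarrow> C $ a $ b | (Inr a, Inr b) \<Rightarrow> D $ a $ b)"

text \<open>The first three relations are M^T J M = J, the last three M J M^T = J. The former drive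
  the action on the Siegel space, the latter the action on pairs of integral vectors.\<close>

definition symplectic_blocks :: "int^'n^'n \<Rightarrow> int^'n^'n \<Rightarrow> int^'n^'n \<Rightarrow> int^'n^'n \<Rightarrow> bool"
  where "symplectic_blocks A B C D \<longleftrightarrow>
    transpose A ** C = transpose C ** A \<and> transpose B ** D = transpose D ** B \<and>
    transpose A ** D = transpose C ** B + mat 1 \<and>
    A ** transpose B = B ** transpose A \<and> C ** transpose D = D ** transpose C \<and>
    A ** transpose D = B ** transpose C + mat 1"

lemma sum_UNIV_sum: "(\<Sum>i\<in>UNIV. f i) = (\<Sum>a\<in>UNIV. f (Inl a)) + (\<Sum>a\<in>UNIV. f (Inr a))"
  for f :: "'a::finite + 'b::finite \<Rightarrow> 'c::comm_monoid_add"
  using sum.Plus[of "UNIV :: 'a set" "UNIV :: 'b set" f] by (simp add: o_def)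

lemma block_matrix_in_Sp_int:
  assumes "symplectic_blocks A B C D"
  shows "block_matrix A B C D \<in> Sp_int"
proof -
  define M where "M = block_matrix A B C D"
  have J: "(symplectic_form ** M) $ Inl a $ j = M $ Inr a $ j"
    "(symplectic_form ** M) $ Inr a $ j = - M $ Inl a $ j" for a j
    by (simp_all add: matrix_matrix_mult_def symplectic_form_def sum_UNIV_sum if_distrib[of "\<lambda>x. x * _"]
        cong: if_cong)
  have e: "(transpose M ** (symplectic_form ** M)) $ i $ j
    = (\<Sum>a\<in>UNIV. M $ Inl a $ i * M $ Inr a $ j) - (\<Sum>a\<in>UNIV. M $ Inr a $ i * M $ Inl a $ j)" for i j
    by (subst matrix_matrix_mult_def) (simp add: sum_UNIV_sum J transpose_def sum_negf)
  have nth: "(transpose X ** Y) $ a $ b = (\<Sum>i\<in>UNIV. X $ i $ a * Y $ i $ b)" for X Y :: "int^'a^'a" and a b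
    by (simp add: matrix_matrix_mult_def transpose_def)
  have S: "transpose A ** C = transpose C ** A" "transpose B ** D = transpose D ** B"
    "transpose A ** D = transpose C ** B + mat 1"
    using assms by (simp_all add: symplectic_blocks_def)
  have S': "transpose D ** A = transpose B ** C + mat 1"
    using arg_cong[OF S(3), of transpose] by (simp add: matrix_transpose_mul transpose_add)
  have rel: "(\<Sum>i\<in>UNIV. A $ i $ a * C $ i $ b) = (\<Sum>i\<in>UNIV. C $ i $ a * A $ i $ b)"
    "(\<Sum>i\<in>UNIV. B $ i $ a * D $ i $ b) = (\<Sum>i\<in>UNIV. D $ i $ a * B $ i $ b)"
    "(\<Sum>i\<in>UNIV. A $ i $ a * D $ i $ b) = (\<Sum>i\<in>UNIV. C $ i $ a * B $ i $ b) + (if a = b then 1 else 0)"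
    "(\<Sum>i\<in>UNIV. D $ i $ a * A $ i $ b) = (\<Sum>i\<in>UNIV. B $ i $ a * C $ i $ b) + (if a = b then 1 else 0)"
    for a b
    unfolding nth[symmetric] S S' by (simp_all add: mat_def)
  have "transpose M ** (symplectic_form ** M) = symplectic_form"
    unfolding vec_eq_iff e
  proof (intro allI)
    fix i j :: "'a + 'a"
    show "(\<Sum>a\<in>UNIV. M $ Inl a $ i * M $ Inr a $ j) - (\<Sum>a\<in>UNIV. M $ Inr a $ i * M $ Inl a $ j)
      = symplectic_form $ i $ j"
      by (cases i; cases j) (simp_all add: M_def block_matrix_def symplectic_form_def rel)
  qed
  then show ?thesis by (simp add: Sp_int_def M_def matrix_mul_assoc)
qed

lemma siegel_action_block_matrix:
  "siegel_factor (block_matrix A B C D) \<tau> = cmat C ** \<tau> + cmat D"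
  "siegel_action (block_matrix A B C D) \<tau> =
    (cmat A ** \<tau> + cmat B) ** matrix_inv (cmat C ** \<tau> + cmat D)"
proof -
  have "block_A (block_matrix A B C D) = cmat A" "block_B (block_matrix A B C D) = cmat B"
    "block_C (block_matrix A B C D) = cmat C" "block_D (block_matrix A B C D) = cmat D"
    by (simp_all add: vec_eq_iff block_A_def block_B_def block_C_def block_D_def block_matrix_def)
  then show "siegel_factor (block_matrix A B C D) \<tau> = cmat C ** \<tau> + cmat D"
    "siegel_action (block_matrix A B C D) \<tau> =
    (cmat A ** \<tau> + cmat B) ** matrix_inv (cmat C ** \<tau> + cmat D)"
    by (simp_all add: siegel_factor_def siegel_action_def)
qed

text \<open>M^T J M = J evaluated between the block columns of (\<sigma>, 1) and (\<tau>, 1). For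
  \<sigma> = \<tau> it gives the symmetry of the transformed point, for \<sigma> the conjugate of
  \<tau> its imaginary part.\<close>

lemma symplectic_blocks_cocycle:
  fixes \<sigma> \<tau> :: "complex^'n^'n"
  assumes "symplectic_blocks A B C D"
  shows "(\<sigma> ** transpose (cmat C) + transpose (cmat D)) ** (cmat A ** \<tau> + cmat B)
    - (\<sigma> ** transpose (cmat A) + transpose (cmat B)) ** (cmat C ** \<tau> + cmat D) = \<tau> - \<sigma>"
proof -
  have "transpose (cmat A) ** cmat C = transpose (cmat C) ** cmat A"
    "transpose (cmat B) ** cmat D = transpose (cmat D) ** cmat B"
    "transpose (cmat A) ** cmat D = transpose (cmat C) ** cmat B + mat 1"
    using assms unfolding symplectic_blocks_def
    by (metis cmat_mult cmat_transpose cmat_add cmat_1)+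
  note r1 = this
  have "transpose (cmat D) ** cmat A = transpose (cmat B) ** cmat C + mat 1"
    using arg_cong[OF r1(3), of transpose] by (simp add: matrix_transpose_mul transpose_add)
  then have r4: "transpose (cmat D) ** (cmat A ** X) = transpose (cmat B) ** (cmat C ** X) + X" for X :: "complex^'n^'n"
    by (simp add: matrix_mul_assoc matrix_add_rdistrib)
  have r2: "transpose (cmat A) ** (cmat C ** X) = transpose (cmat C) ** (cmat A ** X)" for X :: "complex^'n^'n"
    by (simp add: matrix_mul_assoc r1)
  show ?thesis
    by (simp add: matrix_add_ldistrib matrix_add_rdistrib r1 r2 r4 flip: matrix_mul_assoc)
qed

definition peter_norm :: "int \<Rightarrow> (complex^'n^'n \<Rightarrow> complex) \<Rightarrow> complex^'n^'n \<Rightarrow> real"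
  where "peter_norm k f \<tau> = det (imag \<tau>) powr (of_int k / 2) * cmod (f \<tau>)"

text \<open>
  A form of the statement that the lattice \<open>\<tau> \<int>\<^sup>g + \<int>\<^sup>g\<close> with the Hermitian form \<open>y\<inverse>\<close> has
  minimum at least \<open>\<mu>\<close> which avoids the inverse: the vector \<open>z\<close> is a test vector in the
  Cauchy-Schwarz inequality. The lattice depends only on the \<open>Sp_int\<close>-orbit of \<open>\<tau>\<close>.
\<close>
definition period_lattice_min :: "real \<Rightarrow> complex^'n^'n \<Rightarrow> bool"
  where "period_lattice_min \<mu> \<tau> \<longleftrightarrow> (\<forall>p q. p \<noteq> 0 \<or> q \<noteq> 0 \<longrightarrow>
    (\<exists>z. z \<noteq> 0 \<and> \<mu> * herm (imag \<tau>) z \<le> (cmod (bil z (\<tau> *v cvec p + cvec q)))\<^sup>2))"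

lemma cvec_mult: "cvec (A *v v) = cmat A *v cvec v"
  by (simp add: vec_eq_iff matrix_vector_mult_def)

lemma cvec_add: "cvec (u + v) = cvec u + cvec v"
  by (simp add: vec_eq_iff)

text \<open>The relations M J M^T = J recover p and q from the two combinations, with the blocks D,
  - C and A, - B.\<close>

lemma symplectic_blocks_vector_nonzero:
  assumes "symplectic_blocks A B C D" "p \<noteq> 0 \<or> q \<noteq> 0"
  shows "transpose A *v p + transpose C *v q \<noteq> 0 \<or> transpose B *v p + transpose D *v q \<noteq> 0"
proof (rule ccontr)
  define u v where "u = transpose A *v p + transpose C *v q" and "v = transpose B *v p + transpose D *v q"
  assume "\<not> ?thesis"
  then have 0: "u = 0" "v = 0" by (auto simp: u_def v_def)
  have r: "A ** transpose B = B ** transpose A" "C ** transpose D = D ** transpose C"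
    "A ** transpose D = B ** transpose C + mat 1"
    using assms(1) by (auto simp: symplectic_blocks_def)
  have r': "D ** transpose A = C ** transpose B + mat 1"
    using arg_cong[OF r(3), of transpose] by (simp add: matrix_transpose_mul transpose_add)
  have "D *v u - C *v v = p" "A *v v - B *v u = q"
    unfolding u_def v_def
    by (simp_all add: matrix_vector_right_distrib matrix_vector_mul_assoc r r' matrix_vector_mult_add_rdistrib
        del: transpose_matrix_vector)
  then show False using 0 assms(2) by simp
qed

lemma det_map_cnj: "det (cnj_mat A) = cnj (det A)"
  by (simp add: det_def)

lemma det_map_of_real: "det (map_matrix complex_of_real A) = of_real (det A)"
  by (simp add: det_def)

lemma map_matrix_mult_left: "map_matrix ((*) c) A ** B = map_matrix ((*) c) (A ** (B :: complex^'n^'m))"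
  by (simp add: vec_eq_iff matrix_matrix_mult_def sum_distrib_left mult_ac)

lemma map_matrix_mult_right: "A ** map_matrix ((*) c) B = map_matrix ((*) c) (A ** (B :: complex^'n^'m))"
  by (simp add: vec_eq_iff matrix_matrix_mult_def sum_distrib_left mult_ac)

text \<open>Equivalence of points is reduced to the consequences the argument uses. The relation is
  then transitive by inspection, and symplectic matrices never have to be multiplied.\<close>

definition siegel_move :: "complex^'n^'n \<Rightarrow> complex^'n^'n \<Rightarrow> bool"
  where "siegel_move \<tau> \<tau>' \<longleftrightarrow> \<tau>' \<in> siegel_space \<and>
    (\<forall>k f. siegel_modular_form k f \<longrightarrow> peter_norm k f \<tau>' = peter_norm k f \<tau>) \<and>
    (\<forall>\<mu>. period_lattice_min \<mu> \<tau> \<longrightarrow> period_lattice_min \<mu> \<tau>')"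

text \<open>All claims follow from two instances of the cocycle identity, which make
  \<open>\<tau>'\<close> symmetric and give Z^H (Im \<tau>') Z = Im \<tau>, where Z^H is the
  conjugate transpose.\<close>

theorem siegel_transformation:
  fixes \<tau> :: "complex^'n^'n"
  assumes S: "symplectic_blocks A B C D" and \<tau>: "\<tau> \<in> siegel_space"
  defines "Z \<equiv> cmat C ** \<tau> + cmat D"
  obtains \<tau>' where "\<tau>' ** Z = cmat A ** \<tau> + cmat B"
    "det Z \<noteq> 0" "det (imag \<tau>') * (cmod (det Z))\<^sup>2 = det (imag \<tau>)"
    "siegel_move \<tau> \<tau>'"
proof -
  define W where "W = cmat A ** \<tau> + cmat B"
  define Y where "Y \<sigma> = map_matrix complex_of_real (imag \<sigma>)" for \<sigma> :: "complex^'n^'n"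
  have sym: "transpose \<tau> = \<tau>" and pd: "posdef (imag \<tau>)"
    using \<tau> by (auto simp: siegel_space_iff)
  have 2: "\<sigma> - cnj_mat \<sigma> = map_matrix ((*) (2 * \<i>)) (Y \<sigma>)" for \<sigma> :: "complex^'n^'n"
    by (simp add: vec_eq_iff Y_def complex_diff_cnj)
  have symc: "transpose (cnj_mat \<tau>) = cnj_mat \<tau>"
    using sym by (metis cnj_mat_transpose)
  have tZ: "transpose Z = \<tau> ** transpose (cmat C) + transpose (cmat D)"
    by (simp add: Z_def matrix_transpose_mul transpose_add sym)
  have tW: "transpose W = \<tau> ** transpose (cmat A) + transpose (cmat B)"
    by (simp add: W_def matrix_transpose_mul transpose_add sym)
  have tZc: "transpose (cnj_mat Z) = cnj_mat \<tau> ** transpose (cmat C) + transpose (cmat D)"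
    by (simp add: Z_def matrix_transpose_mul transpose_add symc cnj_mat_add cnj_mat_mult)
  have tWc: "transpose (cnj_mat W) = cnj_mat \<tau> ** transpose (cmat A) + transpose (cmat B)"
    by (simp add: W_def matrix_transpose_mul transpose_add symc cnj_mat_add cnj_mat_mult)
  have ZW: "transpose Z ** W - transpose W ** Z = 0"
    using symplectic_blocks_cocycle[OF S, of \<tau> \<tau>] unfolding tZ tW by (simp add: Z_def W_def)
  have ZWc: "transpose (cnj_mat Z) ** W - transpose (cnj_mat W) ** Z = \<tau> - cnj_mat \<tau>"
    using symplectic_blocks_cocycle[OF S, of "cnj_mat \<tau>" \<tau>] unfolding tZc tWc by (simp add: Z_def W_def)
  \<comment> \<open>Pairing \<open>ZWc\<close> with \<open>w\<close> and its conjugate: a kernel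
    vector of \<open>Z\<close> makes the left side vanish, hence also the Hermitian form of Im
    \<tau> at \<open>w\<close>.\<close>
  have "w = 0" if "Z *v w = 0" for w
  proof (rule ccontr)
    assume "w \<noteq> 0"
    let ?w = "\<chi> i. cnj (w $ i)"
    have "cnj_mat Z *v ?w = 0"
      using cnj_mult_vector[of Z w] that by (simp add: vec_eq_iff)
    then have "bil ?w ((\<tau> - cnj_mat \<tau>) *v w) = 0"
      unfolding ZWc[symmetric]
      by (simp add: matrix_vector_mult_diff_rdistrib that bil_mult_vector[of ?w "transpose _"] bil_diff
          del: transpose_matrix_vector flip: matrix_vector_mul_assoc) (simp add: bil_def)
    moreover have "(\<tau> - cnj_mat \<tau>) *v w = (2 * \<i>) *s (Y \<tau> *v w)"
      unfolding 2 by (simp add: vec_eq_iff matrix_vector_mult_def sum_distrib_left mult_ac)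
    then have "bil ?w ((\<tau> - cnj_mat \<tau>) *v w) = 2 * \<i> * bil ?w (Y \<tau> *v w)"
      by (simp add: bil_def sum_distrib_left mult_ac)
    moreover have "bil ?w (Y \<tau> *v w) = of_real (herm (imag \<tau>) w)"
      unfolding Y_def using pd by (intro bil_herm) (auto simp: posdef_def)
    ultimately show False using herm_pos[OF pd \<open>w \<noteq> 0\<close>] by simp
  qed
  then have "\<exists>Zi. Zi ** Z = mat 1"
    by (simp add: matrix_left_invertible_ker)
  then have inv: "invertible Z" by (simp add: invertible_left_inverse)
  define Zi where "Zi = matrix_inv Z"
  have Zi: "Z ** Zi = mat 1" "Zi ** Z = mat 1"
    using inv someI_ex[of "\<lambda>A'. Z ** A' = mat 1 \<and> A' ** Z = mat 1"]
    by (auto simp: Zi_def matrix_inv_def invertible_def)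
  have dZ: "det Z \<noteq> 0" using inv by (simp add: invertible_det_nz)
  define \<tau>' where "\<tau>' = W ** Zi"
  have \<tau>'Z: "\<tau>' ** Z = W" by (simp add: \<tau>'_def Zi flip: matrix_mul_assoc)
  have Zt: "transpose Zi ** transpose Z = mat 1" "transpose Z ** transpose Zi = mat 1"
    by (simp_all add: Zi flip: matrix_transpose_mul)
  have "transpose \<tau>' = transpose Zi ** (transpose W ** Z) ** Zi"
    by (simp add: \<tau>'_def matrix_transpose_mul Zi flip: matrix_mul_assoc)
  also have "transpose W ** Z = transpose Z ** W" using ZW by simp
  also have "transpose Zi ** (transpose Z ** W) ** Zi = (transpose Zi ** transpose Z) ** W ** Zi"
    by (simp only: matrix_mul_assoc)
  finally have sym': "transpose \<tau>' = \<tau>'" by (simp add: Zt \<tau>'_def)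
  have Ztc: "transpose (cnj_mat Z) ** transpose (cnj_mat Zi) = mat 1"
    using Zi(2) by (simp flip: matrix_transpose_mul cnj_mat_mult)
  have "transpose (cnj_mat Z) ** cnj_mat \<tau>' = transpose (cnj_mat Z) ** transpose (cnj_mat \<tau>')"
    using sym' by (metis cnj_mat_transpose)
  also have "\<dots> = transpose (cnj_mat W)"
    by (simp add: \<tau>'_def cnj_mat_mult matrix_transpose_mul matrix_mul_assoc Ztc)
  finally have "transpose (cnj_mat Z) ** (\<tau>' - cnj_mat \<tau>') ** Z = \<tau> - cnj_mat \<tau>"
    by (simp add: matrix_diff_ldistrib matrix_diff_rdistrib ZWc \<tau>'Z flip: matrix_mul_assoc)
  then have "map_matrix ((*) (2 * \<i>)) (transpose (cnj_mat Z) ** Y \<tau>' ** Z) = map_matrix ((*) (2 * \<i>)) (Y \<tau>)"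
    by (simp add: 2 map_matrix_mult_left map_matrix_mult_right)
  then have YZ: "transpose (cnj_mat Z) ** Y \<tau>' ** Z = Y \<tau>"
    by (simp add: vec_eq_iff)
  have symI: "transpose (imag \<tau>') = imag \<tau>'"
    using sym' by (simp add: vec_eq_iff transpose_def)
  have hZ: "herm (imag \<tau>') (Z *v w) = herm (imag \<tau>) w" for w
  proof -
    let ?w = "\<chi> i. cnj (w $ i)"
    have "complex_of_real (herm (imag \<tau>) w) = bil ?w (Y \<tau> *v w)"
      unfolding Y_def using pd by (intro bil_herm[symmetric]) (auto simp: posdef_def)
    also have "\<dots> = bil (cnj_mat Z *v ?w) (Y \<tau>' *v (Z *v w))"
      unfolding YZ[symmetric]
      by (simp add: bil_mult_vector[of ?w "transpose _"] del: transpose_matrix_vector flip: matrix_vector_mul_assoc)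
    also have "\<dots> = of_real (herm (imag \<tau>') (Z *v w))"
      unfolding Y_def cnj_mult_vector[symmetric] by (rule bil_herm[OF symI])
    finally show ?thesis by (simp only: of_real_eq_iff)
  qed
  have "0 < qf (imag \<tau>') x" if "x \<noteq> 0" for x
  proof -
    define c where "c = (\<chi> i. complex_of_real (x $ i))"
    have "c \<noteq> 0" using that by (auto simp: c_def vec_eq_iff)
    have Zc: "Z *v (Zi *v c) = c" by (simp add: matrix_vector_mul_assoc Zi)
    then have "Zi *v c \<noteq> 0" using \<open>c \<noteq> 0\<close> by auto
    then have "0 < herm (imag \<tau>') c" using hZ[of "Zi *v c"] herm_pos[OF pd] Zc by metis
    also have "herm (imag \<tau>') c = qf (imag \<tau>') x"
      by (simp add: herm_def c_def qf_def zero_vec_def[symmetric])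
    finally show ?thesis .
  qed
  then have pd': "posdef (imag \<tau>')" using symI by (simp add: posdef_def)
  have \<tau>'H: "\<tau>' \<in> siegel_space" using sym' pd' by (simp add: siegel_space_iff)
  have "cnj (det Z) * of_real (det (imag \<tau>')) * det Z = complex_of_real (det (imag \<tau>))"
    using arg_cong[OF YZ, of det] by (simp add: det_mul Y_def det_map_of_real det_map_cnj)
  then have "complex_of_real (det (imag \<tau>') * (cmod (det Z))\<^sup>2) = complex_of_real (det (imag \<tau>))"
    unfolding of_real_mult complex_norm_square by (simp only: mult_ac)
  then have det: "det (imag \<tau>') * (cmod (det Z))\<^sup>2 = det (imag \<tau>)"
    by (simp only: of_real_eq_iff)
  have "peter_norm k f \<tau>' = peter_norm k f \<tau>" if f: "siegel_modular_form k f" for k f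
  proof -
    have act: "siegel_action (block_matrix A B C D) \<tau> = \<tau>'"
      "siegel_factor (block_matrix A B C D) \<tau> = Z"
      by (simp_all add: siegel_action_block_matrix \<tau>'_def W_def Zi_def Z_def)
    have "f \<tau>' = det Z powi k * f \<tau>"
    proof -
      have "f (siegel_action (block_matrix A B C D) \<tau>)
        = det (siegel_factor (block_matrix A B C D) \<tau>) powi k * f \<tau>"
        using f \<tau> block_matrix_in_Sp_int[OF S] unfolding siegel_modular_form_def by blast
      then show ?thesis by (simp only: act)
    qed
    moreover have "det (imag \<tau>) powr (of_int k / 2) = det (imag \<tau>') powr (of_int k / 2) * cmod (det Z) powr of_int k"
    proof -
      have "(cmod (det Z))\<^sup>2 = cmod (det Z) powr 2" using dZ by simp
      then have "((cmod (det Z))\<^sup>2) powr (of_int k / 2) = cmod (det Z) powr of_int k"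
        by (simp only: powr_powr) simp
      then show ?thesis unfolding det[symmetric] powr_mult by simp
    qed
    moreover have "cmod (det Z) powr of_int k = cmod (det Z) powi k"
      using dZ by (simp add: powr_real_of_int')
    ultimately show ?thesis
      by (simp add: peter_norm_def norm_mult norm_power_int)
  qed
  moreover have "period_lattice_min \<mu> \<tau>'" if L: "period_lattice_min \<mu> \<tau>" for \<mu>
    unfolding period_lattice_min_def
  proof (intro allI impI)
    fix p q :: "int^'n" assume pq: "p \<noteq> 0 \<or> q \<noteq> 0"
    \<comment> \<open>(u, v) is the image of (p, q) under M^T. Multiplication by the transpose of
      \<open>Z\<close> carries \<tau>' p + q to \<tau> u + v, so the period lattices correspond and
      \<open>Z *v z\<close> is the new test vector.\<close>
    define u v where "u = transpose A *v p + transpose C *v q" and "v = transpose B *v p + transpose D *v q"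
    have "u \<noteq> 0 \<or> v \<noteq> 0" unfolding u_def v_def by (rule symplectic_blocks_vector_nonzero[OF S pq])
    then obtain z where z: "z \<noteq> 0" "\<mu> * herm (imag \<tau>) z \<le> (cmod (bil z (\<tau> *v cvec u + cvec v)))\<^sup>2"
      using L unfolding period_lattice_min_def by blast
    have "transpose Z ** \<tau>' = transpose W"
      using arg_cong[OF \<tau>'Z, of transpose] by (simp add: matrix_transpose_mul sym')
    then have "transpose Z *v (\<tau>' *v cvec p + cvec q) = transpose W *v cvec p + transpose Z *v cvec q"
      by (simp add: matrix_vector_right_distrib matrix_vector_mul_assoc del: transpose_matrix_vector)
    also have "\<dots> = \<tau> *v cvec u + cvec v"
      unfolding tZ tW u_def v_def cvec_add cvec_mult cmat_transpose
      by (simp add: matrix_vector_right_distrib matrix_vector_mult_add_rdistrib matrix_vector_mul_assoc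
          del: transpose_matrix_vector)
    finally have "bil (Z *v z) (\<tau>' *v cvec p + cvec q) = bil z (\<tau> *v cvec u + cvec v)"
      using bil_mult_vector[of z "transpose Z" "\<tau>' *v cvec p + cvec q"]
      by (simp del: transpose_matrix_vector)
    moreover have "Z *v z \<noteq> 0"
      using z(1) Zi(2) by (metis matrix_vector_mul_assoc matrix_vector_mul_lid matrix_vector_mult_0_right)
    ultimately show "\<exists>z. z \<noteq> 0 \<and> \<mu> * herm (imag \<tau>') z \<le> (cmod (bil z (\<tau>' *v cvec p + cvec q)))\<^sup>2"
      using z(2) hZ[of z] by (intro exI[of _ "Z *v z"]) simp
  qed
  ultimately show ?thesis
    using \<tau>'Z \<tau>'H by (intro that[of \<tau>'] dZ det) (simp_all add: W_def siegel_move_def)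
qed

section \<open>Points with large imaginary part\<close>

lemma siegel_move_refl: "\<tau> \<in> siegel_space \<Longrightarrow> siegel_move \<tau> \<tau>"
  by (simp add: siegel_move_def)

lemma siegel_move_trans: "siegel_move \<tau> \<tau>' \<Longrightarrow> siegel_move \<tau>' \<tau>'' \<Longrightarrow> siegel_move \<tau> \<tau>''"
  by (simp add: siegel_move_def)

lemma siegel_move_in: "siegel_move \<tau> \<tau>' \<Longrightarrow> \<tau>' \<in> siegel_space"
  by (simp add: siegel_move_def)

lemma int_matrix_zero [simp]:
  "transpose (0 :: int^'n^'n) = 0" "(0 :: int^'n^'n) ** X = 0" "X ** (0 :: int^'n^'n) = 0"
  by (simp_all add: vec_eq_iff transpose_def matrix_matrix_mult_def)

lemma siegel_move_translation:
  fixes \<tau> :: "complex^'n^'n"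
  assumes "\<tau> \<in> siegel_space" "transpose S = S"
  shows "siegel_move \<tau> (\<tau> + cmat S)"
proof -
  have "symplectic_blocks (mat 1) S 0 (mat 1)"
    using assms(2) by (simp add: symplectic_blocks_def)
  from siegel_transformation[OF this assms(1)] obtain \<tau>' where
    "\<tau>' ** (cmat 0 ** \<tau> + cmat (mat 1)) = cmat (mat 1) ** \<tau> + cmat S" "siegel_move \<tau> \<tau>'"
    by blast
  moreover have "cmat 0 ** \<tau> = (0 :: complex^'n^'n)"
    by (simp add: vec_eq_iff matrix_matrix_mult_def)
  ultimately show ?thesis by simp
qed

lemma siegel_move_unimodular:
  fixes \<tau> :: "complex^'n^'n"
  assumes \<tau>: "\<tau> \<in> siegel_space" and uw: "u ** w = mat 1" "w ** u = mat 1"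
  shows "siegel_move \<tau> (cmat u ** \<tau> ** transpose (cmat u))"
    and "det (imag (cmat u ** \<tau> ** transpose (cmat u))) = det (imag \<tau>)"
proof -
  have t: "transpose u ** transpose w = mat 1" "transpose w ** transpose u = mat 1"
    by (simp_all add: uw flip: matrix_transpose_mul)
  have 0: "0 ** X = (0 :: complex^'n^'n)" "cmat 0 = (0 :: complex^'n^'n)" for X :: "complex^'n^'n"
    by (simp_all add: vec_eq_iff matrix_matrix_mult_def)
  have "symplectic_blocks u 0 0 (transpose w)"
    using uw t by (simp add: symplectic_blocks_def)
  from siegel_transformation[OF this \<tau>, unfolded 0 add_0_left add_0_right] obtain \<tau>' where
    1: "\<tau>' ** cmat (transpose w) = cmat u ** \<tau>" and "det (cmat (transpose w) :: complex^'n^'n) \<noteq> 0"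
    and 2: "det (imag \<tau>') * (cmod (det (cmat (transpose w) :: complex^'n^'n)))\<^sup>2 = det (imag \<tau>)"
      "siegel_move \<tau> \<tau>'"
    .
  have "\<tau>' = \<tau>' ** cmat (transpose w) ** cmat (transpose u)"
    by (simp add: t flip: matrix_mul_assoc cmat_mult)
  then have e: "\<tau>' = cmat u ** \<tau> ** transpose (cmat u)"
    unfolding 1 by (simp only: cmat_transpose)
  have "det u * det w = 1" using arg_cong[OF uw(1), of det] by (simp add: det_mul)
  then have "\<bar>det w\<bar> = 1" by (auto simp: zmult_eq_1_iff)
  moreover have "det (cmat (transpose w)) = (of_int (det w) :: complex)"
    by (simp add: cmat_transpose) (simp add: det_def)
  ultimately have "cmod (det (cmat (transpose w) :: complex^'n^'n)) = 1"
    by (simp flip: of_int_abs)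
  then show "siegel_move \<tau> (cmat u ** \<tau> ** transpose (cmat u))"
    "det (imag (cmat u ** \<tau> ** transpose (cmat u))) = det (imag \<tau>)"
    using 2 by (simp_all flip: e)
qed

text \<open>The map -1/\<tau> of SL_2(Z) embedded in coordinate \<open>k\<close>. The factor is the
  identity matrix with row \<open>k\<close> replaced by that of \<tau>, so Cramer's rule gives its
  determinant.\<close>

lemma siegel_move_inversion:
  fixes \<tau> :: "complex^'n^'n"
  assumes \<tau>: "\<tau> \<in> siegel_space"
  obtains \<tau>' where "siegel_move \<tau> \<tau>'" "det (imag \<tau>') * (cmod (\<tau> $ k $ k))\<^sup>2 = det (imag \<tau>)"
proof -
  define E :: "int^'n^'n" where "E = (\<chi> i j. if i = k \<and> j = k then 1 else 0)"
  have EE: "E ** E = E"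
    by (auto simp: vec_eq_iff matrix_matrix_mult_def E_def if_distrib[of "\<lambda>x. x * _"] cong: if_cong)
  have tE: "transpose E = E" by (auto simp: E_def transpose_def vec_eq_iff)
  have tE': "transpose (mat 1 - E) = mat 1 - E" "transpose (- E) = - E"
    using tE by (auto simp: transpose_def vec_eq_iff mat_def)
  have neg: "(- X) ** Y = - (X ** Y)" "Y ** (- X) = - (Y ** X)" for X Y :: "int^'n^'n"
    by (simp_all add: vec_eq_iff matrix_matrix_mult_def sum_negf)
  have "symplectic_blocks (mat 1 - E) (- E) E (mat 1 - E)"
    by (simp add: symplectic_blocks_def tE tE' neg matrix_diff_ldistrib matrix_diff_rdistrib EE)
  from siegel_transformation[OF this \<tau>] obtain \<tau>' where
    1: "siegel_move \<tau> \<tau>'" and 2: "det (imag \<tau>') * (cmod (det (cmat E ** \<tau> + cmat (mat 1 - E))))\<^sup>2 = det (imag \<tau>)"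
    by blast
  have "(cmat E ** \<tau> + cmat (mat 1 - E)) $ i $ j = (if i = k then \<tau> $ k $ j else mat 1 $ i $ j)" for i j
    by (auto simp: matrix_matrix_mult_def E_def mat_def if_distrib[of "\<lambda>x. x * _"] if_distrib[of of_int] cong: if_cong)
  then have "transpose (cmat E ** \<tau> + cmat (mat 1 - E))
    = (\<chi> i j. if j = k then (mat 1 *v (\<tau> $ k)) $ i else mat 1 $ i $ j)"
    by (simp add: vec_eq_iff transpose_def) (auto simp: mat_def)
  then have "det (transpose (cmat E ** \<tau> + cmat (mat 1 - E))) = (\<tau> $ k) $ k * det (mat 1 :: complex^'n^'n)"
    by (simp only: cramer_lemma)
  then have "det (cmat E ** \<tau> + cmat (mat 1 - E)) = \<tau> $ k $ k"
    by (simp only: det_transpose det_I mult_1_right)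
  then show ?thesis using that 1 2 by simp
qed

text \<open>Turns the imaginary part into a lattice basis, to which the reduction theory
  applies.\<close>

definition gram :: "('n \<Rightarrow> real^'n) \<Rightarrow> real^'n^'n"
  where "gram b = (\<chi> i j. b i \<bullet> b j)"

lemma qf_gram: "qf (gram b) x = (norm (\<Sum>i\<in>UNIV. x $ i *\<^sub>R b i))\<^sup>2"
  by (simp add: qf_def gram_def inner_vec_def[of x] matrix_vector_mult_def power2_norm_eq_inner
      inner_sum_left inner_sum_right sum_distrib_left mult_ac) (simp add: inner_commute)

lemma posdef_imp_gram:
  fixes y :: "real^'n^'n"
  assumes "posdef y"
  obtains b where "y = gram b"
proof -
  obtain B :: "real^'n^'n" where B: "transpose B ** y ** B = mat 1"
    by (rule posdef_imp_congruent_mat_1[OF assms])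
  define A where "A = transpose B ** y"
  have "transpose A ** A = y ** (B ** (transpose B ** y))"
    using assms by (simp add: A_def posdef_def matrix_transpose_mul matrix_mul_assoc)
  then have "y = transpose A ** A" by (simp add: congruent_mat_1_inverse[OF B])
  also have "\<dots> = gram (\<lambda>i. column i A)"
    by (simp add: gram_def vec_eq_iff matrix_matrix_mult_def transpose_def column_def inner_vec_def)
  finally show ?thesis using that by blast
qed

text \<open>A shear of the basis multiplies by the elementary matrix \<open>E a\<close>, whose
  inverse is \<open>E (- a)\<close>; Gram matrices transform in the same way as imaginary
  parts.\<close>

lemma siegel_move_transvections:
  fixes \<tau> :: "complex^'n^'n"
  assumes "transvections UNIV b c" "\<tau> \<in> siegel_space" "imag \<tau> = gram b"
  shows "\<exists>\<tau>'. siegel_move \<tau> \<tau>' \<and> imag \<tau>' = gram c \<and> det (imag \<tau>') = det (imag \<tau>)"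
  using assms
proof induction
  case idle
  then show ?case using siegel_move_refl by blast
next
  case (shear c j k a)
  then obtain \<sigma> where \<sigma>: "siegel_move \<tau> \<sigma>" "imag \<sigma> = gram c" "det (imag \<sigma>) = det (imag \<tau>)" by blast
  define E :: "int \<Rightarrow> int^'n^'n" where "E s = (\<chi> p q. if p = q then 1 else if p = k \<and> q = j then s else 0)" for s
  have E: "E s ** E (- s) = mat 1" for s
  proof -
    have "(E s ** E (- s)) $ p $ q = mat 1 $ p $ q" for p q
    proof -
      have "(E s ** E (- s)) $ p $ q = (\<Sum>r\<in>UNIV. E s $ p $ r * E (- s) $ r $ q)"
        by (simp add: matrix_matrix_mult_def)
      also have "\<dots> = (\<Sum>r\<in>UNIV. (if r = p then E (- s) $ p $ q else 0) + (if r = j then (if p = k then s * E (- s) $ j $ q else 0) else 0))"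
        using shear.hyps(4) by (intro sum.cong) (auto simp: E_def)
      also have "\<dots> = E (- s) $ p $ q + (if p = k then s * E (- s) $ j $ q else 0)"
        by (simp add: sum.distrib)
      also have "\<dots> = mat 1 $ p $ q" using shear.hyps(4) by (auto simp: E_def mat_def)
      finally show ?thesis .
    qed
    then show ?thesis by (simp add: vec_eq_iff)
  qed
  define \<tau>' where "\<tau>' = cmat (E a) ** \<sigma> ** transpose (cmat (E a))"
  have m: "siegel_move \<sigma> \<tau>'" "det (imag \<tau>') = det (imag \<sigma>)"
    using siegel_move_unimodular[OF siegel_move_in[OF \<sigma>(1)], of "E a" "E (- a)"] E[of a] E[of "- a"]
    by (simp_all add: \<tau>'_def)
  let ?d = "c(k := c k + of_int a *\<^sub>R c j)"
  have d: "?d p = (\<Sum>r\<in>UNIV. of_int (E a $ p $ r) *\<^sub>R c r)" for p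
  proof -
    have "(\<Sum>r\<in>UNIV. of_int (E a $ p $ r) *\<^sub>R c r)
      = (\<Sum>r\<in>UNIV. (if r = p then c p else 0) + (if r = j then (if p = k then of_int a *\<^sub>R c j else 0) else 0))"
      using shear.hyps(4) by (intro sum.cong) (auto simp: E_def)
    also have "\<dots> = ?d p" by (simp add: sum.distrib)
    finally show ?thesis by simp
  qed
  have "imag \<tau>' $ p $ q = gram ?d $ p $ q" for p q
  proof -
    have "imag \<tau>' $ p $ q = (\<Sum>s\<in>UNIV. \<Sum>r\<in>UNIV. of_int (E a $ p $ r) * imag \<sigma> $ r $ s * of_int (E a $ q $ s))"
      by (simp add: \<tau>'_def matrix_matrix_mult_def transpose_def sum_distrib_right)
    also have "\<dots> = (\<Sum>s\<in>UNIV. \<Sum>r\<in>UNIV. of_int (E a $ p $ r) * (c r \<bullet> c s) * of_int (E a $ q $ s))"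
      unfolding \<sigma>(2) by (simp add: gram_def)
    also have "\<dots> = gram ?d $ p $ q"
      unfolding gram_def d by (simp add: inner_sum_left inner_sum_right sum_distrib_left mult_ac)
    finally show ?thesis .
  qed
  then have "imag \<tau>' = gram ?d" by (simp add: vec_eq_iff)
  then show ?case using m \<sigma> siegel_move_trans by metis
qed

section \<open>Bounding the determinant along an orbit\<close>

lemma posdef_norm_bounds:
  fixes y :: "real^'n^'n"
  assumes "posdef y"
  obtains l u where "0 < l" "0 < u" "\<And>x. l * (norm x)\<^sup>2 \<le> qf y x" "\<And>x. qf y x \<le> u * (norm x)\<^sup>2"
proof -
  obtain B :: "real^'n^'n" where B: "transpose B ** y ** B = mat 1"
    by (rule posdef_imp_congruent_mat_1[OF assms])
  obtain A :: "real^'n^'n" where A: "\<And>x. qf y x = (norm (A *v x))\<^sup>2" "\<And>x. B *v (A *v x) = x"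
    using posdef_eq_norm[OF B] by blast
  obtain c where c: "\<And>z. norm (B *v z) \<le> norm z * c" "c > 0"
    using bounded_linear.pos_bounded[OF matrix_vector_mul_bounded_linear[of B]] by metis
  obtain d where d: "\<And>z. norm (A *v z) \<le> norm z * d" "d > 0"
    using bounded_linear.pos_bounded[OF matrix_vector_mul_bounded_linear[of A]] by metis
  show ?thesis
  proof (rule that[of "1 / c\<^sup>2" "d\<^sup>2"])
    fix x
    have "(norm x)\<^sup>2 \<le> (norm (A *v x) * c)\<^sup>2" using c(1)[of "A *v x"] A(2)[of x] by (intro power_mono) auto
    then show "1 / c\<^sup>2 * (norm x)\<^sup>2 \<le> qf y x"
      using c(2) by (simp add: A power_mult_distrib divide_le_eq)
    have "(norm (A *v x))\<^sup>2 \<le> (norm x * d)\<^sup>2" using d(1) by (intro power_mono) auto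
    then show "qf y x \<le> d\<^sup>2 * (norm x)\<^sup>2" by (simp add: A power_mult_distrib mult.commute)
  qed (use c d in auto)
qed

lemma norm_rvec_ge_1:
  assumes "v \<noteq> 0"
  shows "1 \<le> (norm (rvec v))\<^sup>2"
proof -
  obtain i where i: "v $ i \<noteq> 0" using assms by (auto simp: vec_eq_iff)
  then have "1 \<le> \<bar>v $ i\<bar>" by simp
  then have "1 \<le> \<bar>rvec v $ i\<bar>" by (simp add: rvec_def flip: of_int_abs)
  also have "\<dots> \<le> norm (rvec v)" by (rule component_le_norm_cart)
  finally show ?thesis by (simp add: one_le_power)
qed

lemma herm_cvec: "herm y (cvec v) = qf y (rvec v)"
  by (simp add: herm_def rvec_def flip: zero_vec_def)

text \<open>The vector p serves as its own test vector: the imaginary part of the pairing is y[p],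
  whatever q is. If p = 0, the vector q does, and the pairing is its squared norm.\<close>

lemma exists_period_lattice_min:
  fixes \<tau> :: "complex^'n^'n"
  assumes "\<tau> \<in> siegel_space"
  obtains \<mu> where "0 < \<mu>" "period_lattice_min \<mu> \<tau>"
proof -
  define y where "y = imag \<tau>"
  have y: "posdef y" using assms by (simp add: y_def siegel_space_iff)
  obtain l u where lu: "0 < l" "0 < u" "\<And>x. l * (norm x)\<^sup>2 \<le> qf y x" "\<And>x. qf y x \<le> u * (norm x)\<^sup>2"
    using posdef_norm_bounds[OF y] by blast
  define \<mu> where "\<mu> = min l (1 / u)"
  have "period_lattice_min \<mu> \<tau>"
    unfolding period_lattice_min_def y_def[symmetric]
  proof (intro allI impI)
    fix p q :: "int^'n" assume pq: "p \<noteq> 0 \<or> q \<noteq> 0"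
    show "\<exists>z. z \<noteq> 0 \<and> \<mu> * herm y z \<le> (cmod (bil z (\<tau> *v cvec p + cvec q)))\<^sup>2"
    proof (cases "p = 0")
      case False
      have "Im (bil (cvec p) (\<tau> *v cvec p + cvec q)) = qf y (rvec p)"
        by (simp add: bil_def y_def qf_def rvec_def inner_vec_def matrix_vector_mult_def algebra_simps)
      then have "\<bar>qf y (rvec p)\<bar> \<le> cmod (bil (cvec p) (\<tau> *v cvec p + cvec q))"
        using abs_Im_le_cmod by metis
      then have "(qf y (rvec p))\<^sup>2 \<le> (cmod (bil (cvec p) (\<tau> *v cvec p + cvec q)))\<^sup>2"
        using power_mono[of "\<bar>qf y (rvec p)\<bar>" _ 2] by simp
      moreover have "\<mu> \<le> qf y (rvec p)"
      proof -
        have "\<mu> \<le> l * 1" by (simp add: \<mu>_def)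
        also have "\<dots> \<le> l * (norm (rvec p))\<^sup>2"
          using norm_rvec_ge_1[OF False] lu by (intro mult_left_mono) auto
        also have "\<dots> \<le> qf y (rvec p)" by (rule lu)
        finally show ?thesis .
      qed
      then have "\<mu> * qf y (rvec p) \<le> (qf y (rvec p))\<^sup>2"
        using qf_nonneg[OF y] by (simp add: power2_eq_square mult_right_mono)
      ultimately show ?thesis
        using False by (intro exI[of _ "cvec p"]) (auto simp: herm_cvec vec_eq_iff)
    next
      case True
      then have q: "q \<noteq> 0" using pq by simp
      have b: "bil (cvec q) (\<tau> *v cvec p + cvec q) = of_real ((norm (rvec q))\<^sup>2)"
        by (simp add: True bil_def rvec_def matrix_vector_mult_def power2_norm_eq_inner inner_vec_def)
      have "\<mu> * qf y (rvec q) \<le> 1 / u * (u * (norm (rvec q))\<^sup>2)"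
        using lu qf_nonneg[OF y] by (intro mult_mono) (auto simp: \<mu>_def)
      also have "\<dots> = 1 * (norm (rvec q))\<^sup>2" using lu by simp
      also have "\<dots> \<le> (norm (rvec q))\<^sup>2 * (norm (rvec q))\<^sup>2"
        using norm_rvec_ge_1[OF q] by (intro mult_right_mono) auto
      also have "\<dots> = (cmod (bil (cvec q) (\<tau> *v cvec p + cvec q)))\<^sup>2"
        unfolding b by (simp only: norm_of_real) (simp add: power2_eq_square)
      finally show ?thesis
        using q by (intro exI[of _ "cvec q"]) (auto simp: herm_cvec vec_eq_iff)
    qed
  qed
  moreover have "0 < \<mu>" using lu by (simp add: \<mu>_def)
  ultimately show ?thesis using that by blast
qed

text \<open>Vectors with p = 0 already decide: by Cauchy-Schwarz the hypothesis says y^{-1}[q] >=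
  \<mu>, and Hermite's inequality bounds det y^{-1} from below. As \<mu> is inherited along the
  orbit, so is the bound.\<close>

lemma period_lattice_min_imp_det_le:
  fixes \<tau> :: "complex^'n^'n"
  assumes \<tau>: "\<tau> \<in> siegel_space" "period_lattice_min \<mu> \<tau>" "0 < \<mu>" and K: "hermite_bound TYPE('n) K" "0 < K"
  shows "det (imag \<tau>) \<le> (K / \<mu>) powr real CARD('n)"
proof -
  define y where "y = imag \<tau>"
  have y: "posdef y" using \<tau> by (simp add: y_def siegel_space_iff)
  obtain B :: "real^'n^'n" where B1: "transpose B ** y ** B = mat 1"
    by (rule posdef_imp_congruent_mat_1[OF y])
  note B = B1 congruent_mat_1_posdef_inverse[OF B1] congruent_mat_1_det[OF B1] qf_mult_transpose
  obtain A :: "real^'n^'n" where A: "\<And>x. qf y x = (norm (A *v x))\<^sup>2" "\<And>x. B *v (A *v x) = x"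
    using posdef_eq_norm[OF B(1)] by blast
  have cs: "(x \<bullet> v)\<^sup>2 \<le> qf y x * qf (B ** transpose B) v" for x v
  proof -
    have "x \<bullet> v = (A *v x) \<bullet> (transpose B *v v)"
      using inner_matrix_vector[of "A *v x" "transpose B" v] A(2)[of x] by simp
    then show ?thesis
      using Cauchy_Schwarz_ineq[of "A *v x" "transpose B *v v"] by (simp add: A B power2_norm_eq_inner)
  qed
  have "\<mu> \<le> qf (B ** transpose B) (rvec q)" if q: "q \<noteq> 0" for q
  proof -
    obtain z where z: "z \<noteq> 0" "\<mu> * herm y z \<le> (cmod (bil z (\<tau> *v cvec 0 + cvec q)))\<^sup>2"
      using \<tau>(2) q unfolding period_lattice_min_def y_def by blast
    define a b where "a = (\<chi> i. Re (z $ i))" and "b = (\<chi> i. Im (z $ i))"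
    have "\<tau> *v cvec 0 = 0" by (simp add: vec_eq_iff matrix_vector_mult_def)
    then have "(cmod (bil z (\<tau> *v cvec 0 + cvec q)))\<^sup>2 = (a \<bullet> rvec q)\<^sup>2 + (b \<bullet> rvec q)\<^sup>2"
      by (simp add: bil_def cmod_power2 a_def b_def inner_vec_def rvec_def)
    also have "\<dots> \<le> qf y a * qf (B ** transpose B) (rvec q) + qf y b * qf (B ** transpose B) (rvec q)"
      by (intro add_mono cs)
    also have "\<dots> = qf (B ** transpose B) (rvec q) * herm y z"
      by (simp add: herm_def a_def b_def algebra_simps)
    finally have "\<mu> * herm y z \<le> qf (B ** transpose B) (rvec q) * herm y z" using z(2) by simp
    then show ?thesis using herm_pos[OF y z(1)] by simp
  qed
  then have "\<mu> \<le> K * det (B ** transpose B) powr (1 / real CARD('n))"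
    using K(1) B(2) \<tau>(3) unfolding hermite_bound_def by blast
  moreover have "det (B ** transpose B) = 1 / det y"
    using B(3) posdef_det_pos[OF y] by (simp add: det_mul field_simps power2_eq_square)
  ultimately have "\<mu> \<le> K / det y powr (1 / real CARD('n))"
    using posdef_det_pos[OF y] by (simp add: powr_divide)
  then have "det y powr (1 / real CARD('n)) \<le> K / \<mu>"
    using posdef_det_pos[OF y] \<tau>(3) by (simp add: field_simps)
  then have "(det y powr (1 / real CARD('n))) powr real CARD('n) \<le> (K / \<mu>) powr real CARD('n)"
    by (intro powr_mono2) auto
  then show ?thesis using posdef_det_pos[OF y] by (simp add: powr_powr y_def)
qed

text \<open>
  A point of the orbit whose imaginary part has nearly maximal determinant: a vector of square length
  below \<open>r\<close> could be moved to a diagonal entry, where an inversion would increase the determinant.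
\<close>
theorem exists_high_point:
  fixes \<tau> :: "complex^'n^'n"
  assumes \<tau>: "\<tau> \<in> siegel_space" and r: "0 < r" "r < sqrt 3 / 2"
  shows "\<exists>\<tau>'. siegel_move \<tau> \<tau>' \<and> (\<forall>v. v \<noteq> 0 \<longrightarrow> r \<le> qf (imag \<tau>') (rvec v))"
proof -
  obtain K where K: "0 < K" "hermite_bound TYPE('n) K" using blichfeldt by blast
  obtain \<mu> where \<mu>: "0 < \<mu>" "period_lattice_min \<mu> \<tau>" using exists_period_lattice_min[OF \<tau>] by blast
  define S where "S = {det (imag \<sigma>) | \<sigma>. siegel_move \<tau> \<sigma>}"
  have S0: "S \<noteq> {}" using siegel_move_refl[OF \<tau>] by (auto simp: S_def)
  have "s \<le> (K / \<mu>) powr real CARD('n)" if "s \<in> S" for s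
    using that period_lattice_min_imp_det_le[OF _ _ \<mu>(1) K(2,1)] \<mu>(2) unfolding S_def siegel_move_def by blast
  then have bdd: "bdd_above S" by (auto simp: bdd_above_def)
  have pos: "0 < s" if "s \<in> S" for s
    using that posdef_det_pos unfolding S_def siegel_move_def siegel_space_iff by blast
  have Sup0: "0 < Sup S" using S0 pos bdd by (metis cSup_upper ex_in_conv order_less_le_trans)
  \<comment> \<open>Bounds the squared modulus of a diagonal entry with real part at most 1/2 and
    imaginary part at most \<open>r\<close>. It is below 1 exactly because r < sqrt 3 / 2.\<close>
  define \<theta> where "\<theta> = 1/4 + r\<^sup>2"
  have "r\<^sup>2 < (sqrt 3 / 2)\<^sup>2" using r by (intro power_strict_mono) auto
  then have \<theta>: "\<theta> < 1" "0 < \<theta>" by (auto simp: \<theta>_def power_divide add_pos_nonneg)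
  then have "\<theta> * Sup S < Sup S" using Sup0 by simp
  then obtain \<sigma> where \<sigma>: "siegel_move \<tau> \<sigma>" "\<theta> * Sup S < det (imag \<sigma>)"
    using less_cSupD[OF S0] unfolding S_def by blast
  have \<sigma>H: "\<sigma> \<in> siegel_space" using siegel_move_in \<sigma> by blast
  have pd: "posdef (imag \<sigma>)" using \<sigma>H by (simp add: siegel_space_iff)
  obtain b where b: "imag \<sigma> = gram b" using posdef_imp_gram[OF pd] by blast
  have "r \<le> qf (imag \<sigma>) (rvec v)" if v: "v \<noteq> 0" for v
  proof (rule ccontr)
    assume "\<not> ?thesis"
    then have small: "qf (imag \<sigma>) (rvec v) < r" by simp
    fix k :: 'n
    \<comment> \<open>The short vector is \<open>d\<close> times a member of another basis; as d^2
      >= 1, that member is short as well and supplies diagonal entry \<open>k\<close>.\<close>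
    obtain c d where c: "transvections UNIV b c" "(\<Sum>j\<in>UNIV. of_int (v $ j) *\<^sub>R b j) = of_int d *\<^sub>R c k"
      using lattice_vector_multiple_of_basis_vector[of UNIV k b "\<lambda>j. v $ j"] by auto
    have q: "qf (imag \<sigma>) (rvec v) = (of_int d)\<^sup>2 * (norm (c k))\<^sup>2"
      using c(2) by (simp add: b qf_gram rvec_def power_mult_distrib)
    moreover have "0 < qf (imag \<sigma>) (rvec v)" using pd v by (simp add: posdef_def)
    ultimately have "d \<noteq> 0" by auto
    then have "1 \<le> d\<^sup>2" using zero_less_power2[of d] by linarith
    then have "1 \<le> (of_int d :: real)\<^sup>2" by (metis of_int_1 of_int_le_iff of_int_power)
    then have "1 * (norm (c k))\<^sup>2 \<le> (of_int d)\<^sup>2 * (norm (c k))\<^sup>2" by (intro mult_right_mono) auto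
    then have ck: "(norm (c k))\<^sup>2 < r" using q small by simp
    obtain \<sigma>1 where \<sigma>1: "siegel_move \<sigma> \<sigma>1" "imag \<sigma>1 = gram c" "det (imag \<sigma>1) = det (imag \<sigma>)"
      using siegel_move_transvections[OF c(1) \<sigma>H b] by blast
    have i1: "Im (\<sigma>1 $ k $ k) = (norm (c k))\<^sup>2"
      using \<sigma>1(2) by (auto simp: vec_eq_iff gram_def power2_norm_eq_inner)
    define N where "N = (\<chi> i j. if i = k \<and> j = k then - round (Re (\<sigma>1 $ k $ k)) else 0)"
    define \<sigma>2 where "\<sigma>2 = \<sigma>1 + cmat N"
    have \<sigma>2: "siegel_move \<sigma>1 \<sigma>2"
      unfolding \<sigma>2_def using siegel_move_in[OF \<sigma>1(1)]
      by (intro siegel_move_translation) (auto simp: N_def transpose_def vec_eq_iff)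
    have "imag \<sigma>2 = imag \<sigma>1" by (simp add: \<sigma>2_def vec_eq_iff)
    obtain \<sigma>3 where \<sigma>3: "siegel_move \<sigma>2 \<sigma>3" "det (imag \<sigma>3) * (cmod (\<sigma>2 $ k $ k))\<^sup>2 = det (imag \<sigma>2)"
      using siegel_move_inversion[OF siegel_move_in[OF \<sigma>2], of k] by blast
    have "Re (\<sigma>2 $ k $ k) = Re (\<sigma>1 $ k $ k) - of_int (round (Re (\<sigma>1 $ k $ k)))"
      by (simp add: \<sigma>2_def N_def)
    then have "\<bar>Re (\<sigma>2 $ k $ k)\<bar> \<le> 1/2"
      using of_int_round_abs_le[of "Re (\<sigma>1 $ k $ k)"] by (simp add: abs_minus_commute)
    then have "\<bar>Re (\<sigma>2 $ k $ k)\<bar>\<^sup>2 \<le> (1/2)\<^sup>2" by (intro power_mono) auto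
    moreover have "(Im (\<sigma>2 $ k $ k))\<^sup>2 \<le> r\<^sup>2"
      using ck i1 by (intro power_mono) (auto simp: \<sigma>2_def N_def)
    ultimately have "(cmod (\<sigma>2 $ k $ k))\<^sup>2 \<le> \<theta>"
      by (simp add: cmod_power2 \<theta>_def power_divide)
    moreover have "siegel_move \<tau> \<sigma>3"
      using \<sigma>(1) \<sigma>1(1) \<sigma>2 \<sigma>3(1) siegel_move_trans by blast
    then have "det (imag \<sigma>3) \<in> S" by (auto simp: S_def)
    then have "det (imag \<sigma>3) \<le> Sup S" "0 \<le> det (imag \<sigma>3)"
      using bdd pos by (auto intro: cSup_upper less_imp_le)
    ultimately have "det (imag \<sigma>2) \<le> Sup S * \<theta>"
      unfolding \<sigma>3(2)[symmetric] using Sup0 by (intro mult_mono) auto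
    then show False
      using \<sigma>(2) \<sigma>1(3) \<open>imag \<sigma>2 = imag \<sigma>1\<close> by (simp add: mult.commute)
  qed
  then show ?thesis using \<sigma>(1) by blast
qed

section \<open>A maximum principle on a half plane\<close>

text \<open>
  The maximum principle is applied to $h(s) e^{-2\pi i m s}$ with a further factor $e^{i\epsilon s}$,
  which makes the product vanish at infinity.
\<close>
lemma periodic_half_plane_maximum:
  fixes h :: "complex \<Rightarrow> complex"
  assumes hol: "h holomorphic_on {s. b0 < Im s}"
    and per: "\<And>s. b0 < Im s \<Longrightarrow> cmod (h (s + 1)) = cmod (h s)"
    and decay: "\<And>s. b \<le> Im s \<Longrightarrow> cmod (h s) \<le> C * exp (- 2 * pi * m * Im s)"
    and b: "b0 < b" "b < 0"
  shows "\<exists>x. cmod (h 0) * exp (- 2 * pi * m * b) \<le> cmod (h (Complex x b))"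
proof (rule ccontr)
  assume "\<not> ?thesis"
  then have less: "cmod (h (Complex x b)) < cmod (h 0) * exp (- 2 * pi * m * b)" for x
    by (simp add: not_le)
  define H where "H = cmod (h 0)"
  have "0 < H * exp (- 2 * pi * m * b)"
    using less[of 0] unfolding H_def by (meson norm_ge_zero order_le_less_trans)
  then have H: "0 < H" by (simp add: zero_less_mult_iff)
  have hc: "continuous_on {s. b0 < Im s} h" using hol by (rule holomorphic_on_imp_continuous_on)
  have "continuous_on {0..1} (\<lambda>x. cmod (h (Complex x b)) * exp (2 * pi * m * b))"
    unfolding Complex_eq using b
    by (intro continuous_intros continuous_on_compose2[OF hc]) auto
  then obtain x0 where x0: "x0 \<in> {0..1}" "\<And>x. x \<in> {0..1} \<Longrightarrow>
      cmod (h (Complex x b)) * exp (2 * pi * m * b) \<le> cmod (h (Complex x0 b)) * exp (2 * pi * m * b)"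
    using continuous_attains_sup[of "{0..1::real}"] by (metis (no_types, lifting) compact_Icc atLeastatMost_empty_iff2 zero_le_one)
  define M0 where "M0 = cmod (h (Complex x0 b)) * exp (2 * pi * m * b)"
  have "M0 < H * exp (- 2 * pi * m * b) * exp (2 * pi * m * b)"
    unfolding M0_def H_def using less[of x0] by (intro mult_strict_right_mono) auto
  then have M0: "M0 < H" "0 \<le> M0" by (simp_all add: M0_def mult.assoc flip: exp_add)
  \<comment> \<open>\<open>M0\<close> is the maximum of |h(s) e^{-2 pi i m s}| on the lower line.
    \<open>M1\<close> leaves a gap on both sides between it and \<open>H\<close>, the value at
    0.\<close>
  define M1 where "M1 = (M0 + H) / 2"
  have M1: "M0 < M1" "M1 < H" "0 < M1" using M0 H by (simp_all add: M1_def)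
  \<comment> \<open>On the lower line the damping factor has modulus exp (- \<epsilon> b) > 1, and
    this \<epsilon> raises \<open>M1\<close> exactly to \<open>H\<close>.\<close>
  define \<epsilon> where "\<epsilon> = ln (H / M1) / (- b)"
  have "0 < ln (H / M1)" using M1 by simp
  then have \<epsilon>: "0 < \<epsilon>" unfolding \<epsilon>_def using b by (intro divide_pos_pos) auto
  have "- \<epsilon> * b = ln (H / M1)" using b by (simp add: \<epsilon>_def)
  then have M1\<epsilon>: "M1 * exp (- \<epsilon> * b) = H" using M1 H by simp
  define T where "T = \<bar>C\<bar> / H / \<epsilon> + 1"
  have T: "0 < T" using H \<epsilon> by (simp add: T_def add_nonneg_pos)
  have "\<bar>C\<bar> / H < 1 + \<epsilon> * T" using H \<epsilon> by (simp add: T_def algebra_simps)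
  also have "\<dots> \<le> exp (\<epsilon> * T)" by (rule exp_ge_add_one_self)
  finally have CT: "\<bar>C\<bar> * exp (- \<epsilon> * T) < H" using H by (simp add: exp_minus field_simps)
  define G where "G s = h s * exp (\<i> * of_real (\<epsilon> - 2 * pi * m) * s)" for s
  have nG: "cmod (G s) = cmod (h s) * exp ((2 * pi * m - \<epsilon>) * Im s)" for s
    by (simp add: G_def norm_mult algebra_simps)
  have holG: "G holomorphic_on {s. b0 < Im s}"
    unfolding G_def by (intro holomorphic_intros hol)
  have contG: "continuous_on {s. b0 < Im s} G"
    using holG by (rule holomorphic_on_imp_continuous_on)
  have per_nat: "cmod (h (s + of_nat n)) = cmod (h s)" if "b0 < Im s" for s n
    using that by (induction n) (use per in \<open>auto simp flip: add.assoc simp: add.commute[of 1]\<close>)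
  have per_int: "cmod (G (s + of_int n)) = cmod (G s)" if "b0 < Im s" for s n
  proof (cases n)
    case (nonneg j)
    then show ?thesis using per_nat[OF that, of j] by (simp add: nG)
  next
    case (neg j)
    then show ?thesis using per_nat[of "s + of_int n" "Suc j"] that by (simp add: nG)
  qed
  \<comment> \<open>One period of the strip. The modulus of \<open>G\<close> is periodic, so a
    maximum on this compact cell is one on the whole strip; it is at least \<open>H\<close>, the
    value at 0, whereas both edges stay below \<open>H\<close>.\<close>
  define K where "K = cbox (Complex 0 b) (Complex 1 T)"
  have KI: "K \<subseteq> {s. b0 < Im s}" using b by (auto simp: K_def in_cbox_complex_iff)
  have "0 \<in> K" using b T by (simp add: K_def in_cbox_complex_iff)
  moreover have "continuous_on K (\<lambda>s. cmod (G s))"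
    by (intro continuous_on_norm continuous_on_subset[OF contG KI])
  ultimately obtain p where p: "p \<in> K" "\<And>s. s \<in> K \<Longrightarrow> cmod (G s) \<le> cmod (G p)"
    using continuous_attains_sup[of K "\<lambda>s. cmod (G s)"] unfolding K_def by (metis compact_cbox empty_iff)
  have Gp: "H \<le> cmod (G p)" using p(2)[OF \<open>0 \<in> K\<close>] by (simp add: nG H_def)
  have strip: "cmod (G s) \<le> cmod (G p)" if "b \<le> Im s" "Im s \<le> T" for s
  proof -
    define s' where "s' = s + of_int (- \<lfloor>Re s\<rfloor>)"
    have "s' \<in> K" using that by (simp add: s'_def K_def in_cbox_complex_iff) linarith
    moreover have "cmod (G s') = cmod (G s)" unfolding s'_def using that b by (intro per_int) simp
    ultimately show ?thesis using p(2) by metis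
  qed
  have low: "cmod (G s) < H" if "Im s = b" for s
  proof -
    define s' where "s' = s + of_int (- \<lfloor>Re s\<rfloor>)"
    have "cmod (G s) = cmod (G s')" unfolding s'_def using that b by (intro per_int[symmetric]) simp
    also have "s' = Complex (Re s') b" using that by (simp add: s'_def complex_eq_iff)
    also have "cmod (G (Complex (Re s') b)) = cmod (h (Complex (Re s') b)) * exp (2 * pi * m * b) * exp (- \<epsilon> * b)"
      by (simp add: nG mult.assoc algebra_simps flip: exp_add)
    also have "\<dots> \<le> M0 * exp (- \<epsilon> * b)"
      unfolding M0_def by (intro mult_right_mono x0) (auto simp: s'_def, linarith)
    also have "\<dots> < M1 * exp (- \<epsilon> * b)" using M1 by (intro mult_strict_right_mono) auto
    finally show ?thesis by (simp only: M1\<epsilon>)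
  qed
  have high: "cmod (G s) < H" if "Im s = T" for s
  proof -
    have "cmod (G s) \<le> C * exp (- 2 * pi * m * T) * exp ((2 * pi * m - \<epsilon>) * T)"
      unfolding nG that[symmetric] using decay[of s] that b T by (intro mult_right_mono) auto
    also have "\<dots> = C * exp (- \<epsilon> * T)" by (simp add: algebra_simps flip: exp_add)
    also have "\<dots> \<le> \<bar>C\<bar> * exp (- \<epsilon> * T)" by (intro mult_right_mono) auto
    finally show ?thesis using CT by simp
  qed
  define S where "S = {s. b < Im s \<and> Im s < T}"
  have "b \<le> Im p" "Im p \<le> T" using p(1) by (auto simp: K_def in_cbox_complex_iff)
  then have pS: "p \<in> S" using low[of p] high[of p] Gp by (force simp: S_def)
  have openS: "open S" unfolding S_def
    by (intro open_Collect_conj open_Collect_less continuous_intros)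
  have convS: "convex S"
  proof -
    have "S = {s. Im s > b} \<inter> {s. Im s < T}" by (auto simp: S_def)
    then show ?thesis by (simp add: convex_Int convex_halfspace_Im_gt convex_halfspace_Im_lt)
  qed
  \<comment> \<open>The maximum lies in the interior, so \<open>G\<close> is constant there;
    continuity carries the constant to the lower edge, where |G| < H.\<close>
  have "G constant_on S"
  proof (rule maximum_modulus_principle[OF _ openS _ openS subset_refl pS])
    show "G holomorphic_on S" using b by (intro holomorphic_on_subset[OF holG]) (auto simp: S_def)
    show "connected S" using convS by (rule convex_connected)
    show "cmod (G z) \<le> cmod (G p)" if "z \<in> S" for z using strip that by (simp add: S_def)
  qed
  then have const: "G s = G p" if "s \<in> S" for s using that pS by (auto simp: constant_on_def)
  have "Complex 0 b \<in> closure S"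
    unfolding closure_approachable
  proof (intro allI impI)
    fix e :: real assume e: "0 < e"
    define d where "d = min (e / 2) (T / 2)"
    have "Complex 0 (b + d) \<in> S" using e T b by (auto simp: S_def d_def min_def)
    moreover have "dist (Complex 0 (b + d)) (Complex 0 b) < e"
      using e T by (simp add: dist_norm complex_diff cmod_def d_def min_def)
    ultimately show "\<exists>y\<in>S. dist y (Complex 0 b) < e" by blast
  qed
  moreover have "closure S \<subseteq> {s. b0 < Im s}"
  proof -
    have "closure S \<subseteq> {s. b \<le> Im s}"
      by (intro closure_minimal closed_Collect_le continuous_intros) (auto simp: S_def)
    then show ?thesis using b by auto
  qed
  then have "continuous_on (closure S) G" by (rule continuous_on_subset[OF contG])
  ultimately have "G (Complex 0 b) = G p"
    using continuous_constant_on_closure const by metis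
  then show False using low[of "Complex 0 b"] Gp by simp
qed

section \<open>Fourier expansions and boundedness\<close>

abbreviation rmat :: "rat^'n^'m \<Rightarrow> real^'n^'m"
  where "rmat \<equiv> map_matrix of_rat"

definition fourier_min :: "(complex^'n^'n \<Rightarrow> complex) \<Rightarrow> real \<Rightarrow> bool"
  where "fourier_min f m \<longleftrightarrow>
    (\<forall>t v. fourier_coeff f t \<noteq> 0 \<longrightarrow> v \<noteq> 0 \<longrightarrow> m \<le> qf (rmat t) (rvec v))"

lemma of_rat_complex: "(of_rat q :: complex) = of_real (of_rat q)"
proof (cases q)
  case (Fract a b)
  then show ?thesis by (simp add: of_rat_rat)
qed

lemma norm_exp_tr:
  "cmod (exp_tr (map_matrix of_rat t ** \<tau>)) = exp (- 2 * pi * trace (rmat t ** imag \<tau>))"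
proof -
  have "Im (trace (map_matrix of_rat t ** \<tau>)) = trace (rmat t ** imag \<tau>)"
    by (simp add: trace_def matrix_matrix_mult_def of_rat_complex)
  then show ?thesis by (simp add: exp_tr_def norm_exp_eq_Re)
qed

lemma trace_mult_outer: "trace (t ** outer v) = qf t v"
  by (simp add: trace_def matrix_matrix_mult_def outer_def qf_def inner_vec_def matrix_vector_mult_def
      sum_distrib_left mult_ac)

text \<open>Shows that semidefinite \<open>t\<close> pair nonnegatively with Gram matrices.\<close>

lemma trace_mult_gram: "trace (t ** gram b) = (\<Sum>a\<in>UNIV. qf t (\<chi> i. b i $ a))"
proof -
  have "trace (t ** gram b) = (\<Sum>i\<in>UNIV. \<Sum>j\<in>UNIV. \<Sum>a\<in>UNIV. t $ i $ j * (b j $ a * b i $ a))"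
    by (simp add: trace_def matrix_matrix_mult_def gram_def inner_vec_def sum_distrib_left)
  also have "\<dots> = (\<Sum>i\<in>UNIV. \<Sum>a\<in>UNIV. \<Sum>j\<in>UNIV. t $ i $ j * (b j $ a * b i $ a))"
    by (intro sum.cong refl sum.swap)
  also have "\<dots> = (\<Sum>a\<in>UNIV. \<Sum>i\<in>UNIV. \<Sum>j\<in>UNIV. t $ i $ j * (b j $ a * b i $ a))"
    by (rule sum.swap)
  also have "\<dots> = (\<Sum>a\<in>UNIV. qf t (\<chi> i. b i $ a))"
    by (simp add: qf_def inner_vec_def matrix_vector_mult_def sum_distrib_left mult_ac)
  finally show ?thesis .
qed

lemma qf_psd_rat: "t \<in> psd_rat \<Longrightarrow> 0 \<le> qf (rmat t) x"
  by (simp add: psd_rat_def qf_def)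

lemma fourier_expansion:
  assumes "siegel_modular_form k f"
  shows "has_fourier_expansion f (fourier_coeff f)"
  using assms unfolding siegel_modular_form_def fourier_coeff_def by (metis someI_ex)

lemma fourier_coeff_psd:
  assumes "siegel_modular_form k f" "fourier_coeff f t \<noteq> 0"
  shows "t \<in> psd_rat"
  using fourier_expansion[OF assms(1)] assms(2) unfolding has_fourier_expansion_def by blast

text \<open>The series at \<tau> is compared term by term with the absolutely convergent one at a
  fixed \<tau>0, whose sum of moduli is \<open>C\<close>. What matters is that \<open>C\<close>
  depends neither on \<tau> nor on \<open>D\<close>.\<close>

lemma fourier_bound:
  fixes f :: "complex^'n^'n \<Rightarrow> complex"
  assumes f: "siegel_modular_form k f" and \<tau>0: "\<tau>0 \<in> siegel_space"
  obtains C where "0 \<le> C" "\<And>\<tau> D. \<tau> \<in> siegel_space \<Longrightarrow>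
    (\<And>t. fourier_coeff f t \<noteq> 0 \<Longrightarrow> D + trace (rmat t ** imag \<tau>0) \<le> trace (rmat t ** imag \<tau>)) \<Longrightarrow>
    cmod (f \<tau>) \<le> C * exp (- 2 * pi * D)"
proof -
  define G where "G \<tau> t = fourier_coeff f t * exp_tr (map_matrix of_rat t ** \<tau>)" for \<tau> t
  have hs: "(G \<tau> has_sum f \<tau>) psd_rat" if "\<tau> \<in> siegel_space" for \<tau>
    using fourier_expansion[OF f] that unfolding has_fourier_expansion_def G_def by blast
  then have abs: "(\<lambda>t. norm (G \<tau> t)) summable_on psd_rat" if "\<tau> \<in> siegel_space" for \<tau>
    using that has_sum_imp_summable summable_on_iff_abs_summable_on_complex by blast
  define C where "C = infsum (\<lambda>t. norm (G \<tau>0 t)) psd_rat"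
  show ?thesis
  proof (rule that[of C])
    show "0 \<le> C" unfolding C_def by (rule infsum_nonneg) simp
    fix \<tau> :: "complex^'n^'n" and D
    assume \<tau>: "\<tau> \<in> siegel_space"
      and D: "\<And>t. fourier_coeff f t \<noteq> 0 \<Longrightarrow> D + trace (rmat t ** imag \<tau>0) \<le> trace (rmat t ** imag \<tau>)"
    have le: "norm (G \<tau> t) \<le> norm (G \<tau>0 t) * exp (- 2 * pi * D)" for t
    proof (cases "fourier_coeff f t = 0")
      case False
      have "2 * pi * (D + trace (rmat t ** imag \<tau>0)) \<le> 2 * pi * trace (rmat t ** imag \<tau>)"
        using D[OF False] by (intro mult_left_mono) auto
      then have "exp (- 2 * pi * trace (rmat t ** imag \<tau>)) \<le> exp (- 2 * pi * trace (rmat t ** imag \<tau>0)) * exp (- 2 * pi * D)"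
        by (simp add: algebra_simps flip: exp_add)
      then have "cmod (fourier_coeff f t) * exp (- 2 * pi * trace (rmat t ** imag \<tau>))
        \<le> cmod (fourier_coeff f t) * (exp (- 2 * pi * trace (rmat t ** imag \<tau>0)) * exp (- 2 * pi * D))"
        by (rule mult_left_mono) simp
      then show ?thesis by (simp only: G_def norm_mult norm_exp_tr mult.assoc)
    qed (simp add: G_def)
    have "f \<tau> = infsum (G \<tau>) psd_rat" using hs[OF \<tau>] by (simp add: infsumI)
    then have "cmod (f \<tau>) \<le> infsum (\<lambda>t. norm (G \<tau> t)) psd_rat"
      using norm_infsum_bound[OF abs[OF \<tau>]] by simp
    also have "\<dots> \<le> infsum (\<lambda>t. norm (G \<tau>0 t) * exp (- 2 * pi * D)) psd_rat"
      by (intro infsum_mono abs[OF \<tau>] summable_on_cmult_left abs[OF \<tau>0] le)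
    also have "\<dots> = C * exp (- 2 * pi * D)"
      unfolding C_def by (rule infsum_cmult_left) (simp add: abs[OF \<tau>0])
    finally show "cmod (f \<tau>) \<le> C * exp (- 2 * pi * D)" .
  qed
qed

section \<open>Boundedness of the Petersson norm\<close>

lemma abs_det_le:
  fixes A :: "real^'n^'n"
  assumes "\<And>i j. \<bar>A $ i $ j\<bar> \<le> T"
  shows "\<bar>det A\<bar> \<le> fact CARD('n) * T ^ CARD('n)"
proof -
  have "\<bar>det A\<bar> \<le> (\<Sum>p | p permutes (UNIV :: 'n set). \<bar>of_int (sign p) * (\<Prod>i\<in>UNIV. A $ i $ p i)\<bar>)"
    unfolding det_def by (rule sum_abs)
  also have "\<dots> \<le> (\<Sum>p | p permutes (UNIV :: 'n set). T ^ CARD('n))"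
  proof (rule sum_mono)
    fix p :: "'n \<Rightarrow> 'n"
    have "(\<Prod>i\<in>UNIV. \<bar>A $ i $ p i\<bar>) \<le> (\<Prod>i\<in>(UNIV :: 'n set). T)"
      using assms by (intro prod_mono) auto
    then show "\<bar>of_int (sign p) * (\<Prod>i\<in>UNIV. A $ i $ p i)\<bar> \<le> T ^ CARD('n)"
      by (simp add: abs_mult abs_prod sign_def)
  qed
  also have "\<dots> = fact CARD('n) * T ^ CARD('n)"
    by (simp add: card_permutations[of UNIV "CARD('n)"])
  finally show ?thesis .
qed

lemma powr_times_exp_bounded:
  fixes a c x :: real
  assumes "0 \<le> a" "0 < c" "0 < x"
  shows "x powr a * exp (- c * x) \<le> exp (a * ln (a / c + 1))"
proof -
  \<comment> \<open>Large enough for a / s <= c, so that a ln x <= a ln s + c x; the summand 1 keeps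
    it positive for a = 0.\<close>
  define s where "s = a / c + 1"
  have s: "1 \<le> s" using assms by (simp add: s_def)
  have "ln (x / s) \<le> x / s"
    using ln_le_minus_one[of "x / s"] assms s by simp
  then have "ln x \<le> ln s + x / s"
    using assms s by (simp add: ln_div)
  then have "a * ln x \<le> a * (ln s + x / s)"
    using assms by (intro mult_left_mono) auto
  then have "a * ln x \<le> a * ln s + a * (x / s)"
    by (simp only: distrib_left)
  moreover have "a * (x / s) \<le> c * x"
  proof -
    have "a \<le> c * s" using assms by (simp add: s_def algebra_simps)
    then have "a * x \<le> c * s * x" using assms by (intro mult_right_mono) auto
    then show ?thesis using s by (simp add: divide_le_eq mult_ac)
  qed
  ultimately have "exp (a * ln x - c * x) \<le> exp (a * ln s)" by simp
  moreover have "x powr a * exp (- c * x) = exp (a * ln x - c * x)"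
    using assms by (simp add: powr_def flip: exp_add)
  ultimately show ?thesis by (simp add: s_def)
qed

text \<open>The norm is evaluated at an equivalent point whose imaginary part y is the Gram matrix
  of a reduced basis. With T the trace of y, \<open>f\<close> is at most a multiple of exp (- c T),
  while d0 <= det y <= g! T^g. The upper bound serves k >= 0, the lower one k < 0.\<close>

theorem peter_norm_bounded:
  fixes f :: "complex^'n^'n \<Rightarrow> complex"
  assumes f: "siegel_modular_form k f" and m: "0 < m" "fourier_min f m"
  obtains S where "\<And>\<tau>. \<tau> \<in> siegel_space \<Longrightarrow> peter_norm k f \<tau> \<le> S"
proof -
  obtain h where h: "0 < h" "hermite_bound TYPE('n) h" using blichfeldt by blast
  have "\<exists>K\<ge>1. \<forall>(b :: 'n \<Rightarrow> real^'n) r. 0 < r \<longrightarrow> lattice_min UNIV b r \<longrightarrow>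
    (\<exists>c. transvections UNIV b c \<and>
      (\<forall>x. (\<Sum>i\<in>UNIV. (norm (c i))\<^sup>2 * (x i)\<^sup>2) \<le> K * (norm (\<Sum>i\<in>UNIV. x i *\<^sub>R c i))\<^sup>2))"
    by (rule exists_reduced_basis) simp
  then obtain K where K: "1 \<le> K" and red: "\<And>(b :: 'n \<Rightarrow> real^'n) r. 0 < r \<Longrightarrow> lattice_min UNIV b r \<Longrightarrow>
    \<exists>c. transvections UNIV b c \<and>
      (\<forall>x. (\<Sum>i\<in>UNIV. (norm (c i))\<^sup>2 * (x i)\<^sup>2) \<le> K * (norm (\<Sum>i\<in>UNIV. x i *\<^sub>R c i))\<^sup>2)"
    by blast
  \<comment> \<open>Reduction leaves at least the sum of t_ii |e_i|^2 / (2 K) in the trace. Half of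
    it yields the decay m |e_i|^2 / (4 K); the other half is at least t_ii / (8 K), as |e_i|^2 >=
    1/2, and pays for the reference point.\<close>
  define \<tau>0 :: "complex^'n^'n" where "\<tau>0 = map_matrix (\<lambda>x. \<i> * of_real x) ((1 / (8 * K)) *\<^sub>R mat 1)"
  have i0: "imag \<tau>0 = (1 / (8 * K)) *\<^sub>R mat 1" by (simp add: \<tau>0_def vec_eq_iff)
  have "\<tau>0 \<in> siegel_space"
  proof -
    have "transpose \<tau>0 = \<tau>0" by (auto simp: \<tau>0_def vec_eq_iff transpose_def mat_def)
    moreover have "0 < qf (imag \<tau>0) x" if "x \<noteq> 0" for x
      unfolding i0 qf_scaleR_left qf_mat_1 using K that by (intro mult_pos_pos) auto
    moreover have "transpose (imag \<tau>0) = imag \<tau>0" unfolding i0 by (simp add: vec_eq_iff transpose_def mat_def)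
    ultimately show ?thesis by (simp add: siegel_space_iff posdef_def)
  qed
  then obtain C where C: "0 \<le> C" "\<And>\<tau> D. \<tau> \<in> siegel_space \<Longrightarrow>
    (\<And>t. fourier_coeff f t \<noteq> 0 \<Longrightarrow> D + trace (rmat t ** imag \<tau>0) \<le> trace (rmat t ** imag \<tau>)) \<Longrightarrow>
    cmod (f \<tau>) \<le> C * exp (- 2 * pi * D)"
    using fourier_bound[OF f] by blast
  define n where "n = real CARD('n)"
  have n: "0 < n" by (simp add: n_def)
  define d0 where "d0 = (1 / (2 * h)) powr n"
  have d0: "0 < d0" using h by (simp add: d0_def)
  define c where "c = 2 * pi * (m / (4 * K))"
  have c: "0 < c" using m K by (simp add: c_def)
  define S where "S = C * (d0 powr (k / 2) + (fact CARD('n)) powr (k / 2) * exp (n * (k / 2) * ln (n * (k / 2) / c + 1)))"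
  show ?thesis
  proof (rule that[of S])
    fix \<tau> :: "complex^'n^'n" assume \<tau>: "\<tau> \<in> siegel_space"
    have "sqrt 1 < sqrt 3" by (simp only: real_sqrt_less_iff)
    then have "(1/2 :: real) < sqrt 3 / 2" by simp
    then obtain \<tau>1 where \<tau>1: "siegel_move \<tau> \<tau>1" "\<And>v. v \<noteq> 0 \<Longrightarrow> 1/2 \<le> qf (imag \<tau>1) (rvec v)"
      using exists_high_point[OF \<tau>, of "1/2"] by auto
    have \<tau>1H: "\<tau>1 \<in> siegel_space" using siegel_move_in \<tau>1 by blast
    then have "posdef (imag \<tau>1)" by (simp add: siegel_space_iff)
    then obtain b where b: "imag \<tau>1 = gram b" using posdef_imp_gram by blast
    have lm: "lattice_min UNIV b (1/2)"
      unfolding lattice_min_def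
    proof (intro allI impI)
      fix p :: "'n \<Rightarrow> int" assume "\<exists>i\<in>UNIV. p i \<noteq> 0"
      then have "(\<chi> i. p i) \<noteq> 0" by (auto simp: vec_eq_iff)
      from \<tau>1(2)[OF this] show "1/2 \<le> (norm (\<Sum>i\<in>UNIV. of_int (p i) *\<^sub>R b i))\<^sup>2"
        by (simp add: b qf_gram rvec_def)
    qed
    then obtain e where e: "transvections UNIV b e"
      "\<And>x. (\<Sum>i\<in>UNIV. (norm (e i))\<^sup>2 * (x i)\<^sup>2) \<le> K * (norm (\<Sum>i\<in>UNIV. x i *\<^sub>R e i))\<^sup>2"
      using red[of "1/2" b] by auto
    obtain \<tau>2 where \<tau>2: "siegel_move \<tau>1 \<tau>2" "imag \<tau>2 = gram e"
      using siegel_move_transvections[OF e(1) \<tau>1H b] by blast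
    have \<tau>2H: "\<tau>2 \<in> siegel_space" using siegel_move_in \<tau>2 by blast
    then have pd: "posdef (gram e)" by (simp add: siegel_space_iff flip: \<tau>2(2))
    have lme: "lattice_min UNIV e (1/2)" using lattice_min_transvections[OF e(1) _ lm] by simp
    then have ei: "1/2 \<le> (norm (e i))\<^sup>2" for i by (rule lattice_minD1) auto
    define T where "T = (\<Sum>i\<in>UNIV. (norm (e i))\<^sup>2)"
    have eT: "(norm (e i))\<^sup>2 \<le> T" for i unfolding T_def by (rule member_le_sum) auto
    have "1/2 \<le> T" using order_trans[OF ei eT] .
    then have T: "0 < T" by simp
    have f2: "cmod (f \<tau>2) \<le> C * exp (- 2 * pi * (m / (4 * K) * T))"
    proof (rule C(2)[OF \<tau>2H])
      fix t assume t: "fourier_coeff f t \<noteq> 0"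
      have tii: "m \<le> rmat t $ i $ i" for i
      proof -
        have "m \<le> qf (rmat t) (rvec (axis i 1))"
          using m(2) t unfolding fourier_min_def by (simp add: axis_eq_0_iff)
        also have "rvec (axis i 1) = axis i 1" by (auto simp: rvec_def axis_def vec_eq_iff)
        also have "qf (rmat t) (axis i 1) = rmat t $ i $ i"
          by (simp add: qf_def inner_axis' matrix_vector_mult_basis column_def)
        finally show ?thesis .
      qed
      \<comment> \<open>Only half of the diagonal form bounded by reduction is subtracted, so
        \<open>z\<close> is positive definite and hence a Gram matrix.\<close>
      define z :: "real^'n^'n" where "z = gram e - (\<chi> i j. if i = j then (norm (e i))\<^sup>2 / (2 * K) else 0)"
      have qz: "qf z x = qf (gram e) x - (\<Sum>i\<in>UNIV. (norm (e i))\<^sup>2 * (x $ i)\<^sup>2) / (2 * K)" for x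
      proof -
        have "(\<chi> i j. if i = j then (norm (e i))\<^sup>2 / (2 * K) else 0) *v x
          = (\<chi> i. (norm (e i))\<^sup>2 / (2 * K) * x $ i)"
          by (simp add: vec_eq_iff matrix_vector_mult_def if_distrib[of "\<lambda>c. c * _"] cong: if_cong)
        then show ?thesis
          unfolding z_def qf_diff_left
          by (simp add: qf_def inner_vec_def[of x "\<chi> i. _ i"] sum_divide_distrib power2_eq_square mult_ac)
      qed
      have "posdef z"
        unfolding posdef_def
      proof (intro conjI allI impI)
        show "transpose z = z" by (auto simp: z_def transpose_def vec_eq_iff gram_def inner_commute)
        fix x :: "real^'n" assume "x \<noteq> 0"
        then have "0 < qf (gram e) x" using pd by (simp add: posdef_def)
        moreover have "(\<Sum>i\<in>UNIV. (norm (e i))\<^sup>2 * (x $ i)\<^sup>2) / (2 * K) \<le> qf (gram e) x / 2"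
          using e(2)[of "\<lambda>i. x $ i"] K by (simp add: qf_gram field_simps)
        ultimately show "0 < qf z x" unfolding qz by linarith
      qed
      then obtain a where "z = gram a" using posdef_imp_gram by blast
      then have "0 \<le> trace (rmat t ** z)"
        using qf_psd_rat[OF fourier_coeff_psd[OF f t]] by (simp add: trace_mult_gram sum_nonneg)
      moreover have "trace (rmat t ** (gram e - z)) = (\<Sum>i\<in>UNIV. rmat t $ i $ i * ((norm (e i))\<^sup>2 / (2 * K)))"
        by (simp add: z_def trace_def matrix_matrix_mult_def if_distrib[of "\<lambda>c. _ * c"] cong: if_cong)
      moreover have "trace (rmat t ** gram e) = trace (rmat t ** (gram e - z)) + trace (rmat t ** z)"
        by (simp add: matrix_diff_ldistrib flip: trace_add)
      ultimately have "(\<Sum>i\<in>UNIV. rmat t $ i $ i * ((norm (e i))\<^sup>2 / (2 * K))) \<le> trace (rmat t ** gram e)"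
        by linarith
      moreover have "(\<Sum>i\<in>UNIV. m / (4 * K) * (norm (e i))\<^sup>2 + rmat t $ i $ i * (1 / (8 * K)))
        \<le> (\<Sum>i\<in>UNIV. rmat t $ i $ i * ((norm (e i))\<^sup>2 / (2 * K)))"
      proof (rule sum_mono)
        fix i
        have "m * (norm (e i))\<^sup>2 \<le> rmat t $ i $ i * (norm (e i))\<^sup>2"
          using tii[of i] by (intro mult_right_mono) auto
        moreover have "rmat t $ i $ i * (1/2) \<le> rmat t $ i $ i * (norm (e i))\<^sup>2"
          by (rule mult_left_mono[OF ei order_trans[OF less_imp_le[OF m(1)] tii]])
        ultimately have "(m * (norm (e i))\<^sup>2 + rmat t $ i $ i * (1/2)) / (4 * K)
          \<le> (2 * (rmat t $ i $ i * (norm (e i))\<^sup>2)) / (4 * K)"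
          using K by (intro divide_right_mono) auto
        then show "m / (4 * K) * (norm (e i))\<^sup>2 + rmat t $ i $ i * (1 / (8 * K)) \<le> rmat t $ i $ i * ((norm (e i))\<^sup>2 / (2 * K))"
          by (simp add: add_divide_distrib mult.commute)
      qed
      moreover have "trace (rmat t ** imag \<tau>0) = (\<Sum>i\<in>UNIV. rmat t $ i $ i * (1 / (8 * K)))"
        unfolding i0 matrix_scaleR_right by (simp add: trace_def sum_divide_distrib)
      ultimately show "m / (4 * K) * T + trace (rmat t ** imag \<tau>0) \<le> trace (rmat t ** imag \<tau>2)"
        by (simp add: \<tau>2(2) T_def sum.distrib sum_distrib_left)
    qed
    define D where "D = det (gram e)"
    have D0: "0 < D" unfolding D_def by (rule posdef_det_pos[OF pd])
    have "\<bar>D\<bar> \<le> fact CARD('n) * T ^ CARD('n)"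
      unfolding D_def
    proof (rule abs_det_le)
      fix i j
      have "\<bar>e i \<bullet> e j\<bar> \<le> norm (e i) * norm (e j)" by (rule Cauchy_Schwarz_ineq2)
      also have "\<dots> \<le> ((norm (e i))\<^sup>2 + (norm (e j))\<^sup>2) / 2"
        using sum_squares_bound[of "norm (e i)" "norm (e j)"] by simp
      also have "\<dots> \<le> T" using eT[of i] eT[of j] by simp
      finally show "\<bar>gram e $ i $ j\<bar> \<le> T" by (simp add: gram_def)
    qed
    then have DT: "D \<le> fact CARD('n) * T powr n" using D0 T by (simp add: n_def powr_realpow)
    have "1/2 \<le> h * D powr (1 / n)"
    proof -
      have "1/2 \<le> qf (gram e) (rvec v)" if "v \<noteq> 0" for v
        using lme that unfolding lattice_min_def qf_gram by (auto simp: rvec_def vec_eq_iff)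
      then show ?thesis unfolding D_def n_def by (intro hermite_boundD[OF h(2) pd]) auto
    qed
    then have "1 / (2 * h) \<le> D powr (1 / n)" using h by (simp add: field_simps)
    then have "d0 \<le> (D powr (1 / n)) powr n" unfolding d0_def using n h by (intro powr_mono2) auto
    then have Dd: "d0 \<le> D" using D0 n by (simp add: powr_powr)
    have "peter_norm k f \<tau> = peter_norm k f \<tau>2"
      using \<tau>1(1) \<tau>2(1) f unfolding siegel_move_def by simp
    also have "\<dots> \<le> D powr (k / 2) * (C * exp (- c * T))"
    proof -
      have "- 2 * pi * (m / (4 * K) * T) = - c * T" by (simp add: c_def)
      then show ?thesis
        unfolding peter_norm_def \<tau>2(2) D_def[symmetric] using f2 by (intro mult_left_mono) simp_all
    qed
    also have "\<dots> = C * (D powr (k / 2) * exp (- c * T))" by simp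
    also have "\<dots> \<le> S"
      unfolding S_def
    proof (intro mult_left_mono C)
      show "D powr (k / 2) * exp (- c * T)
        \<le> d0 powr (k / 2) + (fact CARD('n)) powr (k / 2) * exp (n * (k / 2) * ln (n * (k / 2) / c + 1))"
      proof (cases "0 \<le> k")
        case True
        have "D powr (k / 2) \<le> (fact CARD('n) * T powr n) powr (k / 2)"
          using DT D0 True by (intro powr_mono2) auto
        also have "\<dots> = (fact CARD('n)) powr (k / 2) * T powr (n * (k / 2))"
          by (simp add: powr_mult powr_powr)
        finally have "D powr (k / 2) * exp (- c * T)
          \<le> (fact CARD('n)) powr (k / 2) * T powr (n * (k / 2)) * exp (- c * T)"
          by (intro mult_right_mono) auto
        also have "\<dots> \<le> (fact CARD('n)) powr (k / 2) * exp (n * (k / 2) * ln (n * (k / 2) / c + 1))"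
          unfolding mult.assoc[of _ "T powr _"]
          using powr_times_exp_bounded[of "n * (k / 2)" c T] True n c T by (intro mult_left_mono) auto
        finally show ?thesis using powr_ge_zero[of d0 "k / 2"] by linarith
      next
        case False
        have "D powr (k / 2) * exp (- c * T) \<le> d0 powr (k / 2) * 1"
          using Dd d0 False c T by (intro mult_mono powr_mono2') auto
        also have "\<dots> \<le> d0 powr (k / 2) + (fact CARD('n)) powr (k / 2) * exp (n * (k / 2) * ln (n * (k / 2) / c + 1))"
          by simp
        finally show ?thesis .
      qed
    qed
    finally show "peter_norm k f \<tau> \<le> S" .
  qed
qed

section \<open>The lower bound for the slope\<close>

abbreviation cscale :: "complex \<Rightarrow> complex^'n^'n \<Rightarrow> complex^'n^'n"
  where "cscale s \<equiv> map_matrix ((*) s)"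

lemma outer_rvec: "cmat (outer v) = map_matrix of_real (outer (rvec v))"
  by (simp add: vec_eq_iff outer_def rvec_def)

text \<open>The chain rule gives a real derivative along the line; complex linearity of
  \<open>L\<close> makes it multiplication by \<open>L V\<close>.\<close>

lemma siegel_line_holomorphic:
  fixes f :: "complex^'n^'n \<Rightarrow> complex"
  assumes f: "siegel_holomorphic f" and dom: "\<And>s. b < Im s \<Longrightarrow> \<tau> + cscale s V \<in> siegel_space"
  shows "(\<lambda>s. f (\<tau> + cscale s V)) holomorphic_on {s. b < Im s}"
proof (rule holomorphic_onI)
  fix s assume s: "s \<in> {s. b < Im s}"
  define g where "g s = \<tau> + cscale s V" for s
  obtain L where L: "(f has_derivative L) (at (g s) within siegel_space)"
    "\<And>c X. L (cscale c X) = c * L X"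
    using f dom s unfolding siegel_holomorphic_def g_def by blast
  have "linear (\<lambda>s. cscale s V)"
    by (rule linearI) (simp_all add: vec_eq_iff algebra_simps)
  then have "bounded_linear (\<lambda>s. cscale s V)" by (simp add: linear_conv_bounded_linear)
  then have "(g has_derivative (\<lambda>s. cscale s V)) (at s within {s. b < Im s})"
    unfolding g_def by (auto intro!: derivative_eq_intros bounded_linear_imp_has_derivative)
  moreover have "(f has_derivative L) (at (g s) within g ` {s. b < Im s})"
    by (rule has_derivative_subset[OF L(1)]) (use dom in \<open>auto simp: g_def\<close>)
  ultimately have "(f \<circ> g has_derivative L \<circ> (\<lambda>s. cscale s V)) (at s within {s. b < Im s})"
    by (rule diff_chain_within)
  moreover have "L \<circ> (\<lambda>s. cscale s V) = (*) (L V)"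
    by (simp add: fun_eq_iff L(2) mult.commute)
  ultimately have "(f \<circ> g has_field_derivative L V) (at s within {s. b < Im s})"
    by (simp add: has_field_derivative_def)
  then show "(\<lambda>s. f (\<tau> + cscale s V)) field_differentiable at s within {s. b < Im s}"
    unfolding field_differentiable_def o_def g_def by blast
qed

text \<open>
  Moving a point downwards along a rank one direction costs a bounded factor of the determinant,
  whereas the form grows by the maximum principle. The amount of the motion is bounded below because
  both the form \<open>y\<close> and its inverse satisfy Hermite's inequality.
\<close>
lemma peter_norm_gain:
  fixes f :: "complex^'n^'n \<Rightarrow> complex"
  assumes f: "siegel_modular_form k f" and m: "0 < m" "fourier_min f m"
    and K: "0 < K" "hermite_bound TYPE('n) K" "K < K'" and r: "0 < r" "r < sqrt 3 / 2"
    and \<beta>: "0 < \<beta>" "\<beta> < 1" and \<tau>: "\<tau> \<in> siegel_space"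
  shows "\<exists>\<sigma>\<in>siegel_space. peter_norm k f \<tau> * ((1 - \<beta>) powr (k / 2) * exp (2 * pi * m * \<beta> * (r / K'\<^sup>2)))
    \<le> peter_norm k f \<sigma>"
proof -
  obtain \<tau>1 where \<tau>1: "siegel_move \<tau> \<tau>1" "\<And>v. v \<noteq> 0 \<Longrightarrow> r \<le> qf (imag \<tau>1) (rvec v)"
    using exists_high_point[OF \<tau> r] by blast
  have \<tau>1H: "\<tau>1 \<in> siegel_space" using siegel_move_in \<tau>1 by blast
  define y where "y = imag \<tau>1"
  have y: "posdef y" and sym: "transpose \<tau>1 = \<tau>1" using \<tau>1H by (simp_all add: y_def siegel_space_iff)
  define n where "n = real CARD('n)"
  define D where "D = det y powr (1 / n)"
  have D: "0 < D" using posdef_det_pos[OF y] by (simp add: D_def)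
  have rD: "r \<le> K * D"
    using hermite_boundD[OF K(2) y r(1)] \<tau>1(2) by (simp add: D_def n_def y_def)
  obtain B :: "real^'n^'n" where B1: "transpose B ** y ** B = mat 1"
    by (rule posdef_imp_congruent_mat_1[OF y])
  note B = B1 congruent_mat_1_posdef_inverse[OF B1] congruent_mat_1_det[OF B1] qf_mult_transpose
  have "det (B ** transpose B) = 1 / det y"
    using B(3) posdef_det_pos[OF y] by (simp add: det_mul field_simps power2_eq_square)
  then have Dinv: "det (B ** transpose B) powr (1 / n) = 1 / D"
    using posdef_det_pos[OF y] by (simp add: powr_divide D_def)
  \<comment> \<open>Hermite's inequality for y^{-1}, whose determinant has n-th root 1/D; the slack
    K < K' produces a vector strictly below the bound.\<close>
  have "\<exists>v. v \<noteq> 0 \<and> qf (B ** transpose B) (rvec v) < K' / D"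
  proof (rule ccontr)
    assume "\<not> ?thesis"
    then have "K' / D \<le> qf (B ** transpose B) (rvec v)" if "v \<noteq> 0" for v using that by force
    then have "K' / D \<le> K * (1 / D)"
      using hermite_boundD[OF K(2) B(2), of "K' / D"] K D Dinv by (simp add: n_def)
    then show False using K D by (simp add: divide_le_cancel)
  qed
  then obtain v where v: "v \<noteq> 0" "qf (B ** transpose B) (rvec v) < K' / D" by blast
  define q where "q = (norm (transpose B *v rvec v))\<^sup>2"
  have "q = qf (B ** transpose B) (rvec v)" by (simp only: q_def qf_mult_transpose)
  then have q: "0 < q" "q < K' / D" using v B(2) by (simp_all add: posdef_def)
  define a where "a = 1 / q"
  have a: "0 < a" using q by (simp add: a_def)
  \<comment> \<open>The determinant cancels: r <= K D from \<open>y\<close> and q D < K' from its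
    inverse give r q <= K'^2.\<close>
  have "r / K'\<^sup>2 \<le> a"
  proof -
    have "q * D < K'" using q D by (simp add: field_simps)
    then have "r * q \<le> K * D * q" using rD q by (intro mult_right_mono) auto
    also have "\<dots> = K * (q * D)" by simp
    also have "\<dots> \<le> K' * K'" using K q D \<open>q * D < K'\<close> by (intro mult_mono) auto
    finally show ?thesis using q K by (simp add: a_def field_simps power2_eq_square)
  qed
  define V where "V = cmat (outer v)"
  define g where "g s = \<tau>1 + cscale s V" for s
  have imag_g: "imag (g s) = y - (- Im s) *\<^sub>R outer (rvec v)" for s
    by (simp add: g_def V_def y_def outer_rvec vec_eq_iff)
  have upd: "posdef (imag (g s))" "det (imag (g s)) = det y * (1 + Im s * q)" if "- a < Im s" for s
  proof -
    have "- Im s * q < 1" using that q by (simp add: a_def field_simps)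
    from posdef_rank_one_update[OF y B1, of "- Im s" "rvec v", folded q_def, OF this]
    show "posdef (imag (g s))" "det (imag (g s)) = det y * (1 + Im s * q)"
      unfolding imag_g by simp_all
  qed
  have gH: "g s \<in> siegel_space" if "- a < Im s" for s
  proof -
    have "transpose (g s) = g s"
      using sym by (simp add: g_def V_def outer_rvec vec_eq_iff transpose_def outer_def mult.commute)
    then show ?thesis using upd[OF that] by (simp add: siegel_space_iff)
  qed
  define b where "b = - \<beta> * a"
  have b: "- a < b" "b < 0" using a \<beta> by (simp_all add: b_def)
  define h where "h s = f (g s)" for s
  have "siegel_holomorphic f" using f by (simp add: siegel_modular_form_def)
  then have hol: "h holomorphic_on {s. - a < Im s}"
    unfolding h_def g_def by (rule siegel_line_holomorphic) (use gH in \<open>simp add: g_def\<close>)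
  have per: "cmod (h (s + 1)) = cmod (h s)" if s: "- a < Im s" for s
  proof -
    have "g (s + 1) = g s + V" by (simp add: g_def vec_eq_iff algebra_simps)
    then have "siegel_move (g s) (g (s + 1))"
      using siegel_move_translation[OF gH[OF s], of "outer v"] by (simp add: V_def)
    then have "peter_norm k f (g (s + 1)) = peter_norm k f (g s)"
      using f by (simp add: siegel_move_def)
    moreover have "imag (g (s + 1)) = imag (g s)" by (simp add: imag_g)
    ultimately show ?thesis
      using posdef_det_pos[OF upd(1)[OF s]] by (simp add: peter_norm_def h_def)
  qed
  \<comment> \<open>The reference point lies on the line Im s = b, which is still inside the domain;
    rising by Im s - b adds at least (Im s - b) m to each exponent.\<close>
  obtain C where C: "\<And>\<sigma> D. \<sigma> \<in> siegel_space \<Longrightarrow>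
    (\<And>t. fourier_coeff f t \<noteq> 0 \<Longrightarrow> D + trace (rmat t ** imag (g (\<i> * b))) \<le> trace (rmat t ** imag \<sigma>)) \<Longrightarrow>
    cmod (f \<sigma>) \<le> C * exp (- 2 * pi * D)"
    by (rule fourier_bound[OF f gH[of "\<i> * b"]]) (use b in auto)
  have decay: "cmod (h s) \<le> C * exp (2 * pi * m * b) * exp (- 2 * pi * m * Im s)" if s: "b \<le> Im s" for s
  proof -
    have "cmod (f (g s)) \<le> C * exp (- 2 * pi * ((Im s - b) * m))"
    proof (rule C)
      show "g s \<in> siegel_space" using s b by (intro gH) simp
      fix t assume t: "fourier_coeff f t \<noteq> 0"
      have "imag (g s) = imag (g (\<i> * b)) + (Im s - b) *\<^sub>R outer (rvec v)"
        by (simp add: imag_g algebra_simps)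
      then have "trace (rmat t ** imag (g s)) = trace (rmat t ** imag (g (\<i> * b))) + (Im s - b) * qf (rmat t) (rvec v)"
        by (simp add: matrix_add_ldistrib trace_add matrix_scaleR_right trace_mult_outer[symmetric])
          (simp add: trace_def sum_distrib_left)
      moreover have "(Im s - b) * m \<le> (Im s - b) * qf (rmat t) (rvec v)"
        using m(2) t v(1) s unfolding fourier_min_def by (intro mult_left_mono) auto
      ultimately show "(Im s - b) * m + trace (rmat t ** imag (g (\<i> * b))) \<le> trace (rmat t ** imag (g s))"
        by simp
    qed
    also have "exp (- 2 * pi * ((Im s - b) * m)) = exp (2 * pi * m * b) * exp (- 2 * pi * m * Im s)"
      by (simp add: algebra_simps flip: exp_add)
    finally show ?thesis by (simp add: h_def mult.assoc)
  qed
  obtain x where x: "cmod (h 0) * exp (- 2 * pi * m * b) \<le> cmod (h (Complex x b))"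
    using periodic_half_plane_maximum[OF hol per decay b] by blast
  define \<sigma> where "\<sigma> = g (Complex x b)"
  have \<sigma>H: "\<sigma> \<in> siegel_space" unfolding \<sigma>_def using b by (intro gH) simp
  have "det (imag \<sigma>) = det y * (1 - \<beta>)"
    using upd(2)[of "Complex x b"] b q by (simp add: \<sigma>_def b_def a_def)
  then have det\<sigma>: "det (imag \<sigma>) powr (k / 2) = det y powr (k / 2) * (1 - \<beta>) powr (k / 2)"
    by (simp add: powr_mult)
  have g0: "g 0 = \<tau>1" by (simp add: g_def vec_eq_iff)
  have "peter_norm k f \<tau> = peter_norm k f \<tau>1"
    using \<tau>1(1) f by (simp add: siegel_move_def)
  also have "\<dots> = det y powr (k / 2) * cmod (h 0)"
    by (simp add: peter_norm_def h_def g0 y_def)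
  finally have "peter_norm k f \<tau> * ((1 - \<beta>) powr (k / 2) * exp (2 * pi * m * \<beta> * (r / K'\<^sup>2)))
    = det y powr (k / 2) * (1 - \<beta>) powr (k / 2) * (cmod (h 0) * exp (2 * pi * m * \<beta> * (r / K'\<^sup>2)))"
    by simp
  also have "\<dots> \<le> det y powr (k / 2) * (1 - \<beta>) powr (k / 2) * (cmod (h 0) * exp (- 2 * pi * m * b))"
  proof -
    have "2 * pi * m * \<beta> * (r / K'\<^sup>2) \<le> 2 * pi * m * \<beta> * a"
      using m \<beta> \<open>r / K'\<^sup>2 \<le> a\<close> by (intro mult_left_mono) auto
    then have "exp (2 * pi * m * \<beta> * (r / K'\<^sup>2)) \<le> exp (- 2 * pi * m * b)"
      by (simp add: b_def mult_ac)
    then show ?thesis by (intro mult_left_mono mult_nonneg_nonneg) auto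
  qed
  also have "\<dots> \<le> det y powr (k / 2) * (1 - \<beta>) powr (k / 2) * cmod (h (Complex x b))"
    using x by (intro mult_left_mono) auto
  also have "\<dots> = peter_norm k f \<sigma>"
    by (simp only: peter_norm_def det\<sigma> h_def flip: \<sigma>_def)
  finally show ?thesis using \<sigma>H by blast
qed

text \<open>At \<beta> = 0 the logarithm of the gain is 0 with derivative c - k/2 > 0.\<close>

lemma exists_gain:
  fixes k c :: real
  assumes "k / 2 < c" "0 < c"
  obtains \<beta> where "0 < \<beta>" "\<beta> < 1" "1 < (1 - \<beta>) powr (k / 2) * exp (c * \<beta>)"
proof -
  have "\<exists>\<beta>>0. \<beta> < 1 \<and> 0 < k / 2 * ln (1 - \<beta>) + c * \<beta>"
  proof (cases "k \<le> 0")
    case True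
    have "0 \<le> k / 2 * ln (1 - 1/2)" using True by (intro mult_nonpos_nonpos) auto
    then show ?thesis using assms by (intro exI[of _ "1/2"]) simp
  next
    case False
    \<comment> \<open>Makes c (1 - \<beta>) the midpoint of c and k/2, so still above k/2, and ln (1
      - \<beta>) >= - \<beta> / (1 - \<beta>) suffices.\<close>
    define \<beta> where "\<beta> = (c - k / 2) / (2 * c)"
    have \<beta>: "0 < \<beta>" "\<beta> < 1" using assms False by (simp_all add: \<beta>_def field_simps)
    have "1 - 1 / (1 - \<beta>) \<le> ln (1 - \<beta>)"
      using ln_le_minus_one[of "1 / (1 - \<beta>)"] \<beta> by (simp add: ln_div)
    moreover have "1 - 1 / (1 - \<beta>) = - \<beta> / (1 - \<beta>)" using \<beta> by (simp add: field_simps)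
    ultimately have "k / 2 * (- \<beta> / (1 - \<beta>)) \<le> k / 2 * ln (1 - \<beta>)"
      using False by (intro mult_left_mono) auto
    moreover have "k / 2 / (1 - \<beta>) < c"
    proof -
      have "c * (1 - \<beta>) = (c + k / 2) / 2" using assms by (simp add: \<beta>_def field_simps)
      then have "k / 2 < c * (1 - \<beta>)" using assms by simp
      then show ?thesis using \<beta> by (subst pos_divide_less_eq) simp_all
    qed
    then have "k / 2 / (1 - \<beta>) * \<beta> < c * \<beta>" using \<beta> by (intro mult_strict_right_mono) auto
    ultimately have "0 < k / 2 * ln (1 - \<beta>) + c * \<beta>" by simp
    then show ?thesis using \<beta> by blast
  qed
  then obtain \<beta> where \<beta>: "0 < \<beta>" "\<beta> < 1" "0 < k / 2 * ln (1 - \<beta>) + c * \<beta>" by blast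
  have "1 < exp (k / 2 * ln (1 - \<beta>) + c * \<beta>)" using \<beta>(3) by simp
  also have "\<dots> = (1 - \<beta>) powr (k / 2) * exp (c * \<beta>)"
    using \<beta> by (simp add: powr_def exp_add)
  finally show ?thesis using that \<beta> by blast
qed

section \<open>Vanishing order and slope\<close>

lemma represents_rmat:
  "of_rat (\<Sum>i\<in>UNIV. \<Sum>j\<in>UNIV. of_int (v $ i) * t $ i $ j * of_int (v $ j)) = qf (rmat t) (rvec v)"
  by (simp add: qf_def inner_vec_def rvec_def matrix_vector_mult_def of_rat_sum of_rat_mult
      sum_distrib_left mult_ac)

definition represented_values :: "(complex^'n^'n \<Rightarrow> complex) \<Rightarrow> real set"
  where "represented_values f = {of_rat m | m. \<exists>t. fourier_coeff f t \<noteq> 0 \<and> represents t m}"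

lemma represented_values_iff:
  "s \<in> represented_values f \<longleftrightarrow>
    (\<exists>t v. fourier_coeff f t \<noteq> 0 \<and> v \<noteq> 0 \<and> s = qf (rmat t) (rvec v))"
  unfolding represented_values_def represents_def represents_rmat[symmetric] by blast

lemma represented_values_nonneg:
  assumes "siegel_modular_form k f" "s \<in> represented_values f"
  shows "0 \<le> s"
  using assms fourier_coeff_psd[OF assms(1)] qf_psd_rat by (auto simp: represented_values_iff)

lemma fourier_min_vanishing_order:
  fixes f :: "complex^'n^'n \<Rightarrow> complex"
  assumes f: "siegel_modular_form k f"
  shows "fourier_min f (vanishing_order f)"
  unfolding fourier_min_def
proof (intro allI impI)
  fix t :: "rat^'n^'n" and v :: "int^'n" assume "fourier_coeff f t \<noteq> 0" "v \<noteq> 0"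
  then have "qf (rmat t) (rvec v) \<in> represented_values f"
    by (auto simp: represented_values_iff)
  moreover have "bdd_below (represented_values f)"
    using represented_values_nonneg[OF f] by (auto simp: bdd_below_def)
  ultimately show "vanishing_order f \<le> qf (rmat t) (rvec v)"
    unfolding vanishing_order_def represented_values_def[symmetric] by (rule cInf_lower)
qed

text \<open>A nonzero value of \<open>f\<close> forces a nonzero coefficient, so the infimum is
  taken over a nonempty set of nonnegative numbers.\<close>

lemma vanishing_order_nonneg:
  fixes f :: "complex^'n^'n \<Rightarrow> complex"
  assumes f: "siegel_modular_form k f" and nz: "\<tau> \<in> siegel_space" "f \<tau> \<noteq> 0"
  shows "0 \<le> vanishing_order f"
proof -
  have "\<exists>t. fourier_coeff f t \<noteq> 0"
  proof (rule ccontr)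
    assume "\<not> ?thesis"
    then have "((\<lambda>t :: rat^'n^'n. 0) has_sum f \<tau>) psd_rat"
      using fourier_expansion[OF f] nz(1) unfolding has_fourier_expansion_def by simp
    then have "f \<tau> = 0" using infsumI by fastforce
    then show False using nz by simp
  qed
  then obtain t where t: "fourier_coeff f t \<noteq> 0" by blast
  then have "qf (rmat t) (rvec 1) \<in> represented_values f"
    unfolding represented_values_iff by (intro exI[of _ t] exI[of _ 1]) simp
  then show ?thesis
    unfolding vanishing_order_def represented_values_def[symmetric]
    using represented_values_nonneg[OF f] by (intro cInf_greatest) auto
qed

text \<open>A smaller slope would give a factor l > 1 by which the norm at any point is surpassed
  elsewhere. Started above \<open>Sup P / l\<close>, this exceeds the supremum, which is finite by
  boundedness and positive because f \<tau> is nonzero.\<close>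

lemma slope_lower_bound:
  fixes f :: "complex^'n^'n \<Rightarrow> complex"
  assumes f: "siegel_modular_form k f" and nz: "\<tau> \<in> siegel_space" "f \<tau> \<noteq> 0"
    and K: "0 < K" "hermite_bound TYPE('n) K" "K < K'" and r: "0 < r" "r < sqrt 3 / 2"
  shows "ereal (4 * pi * (r / K'\<^sup>2)) \<le> slope k f"
proof (cases "vanishing_order f = 0")
  case False
  define m where "m = vanishing_order f"
  have m: "0 < m" using False vanishing_order_nonneg[OF f nz] by (simp add: m_def)
  have mf: "fourier_min f m" unfolding m_def by (rule fourier_min_vanishing_order[OF f])
  have "4 * pi * (r / K'\<^sup>2) \<le> k / m"
  proof (rule ccontr)
    assume "\<not> ?thesis"
    then have "k < 4 * pi * (r / K'\<^sup>2) * m" using m by (simp add: not_le pos_divide_less_eq)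
    then have kc: "k / 2 < 2 * pi * m * (r / K'\<^sup>2)" by (simp add: mult_ac)
    have "0 < 2 * pi * m * (r / K'\<^sup>2)" using m r K by simp
    then obtain \<beta> where \<beta>: "0 < \<beta>" "\<beta> < 1" "1 < (1 - \<beta>) powr (k / 2) * exp (2 * pi * m * (r / K'\<^sup>2) * \<beta>)"
      using exists_gain[OF kc] by blast
    define l where "l = (1 - \<beta>) powr (k / 2) * exp (2 * pi * m * (r / K'\<^sup>2) * \<beta>)"
    have l: "1 < l" using \<beta>(3) by (simp only: l_def)
    have gain: "\<exists>\<sigma>\<in>siegel_space. peter_norm k f \<tau> * l \<le> peter_norm k f \<sigma>" if "\<tau> \<in> siegel_space" for \<tau>
      using peter_norm_gain[OF f m mf K r \<beta>(1,2) that] by (simp add: l_def mult_ac)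
    obtain S where S: "\<And>\<tau>. \<tau> \<in> siegel_space \<Longrightarrow> peter_norm k f \<tau> \<le> S"
      using peter_norm_bounded[OF f m mf] by blast
    define P where "P = peter_norm k f ` siegel_space"
    have bdd: "bdd_above P" using S by (auto simp: P_def bdd_above_def)
    have "0 < det (imag \<tau>)" using nz(1) posdef_det_pos by (auto simp: siegel_space_iff)
    then have "0 < peter_norm k f \<tau>" using nz by (simp add: peter_norm_def)
    also have "\<dots> \<le> Sup P" using nz bdd by (intro cSup_upper) (auto simp: P_def)
    finally have "Sup P / l < Sup P" using l by (simp add: divide_less_eq)
    moreover have "P \<noteq> {}" using nz by (auto simp: P_def)
    ultimately obtain \<tau>1 where \<tau>1: "\<tau>1 \<in> siegel_space" "Sup P / l < peter_norm k f \<tau>1"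
      using less_cSupD[of P] unfolding P_def by blast
    obtain \<sigma> where \<sigma>: "\<sigma> \<in> siegel_space" "peter_norm k f \<tau>1 * l \<le> peter_norm k f \<sigma>"
      using gain[OF \<tau>1(1)] by blast
    have "Sup P < peter_norm k f \<tau>1 * l"
      using \<tau>1(2) l by (simp add: divide_less_eq)
    also note \<sigma>(2)
    also have "peter_norm k f \<sigma> \<le> Sup P" using \<sigma> bdd by (intro cSup_upper) (auto simp: P_def)
    finally show False by simp
  qed
  then show ?thesis using False by (simp add: slope_def m_def)
qed (simp add: slope_def)

thm_deps slope_lower_bound blichfeldt

theorem theorem1p2:
  shows "minimal_slope TYPE('n::finite) >
    ereal (sqrt 3 * pi ^ 3 / 2 * Gamma (2 + real CARD('n) / 2) powr (- (4 / real CARD('n))))"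
proof -
  define G where "G = Gamma (2 + real CARD('n) / 2) powr (2 / real CARD('n))"
  have Gamma: "0 < Gamma (2 + real CARD('n) / 2)" by (intro Gamma_real_pos) (simp add: add_pos_nonneg)
  then have G: "0 < G" unfolding G_def powr_gt_zero by (metis less_irrefl)
  have G2: "Gamma (2 + real CARD('n) / 2) powr (- (4 / real CARD('n))) = 1 / G\<^sup>2"
  proof -
    have "G\<^sup>2 = Gamma (2 + real CARD('n) / 2) powr (2 / real CARD('n) + 2 / real CARD('n))"
      by (simp only: G_def power2_eq_square powr_add)
    also have "2 / real CARD('n) + 2 / real CARD('n) = 4 / real CARD('n)"
      by simp
    finally show ?thesis by (simp only: powr_minus inverse_eq_divide)
  qed
  \<comment> \<open>Blichfeldt's bound; 4 pi (sqrt 3 / 2) / \<gamma>^2 is the claimed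
    constant.\<close>
  define \<gamma> where "\<gamma> = 2 / pi * G"
  have \<gamma>: "0 < \<gamma>" using G by (simp add: \<gamma>_def)
  obtain K where K: "0 < K" "K < \<gamma>" "hermite_bound TYPE('n) K"
    unfolding \<gamma>_def G_def by (rule blichfeldt)
  define K' where "K' = (K + \<gamma>) / 2"
  have K': "K < K'" "K' < \<gamma>" "0 < K'" using K by (simp_all add: K'_def)
  have lt: "(K' / \<gamma>)\<^sup>2 < 1"
    using K' \<gamma> power_strict_mono[of "K' / \<gamma>" 1 2] by simp
  \<comment> \<open>r / (sqrt 3 / 2) is the midpoint of (K'/\<gamma>)^2 and 1: \<open>r\<close>
    stays below sqrt 3 / 2, and r / K'^2 still exceeds (sqrt 3 / 2) / \<gamma>^2.\<close>
  define r where "r = sqrt 3 / 2 * (((K' / \<gamma>)\<^sup>2 + 1) / 2)"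
  have r: "0 < r" unfolding r_def by (intro mult_pos_pos) (auto simp: add_nonneg_pos)
  have "r < sqrt 3 / 2 * 1" unfolding r_def using lt by (intro mult_strict_left_mono) auto
  then have r': "r < sqrt 3 / 2" by simp
  have "sqrt 3 * pi ^ 3 / 2 * (1 / G\<^sup>2) = 2 * pi * sqrt 3 / \<gamma>\<^sup>2"
    using G by (simp add: \<gamma>_def field_simps power2_eq_square power3_eq_cube)
  also have "\<dots> = 4 * pi * (sqrt 3 / 2 * (K' / \<gamma>)\<^sup>2 / K'\<^sup>2)"
    using K' \<gamma> by (simp add: field_simps)
  also have "\<dots> < 4 * pi * (r / K'\<^sup>2)"
    unfolding r_def using lt K'
    by (intro mult_strict_left_mono divide_strict_right_mono) auto
  finally have "ereal (sqrt 3 * pi ^ 3 / 2 * (1 / G\<^sup>2)) < ereal (4 * pi * (r / K'\<^sup>2))"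
    by simp
  \<comment> \<open>This bound depends on neither the weight nor the form, so the strict inequality
    survives the infimum.\<close>
  also have "\<dots> \<le> minimal_slope TYPE('n)"
    unfolding minimal_slope_def
    using slope_lower_bound[OF _ _ _ K(1,3) K'(1) r r'] by (intro Inf_greatest) auto
  finally show ?thesis by (simp only: G2)
qed

end
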